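(* Let $(G,\sim,\mathcal{R})$ be a framed turbulence chart. Then $p\mapsto\mathcal{I}(p)$ is a bijection from the elementary routes of $(G,\sim,\mathcal{R})$ (up to equivalence) to the vertices of $\mathcal F_1(G,\sim)$, and $B\mapsto\mathcal{I}(B)$ is a bijection from the self-compatible elementary bands of $(G,\sim,\mathcal{R})$ (up to equivalence) to the extremal rays of $\mathcal F_1(G,\sim)$.
   Context: All graphs are finite undirected graphs (loops and multiple edges allowed) in which every vertex is incident to at least one edge. A vertex is fringe if it is incident to exactly one edge (a loop counts twice) and internal otherwise; an edge is fringe if incident to a fringe vertex. A half-edge is a pair $(e,v)$ with $v$ an endpoint of $e$; every edge, including a loop, has exactly two half-edges. A turbulence chart $(G,\sim)$ is such a graph $G$ (edge set $E$) together with, for every internal vertex $v$, an equivalence relation $\sim_v$ on the half-edges at $v$ having exactly two nonempty classes. A flow is $F:E\to\mathbb R$ such that at every internal vertex $v$, the sum of $F(e)$ over half-edges $(e,v)$ in one class of $\sim_v$ equals the corresponding sum over the other class; it is nonnegative if $F\ge 0$; its strength is $\frac12\sum_{e\text{ fringe}}F(e)$; it is unit if its strength is $1$. The turbulence polyhedron $\mathcal F_1(G,\sim)\subseteq\mathbb R^E$ is the set of unit nonnegative flows. An oriented edge is an ordering $\tilde e=e^te^h$ of the two half-edges of an edge $e$; it starts at the vertex $t(\tilde e)$ of $e^t$ and ends at the vertex $h(\tilde e)$ of $e^h$; $\tilde e^{-1}=e^he^t$. A string is a sequence $\tilde e_1\cdots\tilde e_m$ of oriented edges with $h(\tilde e_j)=t(\tilde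 e_{j+1})$ and with $e_j^h$ and $e_{j+1}^t$ in different classes of $\sim_{h(\tilde e_j)}$ for all $j<m$; there are also lazy strings $e_v$ of length $0$ at each vertex. Substrings are contiguous subsequences (including lazy strings at visited vertices); the inverse string reverses and inverts. A route is a string starting and ending at fringe vertices; a route is identified with its inverse. A band is a string $B$ such that $BB$ is a string and $B$ is not a power of a strictly shorter string; substrings of a band are substrings of its powers; bands are identified up to cyclic rotation and inversion. A trail is a route or band. The indicator vector $\mathcal I(p)\in\mathbb R^E$ of a trail records, for each edge, the number of times the trail traverses it. A framing $\mathcal R$ assigns a linear order to each of the two classes of $\sim_v$ for each internal $v$. An incompatibility is a pair $(\tilde e_1 s\tilde f_1,\tilde e_2 s\tilde f_2)$ of strings where $\tilde e_1,\tilde e_2$ end at an internal vertex $v$ with $\tilde e_1^h,\tilde e_2^h$ in the same class of $\sim_v$ and $\tilde e_1^h<_{\mathcal R}\tilde e_2^h$, $\tilde f_1,\tilde f_2$ start at an internal vertex $w$ with $\tilde f_1^t,\tilde f_2^t$ in the same class of $\sim_w$ and $\tilde f_1^t<_{\mathcal R}\tilde f_2^t$, and $s$ is a (possibly lazy) string with $\tilde e_1s\tilde f_1$ a string. Two trails $p,q$ are incompatible if, after possibly swapping them, some substring $p'$ of $p$ (or $p^{-1}$) and $q'$ of $q$ (or $q^{-1}$) form an incompatibility $(p',q')$; otherwise compatible. A trail is self-compatible if it is compatible with itself. A route is simple if it visits no vertex twice, and a lollipop if it has the form $s\sigma s^{-1}$ for strings $s,\sigma$ where every vertex of $s$ is visited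 exactly twice and every other vertex exactly once. An elementary route is a self-compatible route that is simple or a lollipop. A band is simple if it visits no vertex twice, and a barbell if up to cyclic rotation it has the form $s\sigma_1s^{-1}\sigma_2$ where every vertex of $s$ is visited exactly twice and every other vertex once; a band is elementary if it is simple or a barbell. Extremal rays of a pointed polyhedron are the elements (up to positive scaling) of a minimal generating set of its recession cone.
   Formalization: Strength counts an edge joining two fringe vertices once per fringe endpoint (otherwise its route is not a unit flow), and a barbell with lazy s must have σ1 start and end with half-edges in the same class of ∼ (otherwise σ1σ2 may be a sum of two bands). *)

theory Defs
  imports "HOL-Analysis.Analysis" "HOL-Library.Sublist"
begin

text \<open>
  The edge set of the graph is a finite type \<open>'e\<close>. The two half-edges of an edge \<open>e\<close> are
  \<open>(e, False)\<close> and \<open>(e, True)\<close>, also when \<open>e\<close> is a loop. As every vertex is incident to an edge,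
  the graph is determined by the map \<open>vert\<close> sending a half-edge to its vertex, and the vertex set
  is the range of this map. The relation \<open>sim v\<close> is only meaningful at internal vertices.
\<close>

type_synonym 'e half_edge = "'e \<times> bool"

record ('v, 'e) chart =
  vert :: "'e half_edge \<Rightarrow> 'v"
  sim :: "'v \<Rightarrow> 'e half_edge rel"

definition half_edges_at :: "('v, 'e) chart \<Rightarrow> 'v \<Rightarrow> 'e half_edge set" where
  "half_edges_at G v = {x. vert G x = v}"

definition fringe :: "('v, 'e) chart \<Rightarrow> 'v \<Rightarrow> bool" where
  "fringe G v \<longleftrightarrow> card (half_edges_at G v) = 1"

definition internal :: "('v, 'e) chart \<Rightarrow> 'v \<Rightarrow> bool" where
  "internal G v \<longleftrightarrow> v \<in> range (vert G) \<and> \<not> fringe G v"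

definition turbulence_chart :: "('v, 'e::finite) chart \<Rightarrow> bool" where
  "turbulence_chart G \<longleftrightarrow>
     (\<forall>v. internal G v \<longrightarrow>
        equiv (half_edges_at G v) (sim G v) \<and> card (half_edges_at G v // sim G v) = 2)"

type_synonym ('v, 'e) framing = "'v \<Rightarrow> 'e half_edge set \<Rightarrow> 'e half_edge rel"

text \<open>\<open>R v C\<close> is the (reflexive) linear order on the class \<open>C\<close> of half-edges at \<open>v\<close>.\<close>

definition is_framing :: "('v, 'e) chart \<Rightarrow> ('v, 'e) framing \<Rightarrow> bool" where
  "is_framing G R \<longleftrightarrow>
     (\<forall>v. internal G v \<longrightarrow> (\<forall>C \<in> half_edges_at G v // sim G v. linear_order_on C (R v C)))"

definition same_class :: "('v, 'e) chart \<Rightarrow> 'e half_edge \<Rightarrow> 'e half_edge \<Rightarrow> bool" where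
  "same_class G x y \<longleftrightarrow>
     internal G (vert G x) \<and> vert G x = vert G y \<and> (x, y) \<in> sim G (vert G x)"

definition different_classes :: "('v, 'e) chart \<Rightarrow> 'e half_edge \<Rightarrow> 'e half_edge \<Rightarrow> bool" where
  "different_classes G x y \<longleftrightarrow>
     internal G (vert G x) \<and> vert G x = vert G y \<and> (x, y) \<notin> sim G (vert G x)"

definition framing_less ::
    "('v, 'e) chart \<Rightarrow> ('v, 'e) framing \<Rightarrow> 'e half_edge \<Rightarrow> 'e half_edge \<Rightarrow> bool" where
  "framing_less G R x y \<longleftrightarrow>
     same_class G x y \<and> x \<noteq> y \<and> (x, y) \<in> R (vert G x) (sim G (vert G x) `` {x})"


section \<open>Flows\<close>

definition is_flow :: "('v, 'e::finite) chart \<Rightarrow> real ^ 'e \<Rightarrow> bool" where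
  "is_flow G F \<longleftrightarrow>
     (\<forall>v. internal G v \<longrightarrow>
        (\<forall>C \<in> half_edges_at G v // sim G v. \<forall>D \<in> half_edges_at G v // sim G v.
           (\<Sum>x\<in>C. F $ fst x) = (\<Sum>x\<in>D. F $ fst x)))"

text \<open>
  The sum over fringe edges counts an edge once for each of its fringe endpoints. This only
  matters for an edge joining two fringe vertices (a connected component consisting of one edge).
  Such an edge is by itself a route, and routes are meant to have unit indicator vectors.
  See \<open>strength_eq\<close>.
\<close>

definition strength :: "('v, 'e::finite) chart \<Rightarrow> real ^ 'e \<Rightarrow> real" where
  "strength G F = (\<Sum>x | fringe G (vert G x). F $ fst x) / 2"

definition fringe_edge :: "('v, 'e) chart \<Rightarrow> 'e \<Rightarrow> bool" where
  "fringe_edge G e \<longleftrightarrow> (\<exists>b. fringe G (vert G (e, b)))"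

lemma strength_eq:
  assumes "\<And>e. \<not> (fringe G (vert G (e, False)) \<and> fringe G (vert G (e, True)))"
  shows "strength G F = (1 / 2) * (\<Sum>e | fringe_edge G e. F $ e)"
proof -
  have "inj_on fst {x. fringe G (vert G x)}"
  proof (rule inj_onI)
    fix x y
    assume "x \<in> {x. fringe G (vert G x)}" "y \<in> {x. fringe G (vert G x)}" "fst x = fst y"
    then show "x = y"
      using assms[of "fst x"] by (cases x; cases y; cases "snd x"; cases "snd y") auto
  qed
  moreover have "{e. fringe_edge G e} = fst ` {x. fringe G (vert G x)}"
    by (force simp: fringe_edge_def image_def)
  ultimately show ?thesis
    by (simp add: strength_def sum.reindex)
qed

definition nonneg_flows_of_strength :: "('v, 'e::finite) chart \<Rightarrow> real \<Rightarrow> (real ^ 'e) set" where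
  "nonneg_flows_of_strength G c = {F. is_flow G F \<and> (\<forall>e. F $ e \<ge> 0) \<and> strength G F = c}"

definition turbulence_polyhedron :: "('v, 'e::finite) chart \<Rightarrow> (real ^ 'e) set" where
  "turbulence_polyhedron G = nonneg_flows_of_strength G 1"

text \<open>
  The recession cone of a polyhedron \<open>{x. A x \<le> b}\<close> is \<open>{x. A x \<le> 0}\<close>. This makes sense also for
  charts without fringe vertices, whose turbulence polyhedron is empty. For a nonempty polyhedron
  it is the set of directions in which one can move forever, see \<open>turbulence_recession_cone_eq\<close>.
\<close>

definition turbulence_recession_cone :: "('v, 'e::finite) chart \<Rightarrow> (real ^ 'e) set" where
  "turbulence_recession_cone G = nonneg_flows_of_strength G 0"

lemma is_flow_add: "is_flow G F \<Longrightarrow> is_flow G F' \<Longrightarrow> is_flow G (F + F')"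
  unfolding is_flow_def
  by (intro allI impI ballI, unfold vector_add_component sum.distrib)
    (intro arg_cong2[where f = "(+)"]; blast)

lemma is_flow_scale: "is_flow G F \<Longrightarrow> is_flow G (c *\<^sub>R F)"
  unfolding is_flow_def
  by (intro allI impI ballI, unfold vector_scaleR_component scaleR_sum_right[symmetric])
    (intro arg_cong2[where f = scaleR] refl; blast)

lemma strength_add: "strength G (F + F') = strength G F + strength G F'"
  by (simp add: strength_def sum.distrib add_divide_distrib)

lemma strength_scale: "strength G (c *\<^sub>R F) = c * strength G F"
  by (simp add: strength_def flip: sum_distrib_left)

lemma turbulence_recession_cone_eq:
  assumes "turbulence_polyhedron G \<noteq> {}"
  shows "turbulence_recession_cone G =
    {d. \<forall>x \<in> turbulence_polyhedron G. \<forall>t\<ge>0. x + t *\<^sub>R d \<in> turbulence_polyhedron G}"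
proof (intro subset_antisym subsetI)
  fix d assume "d \<in> turbulence_recession_cone G"
  then show "d \<in> {d. \<forall>x \<in> turbulence_polyhedron G. \<forall>t\<ge>0. x + t *\<^sub>R d \<in> turbulence_polyhedron G}"
    by (auto simp: turbulence_recession_cone_def turbulence_polyhedron_def
        nonneg_flows_of_strength_def is_flow_add is_flow_scale strength_add strength_scale)
next
  fix d
  assume d: "d \<in> {d. \<forall>x \<in> turbulence_polyhedron G. \<forall>t\<ge>0. x + t *\<^sub>R d \<in> turbulence_polyhedron G}"
  obtain x where x: "x \<in> turbulence_polyhedron G"
    using assms by auto
  have xd: "x + t *\<^sub>R d \<in> turbulence_polyhedron G" if "t \<ge> 0" for t
    using d x that by auto
  have d_eq: "d = (x + 1 *\<^sub>R d) + (-1) *\<^sub>R x"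
    by simp
  have "is_flow G ((x + 1 *\<^sub>R d) + (-1) *\<^sub>R x)"
    using xd[of 1] x unfolding turbulence_polyhedron_def nonneg_flows_of_strength_def
    by (intro is_flow_add[of G "x + 1 *\<^sub>R d"] is_flow_scale) auto
  then have "is_flow G d"
    by (simp only: d_eq[symmetric])
  moreover have "strength G d = 0"
    using xd[of 1] x
    by (simp add: turbulence_polyhedron_def nonneg_flows_of_strength_def strength_add)
  moreover have "d $ e \<ge> 0" for e
  proof (rule ccontr)
    assume neg: "\<not> d $ e \<ge> 0"
    have xe: "x $ e \<ge> 0"
      using x by (simp add: turbulence_polyhedron_def nonneg_flows_of_strength_def)
    define t where "t = (x $ e + 1) / (- (d $ e))"
    have "t \<ge> 0"
      using neg xe by (simp add: t_def divide_nonneg_neg)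
    then have "x $ e + t * d $ e \<ge> 0"
      using xd[of t] by (simp add: turbulence_polyhedron_def nonneg_flows_of_strength_def)
    moreover have "t * d $ e = - (x $ e + 1)"
      using neg by (simp add: t_def)
    ultimately show False
      by simp
  qed
  ultimately show "d \<in> turbulence_recession_cone G"
    by (simp add: turbulence_recession_cone_def nonneg_flows_of_strength_def)
qed


section \<open>Extremal rays\<close>

definition minimal_generating_set :: "'a::real_vector set \<Rightarrow> 'a set \<Rightarrow> bool" where
  "minimal_generating_set C S \<longleftrightarrow>
     convex_cone hull S = C \<and> (\<forall>T. T \<subset> S \<longrightarrow> convex_cone hull T \<noteq> C)"

definition ray :: "'a::real_vector \<Rightarrow> 'a set" where
  "ray x = {t *\<^sub>R x | t. t > 0}"

definition extremal_rays :: "'a::real_vector set \<Rightarrow> 'a set set" where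
  "extremal_rays C = {ray x | x S. minimal_generating_set C S \<and> x \<in> S}"


section \<open>Strings\<close>

text \<open>
  An oriented edge is represented by its tail half-edge; its head half-edge is the other half of
  the same edge. The lazy strings are all represented by the empty list; the vertex at which a
  lazy string sits is always determined by the neighbouring edges.
\<close>

type_synonym 'e oriented_edge = "'e \<times> bool"

definition tail_half :: "'e oriented_edge \<Rightarrow> 'e half_edge" where
  "tail_half a = a"

definition head_half :: "'e oriented_edge \<Rightarrow> 'e half_edge" where
  "head_half a = (fst a, \<not> snd a)"

definition edge_inverse :: "'e oriented_edge \<Rightarrow> 'e oriented_edge" where
  "edge_inverse a = (fst a, \<not> snd a)"

definition tail :: "('v, 'e) chart \<Rightarrow> 'e oriented_edge \<Rightarrow> 'v" where
  "tail G a = vert G (tail_half a)"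

definition head :: "('v, 'e) chart \<Rightarrow> 'e oriented_edge \<Rightarrow> 'v" where
  "head G a = vert G (head_half a)"

definition is_string :: "('v, 'e) chart \<Rightarrow> 'e oriented_edge list \<Rightarrow> bool" where
  "is_string G p \<longleftrightarrow>
     (\<forall>j. Suc j < length p \<longrightarrow> different_classes G (head_half (p ! j)) (tail_half (p ! Suc j)))"

definition string_inverse :: "'e oriented_edge list \<Rightarrow> 'e oriented_edge list" where
  "string_inverse p = rev (map edge_inverse p)"

definition string_power :: "'e oriented_edge list \<Rightarrow> nat \<Rightarrow> 'e oriented_edge list" where
  "string_power p n = concat (replicate n p)"

definition route :: "('v, 'e) chart \<Rightarrow> 'e oriented_edge list \<Rightarrow> bool" where
  "route G p \<longleftrightarrow> p \<noteq> [] \<and> is_string G p \<and> fringe G (tail G (hd p)) \<and> fringe G (head G (last p))"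

definition band :: "('v, 'e) chart \<Rightarrow> 'e oriented_edge list \<Rightarrow> bool" where
  "band G B \<longleftrightarrow>
     B \<noteq> [] \<and> is_string G (B @ B) \<and>
     \<not> (\<exists>A n. is_string G A \<and> length A < length B \<and> B = string_power A n)"

definition route_equiv :: "('e oriented_edge list \<times> 'e oriented_edge list) set" where
  "route_equiv = {(p, q). q = p \<or> q = string_inverse p}"

definition band_equiv :: "('e oriented_edge list \<times> 'e oriented_edge list) set" where
  "band_equiv = {(B, B'). \<exists>n. B' = rotate n B \<or> B' = rotate n (string_inverse B)}"

definition indicator_vector :: "'e::finite oriented_edge list \<Rightarrow> real ^ 'e" where
  "indicator_vector p = (\<chi> e. real (count_list (map fst p) e))"


section \<open>Compatibility\<close>

definition incompatibility ::
    "('v, 'e) chart \<Rightarrow> ('v, 'e) framing \<Rightarrow> 'e oriented_edge list \<Rightarrow> 'e oriented_edge list \<Rightarrow> bool" where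
  "incompatibility G R p q \<longleftrightarrow>
     (\<exists>e1 e2 s f1 f2.
        p = [e1] @ s @ [f1] \<and> q = [e2] @ s @ [f2] \<and> is_string G p \<and> is_string G q \<and>
        framing_less G R (head_half e1) (head_half e2) \<and>
        framing_less G R (tail_half f1) (tail_half f2))"

definition substring_of_trail ::
    "('v, 'e) chart \<Rightarrow> 'e oriented_edge list \<Rightarrow> 'e oriented_edge list \<Rightarrow> bool" where
  "substring_of_trail G p' p \<longleftrightarrow>
     (route G p \<and> sublist p' p) \<or> (band G p \<and> (\<exists>n. sublist p' (string_power p n)))"

definition incompatible ::
    "('v, 'e) chart \<Rightarrow> ('v, 'e) framing \<Rightarrow> 'e oriented_edge list \<Rightarrow> 'e oriented_edge list \<Rightarrow> bool" where
  "incompatible G R p q \<longleftrightarrow>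
     (\<exists>p' q'.
        (substring_of_trail G p' p \<or> substring_of_trail G p' (string_inverse p)) \<and>
        (substring_of_trail G q' q \<or> substring_of_trail G q' (string_inverse q)) \<and>
        (incompatibility G R p' q' \<or> incompatibility G R q' p'))"

definition self_compatible ::
    "('v, 'e) chart \<Rightarrow> ('v, 'e) framing \<Rightarrow> 'e oriented_edge list \<Rightarrow> bool" where
  "self_compatible G R p \<longleftrightarrow> \<not> incompatible G R p p"


section \<open>Elementary routes and bands\<close>

text \<open>
  In \<open>string_visits\<close> the start and the end of the string are separate visits; the visits of a band
  are counted cyclically.
\<close>

definition string_visits :: "('v, 'e) chart \<Rightarrow> 'e oriented_edge list \<Rightarrow> 'v list" where
  "string_visits G p = tail G (hd p) # map (head G) p"

definition band_visits :: "('v, 'e) chart \<Rightarrow> 'e oriented_edge list \<Rightarrow> 'v list" where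
  "band_visits G B = map (head G) B"

text \<open>The vertices of a possibly lazy string \<open>s\<close> ending at the vertex \<open>v\<close>.\<close>

definition vertices_of_string_to :: "('v, 'e) chart \<Rightarrow> 'e oriented_edge list \<Rightarrow> 'v \<Rightarrow> 'v set" where
  "vertices_of_string_to G s v = insert v (tail G ` set s)"

definition twice_on_once_off :: "'v set \<Rightarrow> 'v list \<Rightarrow> bool" where
  "twice_on_once_off V vs \<longleftrightarrow> (\<forall>v \<in> set vs. count_list vs v = (if v \<in> V then 2 else 1))"

definition simple_route :: "('v, 'e) chart \<Rightarrow> 'e oriented_edge list \<Rightarrow> bool" where
  "simple_route G p \<longleftrightarrow> route G p \<and> distinct (string_visits G p)"

definition lollipop :: "('v, 'e) chart \<Rightarrow> 'e oriented_edge list \<Rightarrow> bool" where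
  "lollipop G p \<longleftrightarrow>
     route G p \<and>
     (\<exists>s \<sigma>. \<sigma> \<noteq> [] \<and> p = s @ \<sigma> @ string_inverse s \<and>
        twice_on_once_off (vertices_of_string_to G s (tail G (hd \<sigma>))) (string_visits G p))"

definition elementary_route ::
    "('v, 'e) chart \<Rightarrow> ('v, 'e) framing \<Rightarrow> 'e oriented_edge list \<Rightarrow> bool" where
  "elementary_route G R p \<longleftrightarrow> self_compatible G R p \<and> (simple_route G p \<or> lollipop G p)"

definition simple_band :: "('v, 'e) chart \<Rightarrow> 'e oriented_edge list \<Rightarrow> bool" where
  "simple_band G B \<longleftrightarrow> band G B \<and> distinct (band_visits G B)"

text \<open>
  In a barbell \<open>s \<sigma>\<^sub>1 s\<^sup>-\<^sup>1 \<sigma>\<^sub>2\<close> the string \<open>s\<close> may be lazy (two cycles sharing just a vertex). If \<open>s\<close>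
  is not lazy, then \<open>\<sigma>\<^sub>1\<close> starts and ends with half-edges in the same class, namely the one opposite
  to the final half-edge of \<open>s\<close>. For lazy \<open>s\<close> this has to be required: otherwise \<open>\<sigma>\<^sub>1\<close> and \<open>\<sigma>\<^sub>2\<close>
  could both be bands, and the indicator vector of \<open>\<sigma>\<^sub>1 \<sigma>\<^sub>2\<close> would be the sum of theirs. As there
  are two classes, the same condition on \<open>\<sigma>\<^sub>2\<close> follows.
\<close>

definition barbell :: "('v, 'e) chart \<Rightarrow> 'e oriented_edge list \<Rightarrow> bool" where
  "barbell G B \<longleftrightarrow>
     band G B \<and>
     (\<exists>n s \<sigma>1 \<sigma>2. \<sigma>1 \<noteq> [] \<and> rotate n B = s @ \<sigma>1 @ string_inverse s @ \<sigma>2 \<and>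
        same_class G (tail_half (hd \<sigma>1)) (head_half (last \<sigma>1)) \<and>
        twice_on_once_off (vertices_of_string_to G s (tail G (hd \<sigma>1))) (band_visits G B))"

definition elementary_band :: "('v, 'e) chart \<Rightarrow> 'e oriented_edge list \<Rightarrow> bool" where
  "elementary_band G B \<longleftrightarrow> simple_band G B \<or> barbell G B"

end

theory Submission
  imports Defs
begin

text \<open>
  A nonzero nonnegative flow never has a dead end at an internal vertex. So a string of edges in its
  support with pairwise distinct inner vertices and maximal length ends, on either side, in a fringe
  vertex or at one of its own inner vertices. Going through these cases gives an elementary trail
  in the support. Conversely, a flow supported on an elementary trail vanishes as soon as it vanishes
  on one suitable edge, so it is a multiple of the indicator vector of the trail. Hence the
  nonnegative flows with minimal support are, up to scaling, the indicator vectors of elementary trails.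

  A trail can be read off its support, because at almost every vertex the next edge is forced. The
  only choice left is the direction of the two cycles of a barbell relative to each other. The two
  possibilities have the same indicator vector, and exactly one of them is self-compatible.
\<close>

section \<open>Oriented edges and charts\<close>

text \<open>A lollipop or barbell runs twice along its connecting string, so it is awkward to follow
  edge by edge. Both are therefore encoded by a string that uses every edge once,
  \<open>s @ \<beta>\<close> or \<open>\<alpha> @ s @ \<beta>\<close>, with distinct inner vertices
  and with ends that may return to an inner vertex. In this encoding reversing a cycle and inverting
  the string are symmetries, so a statement about both cycles and both directions needs only one
  proof. Extremal rays see indicator vectors only up to scaling. Bands are still recovered exactly:
  the entries are natural numbers and every elementary band has an edge that it traverses once,
  which leaves 1 as the only possible factor between two of these vectors. The same edge shows that
  a barbell is not a proper power.\<close>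

lemma head_half_eq [simp]: "head_half = edge_inverse"
  by (simp add: fun_eq_iff head_half_def edge_inverse_def)

lemma tail_half_eq [simp]: "tail_half x = x"
  by (simp add: tail_half_def)

lemma tail_eq [simp]: "tail G = vert G"
  by (simp add: fun_eq_iff tail_def)

lemma head_eq [simp]: "head G = (\<lambda>x. vert G (edge_inverse x))"
  by (simp add: fun_eq_iff head_def)

lemma edge_inverse_inverse [simp]: "edge_inverse (edge_inverse x) = x"
  by (simp add: edge_inverse_def)

lemma fst_edge_inverse [simp]: "fst (edge_inverse x) = fst x"
  by (simp add: edge_inverse_def)

lemma edge_inverse_neq [simp]: "edge_inverse x \<noteq> x" "x \<noteq> edge_inverse x"
  by (auto simp: edge_inverse_def prod_eq_iff)

lemma edge_inverse_inject [simp]: "edge_inverse x = edge_inverse y \<longleftrightarrow> x = y"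
  by (metis edge_inverse_inverse)

lemma fst_eq_iff: "fst x = fst y \<longleftrightarrow> x = y \<or> x = edge_inverse y"
  by (cases x; cases y) (auto simp: edge_inverse_def)

lemma string_inverse_Nil [simp]: "string_inverse [] = []"
  by (simp add: string_inverse_def)

lemma string_inverse_Cons [simp]: "string_inverse (x # p) = string_inverse p @ [edge_inverse x]"
  by (simp add: string_inverse_def)

lemma string_inverse_append [simp]: "string_inverse (p @ q) = string_inverse q @ string_inverse p"
  by (simp add: string_inverse_def)

lemma string_inverse_inverse [simp]: "string_inverse (string_inverse p) = p"
  by (simp add: string_inverse_def rev_map o_def)

lemma string_inverse_eq_Nil [simp]: "string_inverse p = [] \<longleftrightarrow> p = []"
  by (simp add: string_inverse_def)

lemma length_string_inverse [simp]: "length (string_inverse p) = length p"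
  by (simp add: string_inverse_def)

lemma set_string_inverse [simp]: "set (string_inverse p) = edge_inverse ` set p"
  by (simp add: string_inverse_def)

lemma hd_string_inverse [simp]: "p \<noteq> [] \<Longrightarrow> hd (string_inverse p) = edge_inverse (last p)"
  by (simp add: string_inverse_def hd_rev last_map)

lemma last_string_inverse [simp]: "p \<noteq> [] \<Longrightarrow> last (string_inverse p) = edge_inverse (hd p)"
  by (simp add: string_inverse_def last_rev hd_map)

lemma map_fst_string_inverse: "map fst (string_inverse p) = rev (map fst p)"
  by (simp add: string_inverse_def rev_map)

text \<open>Oriented edges and half-edges share one type. So this set is both the set of half-edges
  in the support of \<open>p\<close> and the set of edges, in either orientation, that a string
  inside this support may use.\<close>

definition halves :: "'e oriented_edge list \<Rightarrow> 'e half_edge set" where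
  "halves p = {x. fst x \<in> fst ` set p}"

lemma halves_eq: "halves p = set p \<union> edge_inverse ` set p"
  by (simp add: set_eq_iff halves_def image_iff fst_eq_iff bex_disj_distrib Bex_def)

lemma set_subset_halves [simp]: "set p \<subseteq> halves p"
  by (auto simp: halves_def)

lemma halves_append [simp]: "halves (p @ q) = halves p \<union> halves q"
  by (auto simp: halves_def)

lemma halves_Nil [simp]: "halves [] = {}"
  by (simp add: halves_def)

lemma halves_string_inverse [simp]: "halves (string_inverse p) = halves p"
  by (simp add: halves_def image_image)

lemma edge_inverse_in_halves [simp]: "edge_inverse x \<in> halves p \<longleftrightarrow> x \<in> halves p"
  by (simp add: halves_def)

lemma in_halves_self: "x \<in> set p \<Longrightarrow> x \<in> halves p"
  by (auto simp: halves_def)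

lemma indicator_vector_nth: "indicator_vector p $ e = real (count_list (map fst p) e)"
  by (simp add: indicator_vector_def)

lemma indicator_vector_nonneg: "indicator_vector p $ e \<ge> 0"
  by (simp add: indicator_vector_nth)

lemma indicator_vector_eq_0_iff: "indicator_vector p $ e = 0 \<longleftrightarrow> e \<notin> fst ` set p"
  by (simp add: indicator_vector_nth count_list_0_iff)

lemma count_list_rotate1: "count_list (rotate1 xs) x = count_list xs x"
  by (cases xs) auto

lemma count_list_rotate [simp]: "count_list (rotate n xs) x = count_list xs x"
  by (induction n) (simp_all add: count_list_rotate1)

lemma indicator_vector_rotate [simp]: "indicator_vector (rotate n p) = indicator_vector p"
  by (simp add: vec_eq_iff indicator_vector_nth flip: rotate_map)

lemma indicator_vector_string_inverse [simp]: "indicator_vector (string_inverse p) = indicator_vector p"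
  by (simp add: vec_eq_iff indicator_vector_nth map_fst_string_inverse)

section \<open>Half-edge classes and strings in a turbulence chart\<close>

locale turbulence =
  fixes G :: "('v, 'e::finite) chart"
  assumes chart: "turbulence_chart G"
begin

abbreviation opp :: "'e half_edge \<Rightarrow> 'e half_edge \<Rightarrow> bool" where
  "opp \<equiv> different_classes G"

abbreviation same :: "'e half_edge \<Rightarrow> 'e half_edge \<Rightarrow> bool" where
  "same \<equiv> same_class G"

abbreviation linked :: "'e oriented_edge \<Rightarrow> 'e oriented_edge \<Rightarrow> bool" where
  "linked x y \<equiv> opp (edge_inverse x) y"

lemma equiv_sim: "internal G v \<Longrightarrow> equiv (half_edges_at G v) (sim G v)"
  using chart by (simp add: turbulence_chart_def)

lemma card_classes: "internal G v \<Longrightarrow> card (half_edges_at G v // sim G v) = 2"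
  using chart by (simp add: turbulence_chart_def)

lemma opp_vert: "opp x y \<Longrightarrow> vert G x = vert G y"
  by (simp add: different_classes_def)

lemma same_vert: "same x y \<Longrightarrow> vert G x = vert G y"
  by (simp add: same_class_def)

lemma opp_internal: "opp x y \<Longrightarrow> internal G (vert G x)" "opp x y \<Longrightarrow> internal G (vert G y)"
  by (auto simp: different_classes_def)

lemma same_internal: "same x y \<Longrightarrow> internal G (vert G x)" "same x y \<Longrightarrow> internal G (vert G y)"
  by (auto simp: same_class_def)

lemma internal_not_fringe: "internal G v \<Longrightarrow> \<not> fringe G v"
  by (simp add: internal_def)

lemma internal_or_fringe: "internal G (vert G x) \<or> fringe G (vert G x)"
  by (simp add: internal_def)

lemma same_refl: "internal G (vert G x) \<Longrightarrow> same x x"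
  using equiv_class_self[OF equiv_sim, of "vert G x" x]
  by (simp add: same_class_def half_edges_at_def)

lemma same_sym: "same x y \<Longrightarrow> same y x"
  using equiv_sim[of "vert G x"] symD[of "sim G (vert G x)" x y] by (auto simp: same_class_def equiv_def)

lemma same_trans [trans]: "same x y \<Longrightarrow> same y z \<Longrightarrow> same x z"
  using equiv_sim[of "vert G x"] transD[of "sim G (vert G x)" x y z] by (auto simp: same_class_def equiv_def)

lemma opp_iff_not_same:
  "internal G (vert G x) \<Longrightarrow> vert G x = vert G y \<Longrightarrow> opp x y \<longleftrightarrow> \<not> same x y"
  by (simp add: same_class_def different_classes_def)

lemma not_opp_and_same: "\<not> (opp x y \<and> same x y)"
  by (simp add: same_class_def different_classes_def)

lemma opp_sym: "opp x y \<Longrightarrow> opp y x"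
  unfolding different_classes_def using equiv_sim[of "vert G x"] symD[of "sim G (vert G x)" y x]
  by (auto simp: equiv_def)

lemma opp_irrefl [simp]: "\<not> opp x x"
  using not_opp_and_same[of x x] opp_internal(1)[of x x] same_refl[of x] by blast

lemma opp_same_trans:
  assumes "opp x y" "same y z" shows "opp x z"
proof -
  have "internal G (vert G x)" "vert G x = vert G z"
    using opp_internal(1)[OF assms(1)] opp_vert[OF assms(1)] same_vert[OF assms(2)] by simp_all
  moreover have "\<not> same x z"
    using same_trans[OF _ same_sym[OF assms(2)]] not_opp_and_same[of x y] assms(1) by blast
  ultimately show ?thesis
    using opp_iff_not_same[of x z] by blast
qed

lemma class_eq: "internal G (vert G x) \<Longrightarrow> sim G (vert G x) `` {x} = {y. same x y}"
  using equiv_sim[of "vert G x"]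
  by (fastforce simp: same_class_def half_edges_at_def equiv_def)

lemma class_in_quotient: "internal G (vert G x) \<Longrightarrow> {y. same x y} \<in> half_edges_at G (vert G x) // sim G (vert G x)"
  using quotientI[of x "half_edges_at G (vert G x)" "sim G (vert G x)"] class_eq[of x]
  by (simp add: half_edges_at_def)

text \<open>There are at most two classes at a vertex: if \<open>x\<close> and \<open>z\<close> were
  in different classes, the classes of \<open>x\<close>, \<open>y\<close> and \<open>z\<close> would
  be three elements of a quotient of size two. \<open>exists_opp\<close> uses the other half of the
  count.\<close>

lemma opp_opp_trans: assumes "opp x y" "opp y z" shows "same x z"
proof (rule ccontr)
  assume "\<not> same x z"
  note v = opp_vert[OF assms(1)] opp_vert[OF assms(2)] opp_internal[OF assms(1)] opp_internal[OF assms(2)]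
  let ?Q = "half_edges_at G (vert G x) // sim G (vert G x)"
  let ?C = "\<lambda>x. {y. same x y}"
  have same_if: "same a b" if "?C a = ?C b" "internal G (vert G b)" for a b
    using same_refl[OF that(2)] that(1) by blast
  have "?C x \<noteq> ?C z" "?C x \<noteq> ?C y" "?C y \<noteq> ?C z"
    using \<open>\<not> same x z\<close> v not_opp_and_same[of x y] not_opp_and_same[of y z] assms
      same_if[of x z] same_if[of x y] same_if[of y z] by auto
  then have "card {?C x, ?C y, ?C z} = 3"
    by simp
  moreover have "{?C x, ?C y, ?C z} \<subseteq> ?Q"
    using class_in_quotient[of x] class_in_quotient[of y] class_in_quotient[of z] v by auto
  moreover have "finite ?Q"
    using card_classes[OF v(3)] card.infinite by fastforce
  ultimately have "3 \<le> card ?Q"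
    by (metis card_mono)
  then show False
    using card_classes[OF v(3)] by simp
qed

lemma exists_opp: assumes "internal G (vert G x)" shows "\<exists>y. opp x y"
proof -
  let ?Q = "half_edges_at G (vert G x) // sim G (vert G x)"
  obtain D where D: "D \<in> ?Q" "D \<noteq> {y. same x y}"
    using card_classes[OF assms] class_in_quotient[OF assms]
    by (metis card_2_iff insert_iff)
  from D(1) obtain y where y: "y \<in> half_edges_at G (vert G x)" "D = sim G (vert G x) `` {y}"
    by (rule quotientE)
  then have v: "vert G y = vert G x"
    by (simp add: half_edges_at_def)
  then have "D = {z. same y z}"
    using class_eq[of y] assms y by simp
  then have "\<not> same x y"
    using D(2) same_trans[of x y] same_trans[of y x] same_sym[of x y] by (auto simp del: split_paired_All)
  then show ?thesis
    using opp_iff_not_same[OF assms v[symmetric]] by blast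
qed

lemma quotient_eq:
  assumes "internal G v" "C \<in> half_edges_at G v // sim G v"
  shows "\<exists>x. vert G x = v \<and> C = {y. same x y}"
  using assms(2)
proof (rule quotientE)
  fix x assume x: "C = sim G v `` {x}" "x \<in> half_edges_at G v"
  then have "vert G x = v"
    by (simp add: half_edges_at_def)
  then show ?thesis
    using class_eq[of x] x assms by metis
qed

lemma is_string_iff: "is_string G p \<longleftrightarrow> successively linked p"
  by (simp add: is_string_def successively_conv_nth)

lemma linked_inverse: "linked (edge_inverse y) (edge_inverse x) \<longleftrightarrow> linked x y"
  using opp_sym[of y "edge_inverse x"] opp_sym[of "edge_inverse x" y] by auto

lemma is_string_Nil [simp]: "is_string G []"
  by (simp add: is_string_iff)

lemma is_string_Cons: "is_string G (x # p) \<longleftrightarrow> p = [] \<or> linked x (hd p) \<and> is_string G p"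
  by (simp add: is_string_iff successively_Cons)

lemma is_string_append:
  "is_string G (p @ q) \<longleftrightarrow>
     is_string G p \<and> is_string G q \<and> (p = [] \<or> q = [] \<or> linked (last p) (hd q))"
  by (simp add: is_string_iff successively_append_iff)

lemma is_string_inverse [simp]: "is_string G (string_inverse p) \<longleftrightarrow> is_string G p"
  by (induction p) (auto simp only: string_inverse_Nil string_inverse_Cons is_string_append
      is_string_Cons linked_inverse list.sel last.simps string_inverse_eq_Nil is_string_Nil
      last_string_inverse not_Cons_self simp_thms)

text \<open>Both lists are the inner vertices of the string, once as heads and once as tails.
  Inversion exchanges heads and tails, and visits are counted by heads, so this is the bridge to
  conditions on tails.\<close>

lemma map_head_butlast: "is_string G p \<Longrightarrow> map (\<lambda>x. vert G (edge_inverse x)) (butlast p) = map (vert G) (tl p)"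
proof (induction p rule: induct_list012)
  case (3 x y p)
  then have "vert G (edge_inverse x) = vert G y"
    using opp_vert[of "edge_inverse x" y] by (simp add: is_string_Cons)
  moreover have "map (\<lambda>x. vert G (edge_inverse x)) (butlast (y # p)) = map (vert G) p"
    using 3 by (simp add: is_string_Cons del: butlast.simps)
  ultimately show ?case
    by (simp del: butlast.simps add: butlast.simps(2)[of x])
qed simp_all

end

section \<open>Strings without repeated inner vertices\<close>

lemma tl_string_inverse: "tl (string_inverse p) = string_inverse (butlast p)"
  by (cases p rule: rev_cases) (simp_all add: string_inverse_def)

lemma map_string_inverse: "map f (string_inverse p) = rev (map (\<lambda>x. f (edge_inverse x)) p)"
  by (simp add: string_inverse_def rev_map comp_def)

lemma distinct_iff_count_list: "distinct xs \<longleftrightarrow> (\<forall>u. count_list xs u \<le> 1)"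
proof (induction xs)
  case (Cons x xs)
  have "(\<forall>u. count_list (x # xs) u \<le> 1) \<longleftrightarrow> count_list xs x = 0 \<and> (\<forall>u. count_list xs u \<le> 1)"
  proof (intro iffI conjI allI)
    assume L: "\<forall>u. count_list (x # xs) u \<le> 1"
    show "count_list xs x = 0"
      using L[rule_format, of x] by simp
    show "count_list xs u \<le> 1" for u
      using L[rule_format, of u] by (simp split: if_splits)
  next
    fix u assume "count_list xs x = 0 \<and> (\<forall>u. count_list xs u \<le> 1)"
    then show "count_list (x # xs) u \<le> 1"
      by (cases "u = x") simp_all
  qed
  then show ?case
    using Cons by (simp add: count_list_0_iff)
qed simp

text \<open>With the vertices of \<open>xs\<close> counted twice and those of \<open>ys\<close>
  once, the prescribed numbers of visits say exactly that nothing is repeated within or between the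
  two lists. This turns the definitions of lollipop and barbell into distinctness of inner
  vertices.\<close>

lemma twice_on_once_off_iff:
  assumes "\<And>u. count_list vs u = 2 * count_list xs u + count_list ys u"
  shows "twice_on_once_off (set xs) vs \<longleftrightarrow> distinct (xs @ ys)"
proof
  assume L: "twice_on_once_off (set xs) vs"
  show "distinct (xs @ ys)"
    unfolding distinct_iff_count_list
  proof
    fix u
    show "count_list (xs @ ys) u \<le> 1"
    proof (cases "u \<in> set vs")
      case True
      then have "count_list vs u = (if u \<in> set xs then 2 else 1)"
        using L by (simp add: twice_on_once_off_def)
      moreover have "count_list xs u = 0 \<longleftrightarrow> u \<notin> set xs"
        by (rule count_list_0_iff)
      ultimately show ?thesis
        using assms[of u] by (simp split: if_splits)
    next
      case False
      then show ?thesis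
        using assms[of u] by simp
    qed
  qed
next
  assume R: "distinct (xs @ ys)"
  show "twice_on_once_off (set xs) vs"
    unfolding twice_on_once_off_def
  proof
    fix u assume "u \<in> set vs"
    then have "count_list vs u \<noteq> 0"
      by (simp add: count_list_0_iff)
    moreover have "count_list (xs @ ys) u \<le> 1"
      using R unfolding distinct_iff_count_list by blast
    moreover have "count_list xs u = 0 \<longleftrightarrow> u \<notin> set xs"
      by (rule count_list_0_iff)
    ultimately show "count_list vs u = (if u \<in> set xs then 2 else 1)"
      using assms[of u] by (cases "u \<in> set xs") auto
  qed
qed

context turbulence
begin

text \<open>The tail of the first edge and the head of the last one are left free. They may coincide
  with inner vertices, which is how the cycles at the ends of lollipops and barbells arise.\<close>

definition inner_simple :: "'e oriented_edge list \<Rightarrow> bool" where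
  "inner_simple p \<longleftrightarrow> is_string G p \<and> distinct (map (vert G) (tl p))"

lemma inner_simple_string: "inner_simple p \<Longrightarrow> is_string G p"
  by (simp add: inner_simple_def)

lemma inner_simple_inj: "inner_simple p \<Longrightarrow> x \<in> set (tl p) \<Longrightarrow> y \<in> set (tl p) \<Longrightarrow> vert G x = vert G y \<Longrightarrow> x = y"
  by (auto simp: inner_simple_def distinct_map dest: inj_onD)

lemma inner_simple_inverse [simp]: "inner_simple (string_inverse p) \<longleftrightarrow> inner_simple p"
proof -
  have "map (vert G) (tl (string_inverse p)) = rev (map (vert G) (tl p))" if "is_string G p"
    using map_head_butlast[OF that] by (simp add: tl_string_inverse map_string_inverse)
  then show ?thesis
    unfolding inner_simple_def is_string_inverse by (metis distinct_rev)
qed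

text \<open>An edge in \<open>tl p\<close> is determined by its tail, so only \<open>f\<close> and
  the free first edge of \<open>p\<close> can start at this vertex. The inverse string gives the
  same for half-edges at which edges of \<open>p\<close> arrive.\<close>

lemma inner_simple_at:
  assumes "inner_simple p" "p = A @ [e, f] @ B" "x \<in> halves p" "vert G x = vert G f"
  shows "x \<in> {f, edge_inverse e, hd p, edge_inverse (last p)}"
proof -
  have hd_or: "y = hd q \<or> y = g" if "inner_simple q" "y \<in> set q" "g \<in> set (tl q)" "vert G y = vert G g" for q y g
    using inner_simple_inj[OF that(1) _ that(3,4)] that(2) by (cases q) auto
  have e: "vert G (edge_inverse e) = vert G f"
    using assms opp_vert by (auto simp: inner_simple_def is_string_append is_string_Cons)
  consider "x \<in> set p" | "x \<in> set (string_inverse p)"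
    using assms(3) by (auto simp: halves_eq)
  then show ?thesis
  proof cases
    case 1
    have "f \<in> set (tl p)"
      using assms(2) by (cases A) auto
    then show ?thesis
      using hd_or[OF assms(1) 1 _ assms(4)] by blast
  next
    case 2
    have "edge_inverse e \<in> set (tl (string_inverse p))"
      using assms(2) by (cases B rule: rev_cases) (simp_all add: tl_string_inverse)
    then have "x = hd (string_inverse p) \<or> x = edge_inverse e"
      using hd_or[of "string_inverse p" x "edge_inverse e"] 2 assms(1,4) e by simp
    moreover have "p \<noteq> []"
      using assms(2) by simp
    ultimately show ?thesis
      by auto
  qed
qed

text \<open>If \<open>y\<close> is followed later by its inverse, then the edge right after
  \<open>y\<close> and the inverse of \<open>y\<close> start at the same inner vertex. If the
  inverse comes immediately, a half-edge would be opposite to itself.\<close>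

lemma inner_simple_no_inverse:
  assumes "inner_simple p" "x \<in> set p"
  shows "edge_inverse x \<notin> set p"
proof
  have *: False if p: "p = A @ y # B @ edge_inverse y # C" for y A B C
  proof (cases B)
    case Nil
    then have "linked y (edge_inverse y)"
      using assms(1) p by (simp add: inner_simple_def is_string_append is_string_Cons)
    then show False
      by simp
  next
    case (Cons b D)
    then have "vert G b = vert G (edge_inverse y)"
      using assms(1) p opp_vert[of "edge_inverse y" b]
      by (simp add: inner_simple_def is_string_append is_string_Cons)
    moreover have "distinct (map (vert G) (B @ edge_inverse y # C))"
      using assms(1) p by (cases A) (simp_all add: inner_simple_def)
    ultimately show False
      using Cons by simp
  qed
  assume "edge_inverse x \<in> set p"
  moreover obtain A B where p: "p = A @ x # B"
    using assms(2) by (meson split_list)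
  ultimately consider "edge_inverse x \<in> set A" | "edge_inverse x \<in> set B"
    by auto
  then show False
  proof cases
    case 1
    then obtain C D where "A = C @ edge_inverse x # D"
      by (meson split_list)
    then show False
      using *[of C "edge_inverse x" D B] p by simp
  next
    case 2
    then obtain C D where "B = C @ edge_inverse x # D"
      by (meson split_list)
    then show False
      using *[of A x C D] p by simp
  qed
qed

section \<open>Strings inside a given support whose continuation is forced\<close>

definition forced :: "'e half_edge set \<Rightarrow> 'e oriented_edge list \<Rightarrow> bool" where
  "forced H w \<longleftrightarrow> successively (\<lambda>x y. \<forall>z\<in>H. linked x z \<longrightarrow> z = y) w"

lemma forcedI: "(\<And>A e f B z. w = A @ [e, f] @ B \<Longrightarrow> z \<in> H \<Longrightarrow> linked e z \<Longrightarrow> z = f) \<Longrightarrow> forced H w"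
  unfolding forced_def successively_conv_nth
  by (metis append_Cons append_Nil append_take_drop_id Cons_nth_drop_Suc Suc_lessD)

lemma forced_append:
  "forced H (p @ q) \<longleftrightarrow>
     forced H p \<and> forced H q \<and> (p = [] \<or> q = [] \<or> (\<forall>z\<in>H. linked (last p) z \<longrightarrow> z = hd q))"
  by (simp add: forced_def successively_append_iff)

text \<open>The strings start with the same edge and, wherever both continue, they continue with the
  same edge. They can differ only in where they stop.\<close>

lemma forced_follow:
  assumes "forced H w" "is_string G q" "set q \<subseteq> H" "w \<noteq> []" "q \<noteq> []" "hd q = hd w"
  shows "prefix q w \<or> prefix w q"
  using assms
proof (induction w arbitrary: q)
  case (Cons x w)
  obtain q' where q: "q = x # q'"
    using Cons.prems by (cases q) auto
  show ?case
  proof (cases "w = [] \<or> q' = []")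
    case False
    then have "linked x (hd q')" "hd q' \<in> H"
      using Cons.prems q by (auto simp: is_string_Cons)
    then have "hd q' = hd w"
      using False Cons.prems(1) by (simp add: forced_def successively_Cons)
    then have "prefix q' w \<or> prefix w q'"
      using False Cons.prems q by (intro Cons.IH) (simp_all add: forced_def successively_Cons is_string_Cons)
    then show ?thesis
      using q by simp
  qed (use q in auto)
qed simp

text \<open>Of the four half-edges that \<open>inner_simple_at\<close> allows,
  \<open>edge_inverse e\<close> drops out because no half-edge is opposite to itself. The rest of
  the work for each kind of trail is to exclude the two free ends.\<close>

lemma inner_simple_linked:
  assumes "inner_simple p" "p = A @ [e, f] @ B" "z \<in> halves p" "linked e z"
  shows "z = f \<or> z = hd p \<or> z = edge_inverse (last p)"
proof -
  have "linked e f"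
    using assms(1,2) by (simp add: inner_simple_def is_string_append is_string_Cons)
  then have "vert G z = vert G f"
    using opp_vert[OF assms(4)] opp_vert by metis
  then have "z \<in> {f, edge_inverse e, hd p, edge_inverse (last p)}"
    using inner_simple_at[OF assms(1-3)] by blast
  then show ?thesis
    using assms(4) by auto
qed

text \<open>The cycle \<beta> leaves and returns through the same class, so it can be entered from
  either side. Its heads are its tails shifted cyclically, hence reversal keeps the multiset of
  vertices.\<close>

lemma inner_simple_flip:
  assumes "inner_simple (t @ \<beta>)" "t \<noteq> []" "\<beta> \<noteq> []" "same (hd \<beta>) (edge_inverse (last \<beta>))"
  shows "inner_simple (t @ string_inverse \<beta>)"
proof -
  have s: "is_string G t" "is_string G \<beta>" "linked (last t) (hd \<beta>)"
    using assms(1-3) by (auto simp: inner_simple_def is_string_append)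
  have "linked (last t) (edge_inverse (last \<beta>))"
    using opp_same_trans[OF s(3) assms(4)] .
  then have "is_string G (t @ string_inverse \<beta>)"
    using s assms(3) by (simp add: is_string_append)
  moreover have "mset (map (vert G) (string_inverse \<beta>)) = mset (map (vert G) \<beta>)"
  proof -
    have "map (\<lambda>x. vert G (edge_inverse x)) \<beta> =
        map (\<lambda>x. vert G (edge_inverse x)) (butlast \<beta>) @ [vert G (edge_inverse (last \<beta>))]"
      using assms(3) by (metis (no_types) append_butlast_last_id map_append list.simps(8,9))
    also have "\<dots> = map (vert G) (tl \<beta>) @ [vert G (hd \<beta>)]"
      using map_head_butlast[OF s(2)] same_vert[OF assms(4)] by simp
    finally have "mset (map (vert G) (string_inverse \<beta>)) = mset (map (vert G) (tl \<beta>) @ [vert G (hd \<beta>)])"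
      by (simp only: map_string_inverse mset_rev)
    also have "\<dots> = mset (map (vert G) \<beta>)"
      using assms(3) by (cases \<beta>) simp_all
    finally show ?thesis .
  qed
  then have "mset (map (vert G) (tl (t @ string_inverse \<beta>))) = mset (map (vert G) (tl (t @ \<beta>)))"
    using assms(2) by simp
  ultimately show ?thesis
    using assms(1) mset_eq_imp_distinct_iff unfolding inner_simple_def by blast
qed

text \<open>
  The string \<open>\<alpha> s \<beta>\<close> runs through every edge of the barbell \<open>\<alpha> s \<beta> s\<^sup>-\<^sup>1\<close> once, and it visits twice
  only the vertices at the two ends of \<open>s\<close>.
\<close>

definition barbell_data :: "'e oriented_edge list \<Rightarrow> 'e oriented_edge list \<Rightarrow> 'e oriented_edge list \<Rightarrow> bool" where
  "barbell_data \<alpha> s \<beta> \<longleftrightarrow>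
     \<alpha> \<noteq> [] \<and> \<beta> \<noteq> [] \<and> inner_simple (\<alpha> @ s @ \<beta>) \<and>
     same (hd \<alpha>) (edge_inverse (last \<alpha>)) \<and> same (hd \<beta>) (edge_inverse (last \<beta>))"

definition lollipop_data :: "'e oriented_edge list \<Rightarrow> 'e oriented_edge list \<Rightarrow> bool" where
  "lollipop_data s \<beta> \<longleftrightarrow>
     s \<noteq> [] \<and> \<beta> \<noteq> [] \<and> inner_simple (s @ \<beta>) \<and>
     fringe G (vert G (hd s)) \<and> same (hd \<beta>) (edge_inverse (last \<beta>))"

text \<open>The common part of barbells and lollipops: a string \<open>t\<close> leading to a cycle \<open>\<beta>\<close> on which one turns back.\<close>

definition stem :: "'e oriented_edge list \<Rightarrow> 'e oriented_edge list \<Rightarrow> bool" where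
  "stem t \<beta> \<longleftrightarrow>
     t \<noteq> [] \<and> \<beta> \<noteq> [] \<and> inner_simple (t @ \<beta>) \<and> same (hd \<beta>) (edge_inverse (last \<beta>)) \<and>
     (\<forall>e \<in> set (butlast (t @ \<beta>)). \<not> linked e (hd t))"

lemma barbell_data_inverse:
  "barbell_data \<alpha> s \<beta> \<Longrightarrow> barbell_data (string_inverse \<beta>) (string_inverse s) (string_inverse \<alpha>)"
  using inner_simple_inverse[of "\<alpha> @ s @ \<beta>"] same_sym
  by (auto simp: barbell_data_def)

lemma barbell_data_flip: "barbell_data \<alpha> s \<beta> \<Longrightarrow> barbell_data \<alpha> s (string_inverse \<beta>)"
  using inner_simple_flip[of "\<alpha> @ s" \<beta>] same_sym
  by (auto simp: barbell_data_def)

lemma lollipop_data_flip: "lollipop_data s \<beta> \<Longrightarrow> lollipop_data s (string_inverse \<beta>)"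
  using inner_simple_flip[of s \<beta>] same_sym
  by (auto simp: lollipop_data_def)

lemma lollipop_stem: "lollipop_data s \<beta> \<Longrightarrow> stem s \<beta>"
  using opp_internal(2) internal_not_fringe unfolding lollipop_data_def stem_def by blast

text \<open>An earlier edge that leads to \<open>hd \<alpha>\<close> has its head at the vertex
  where \<alpha> ends. Heads before the last edge are distinct, so it is
  \<open>last \<alpha>\<close>; but \<alpha> turns back within one class and cannot continue into
  its own start.\<close>

lemma barbell_stem: assumes "barbell_data \<alpha> s \<beta>" shows "stem (\<alpha> @ s) \<beta>"
proof -
  let ?L = "\<alpha> @ s @ \<beta>"
  note d = assms[unfolded barbell_data_def]
  have "\<not> linked e (hd \<alpha>)" if e: "e \<in> set (butlast ?L)" for e
  proof
    assume l: "linked e (hd \<alpha>)"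
    have "vert G (edge_inverse e) = vert G (edge_inverse (last \<alpha>))"
      using opp_vert[OF l] same_vert[of "hd \<alpha>"] d by metis
    moreover have "last \<alpha> \<in> set (butlast ?L)"
      using d by (simp add: butlast_append)
    moreover have "distinct (map (\<lambda>x. vert G (edge_inverse x)) (butlast ?L))"
      using d map_head_butlast[of ?L] unfolding inner_simple_def by metis
    ultimately have "e = last \<alpha>"
      using e by (meson distinct_map inj_onD)
    then show False
      using l d opp_sym not_opp_and_same by metis
  qed
  then show ?thesis
    using d by (simp add: stem_def)
qed

text \<open>The two free ends are excluded as continuations: \<open>hd t\<close> by the last
  condition on a stem, and \<open>edge_inverse (last \<beta>)\<close> because it sits at the vertex
  of \<open>hd \<beta>\<close>, an inner vertex different from that of \<open>f\<close>.\<close>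

lemma stem_forced: assumes "stem t \<beta>" shows "forced (halves (t @ \<beta>)) t"
proof (rule forcedI)
  fix A e f B z assume t: "t = A @ [e, f] @ B" and z: "z \<in> halves (t @ \<beta>)" "linked e z"
  note d = assms[unfolded stem_def]
  have "t @ \<beta> = A @ [e, f] @ B @ \<beta>"
    using t by simp
  then have "z = f \<or> z = hd (t @ \<beta>) \<or> z = edge_inverse (last (t @ \<beta>))"
    using inner_simple_linked[of "t @ \<beta>"] d z by blast
  then have "z = f \<or> z = hd t \<or> z = edge_inverse (last \<beta>)"
    using d by simp
  moreover have "z \<noteq> hd t"
    using d z(2) t by (auto simp: butlast_append)
  moreover have False if "z = edge_inverse (last \<beta>)"
  proof -
    have "linked e f"
      using d t by (simp add: inner_simple_def is_string_append is_string_Cons)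
    then have "vert G f = vert G (hd \<beta>)"
      using opp_vert[OF z(2)] opp_vert[of "edge_inverse e" f] same_vert[of "hd \<beta>"] d that by metis
    moreover have "distinct (map (vert G) (f # B @ \<beta>))"
      using d t by (cases A) (auto simp: inner_simple_def)
    then have "vert G f \<notin> vert G ` set \<beta>"
      by simp
    ultimately show False
      using d hd_in_set[of \<beta>] by blast
  qed
  ultimately show "z = f"
    by blast
qed

text \<open>A return to \<open>hd t\<close> is ruled out, so behind the stem only the two directions
  round the cycle remain.\<close>

lemma stem_fork:
  assumes "stem t \<beta>" "z \<in> halves (t @ \<beta>)" "linked (last t) z"
  shows "z \<in> {hd \<beta>, edge_inverse (last \<beta>)}"
proof -
  note d = assms(1)[unfolded stem_def]
  have "t @ \<beta> = butlast t @ [last t, hd \<beta>] @ tl \<beta>"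
    using d by (metis append_butlast_last_id append_Cons append_Nil append_assoc list.collapse)
  then have "z = hd \<beta> \<or> z = hd (t @ \<beta>) \<or> z = edge_inverse (last (t @ \<beta>))"
    using inner_simple_linked[of "t @ \<beta>"] d assms(2,3) by blast
  then have "z = hd \<beta> \<or> z = hd t \<or> z = edge_inverse (last \<beta>)"
    using d by simp
  moreover have "z \<noteq> hd t"
    using d assms(3) by (auto simp: butlast_append)
  ultimately show ?thesis
    by blast
qed

text \<open>Once the cycle has been entered, the way round it and down to the fringe vertex is
  forced. The only edge that could lead back to \<open>edge_inverse (last \<beta>)\<close> is the
  inverse of \<open>hd \<beta>\<close>, and that one arrives in the same class, so it cannot
  continue there.\<close>

lemma lollipop_forced_inverse:
  assumes "lollipop_data s \<beta>" shows "forced (halves (s @ \<beta>)) (string_inverse (s @ \<beta>))"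
proof (rule forcedI)
  let ?L = "string_inverse (s @ \<beta>)"
  fix A e f B z assume L: "?L = A @ [e, f] @ B" and z: "z \<in> halves (s @ \<beta>)" "linked e z"
  note d = assms[unfolded lollipop_data_def]
  have "z = f \<or> z = hd ?L \<or> z = edge_inverse (last ?L)"
    using inner_simple_linked[OF _ L _ z(2)] d z(1) inner_simple_inverse halves_string_inverse by blast
  then have "z = f \<or> z = edge_inverse (last \<beta>) \<or> z = hd s"
    using d by (simp add: hd_append)
  moreover have "z \<noteq> hd s"
    using z(2) opp_internal(2) internal_not_fringe d by blast
  moreover have False if "z = edge_inverse (last \<beta>)"
  proof -
    have "s @ \<beta> = string_inverse (A @ [e, f] @ B)"
      using L by (metis string_inverse_inverse)
    then have "edge_inverse e \<in> set (tl (s @ \<beta>))"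
      by (cases B rule: rev_cases) auto
    moreover have "hd \<beta> \<in> set (tl (s @ \<beta>))"
      using d by simp
    moreover have "vert G (edge_inverse e) = vert G (hd \<beta>)"
      using opp_vert[OF z(2)] same_vert[of "hd \<beta>"] d that by metis
    ultimately have "edge_inverse e = hd \<beta>"
      using inner_simple_inj d by blast
    then show False
      using z(2) that d not_opp_and_same by metis
  qed
  ultimately show "z = f"
    by blast
qed

lemma simple_route_forced:
  assumes "inner_simple p" "fringe G (vert G (hd p))" "fringe G (vert G (edge_inverse (last p)))"
  shows "forced (halves p) p"
proof (rule forcedI)
  fix A e f B z assume p: "p = A @ [e, f] @ B" and z: "z \<in> halves p" "linked e z"
  have "z = f \<or> z = hd p \<or> z = edge_inverse (last p)"
    using inner_simple_linked[OF assms(1) p z] .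
  then show "z = f"
    using assms opp_internal(2)[OF z(2)] internal_not_fringe by blast
qed

lemma simple_band_forced:
  assumes "is_string G B" "linked (last B) (hd B)" "distinct (map (vert G) B)"
  shows "forced (halves B) B"
proof (rule forcedI)
  fix A e f C z assume B: "B = A @ [e, f] @ C" and z: "z \<in> halves B" "linked e z"
  have i: "inner_simple B"
    using assms by (cases B) (simp_all add: inner_simple_def)
  have "linked e f"
    using assms(1) B by (simp add: is_string_append is_string_Cons)
  then have "vert G f = vert G z"
    using opp_vert[OF z(2)] opp_vert by metis
  moreover have "vert G (hd B) \<noteq> vert G f"
    using assms(3) B by (cases A) auto
  \<comment> \<open>Both free ends of \<open>B\<close> lie at the closing junction, whose vertex
    differs from that of \<open>f\<close>.\<close>
  ultimately have "z \<noteq> hd B" "z \<noteq> edge_inverse (last B)"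
    using opp_vert[OF assms(2)] by auto
  then show "z = f"
    using inner_simple_linked[OF i B z] by blast
qed

end

section \<open>Simple trails, lollipops and barbells\<close>

lemma count_list_string_power: "count_list (map f (string_power A n)) e = n * count_list (map f A) e"
  by (induction n) (simp_all add: string_power_def)

context turbulence
begin

lemma is_string_single [simp]: "is_string G [x]"
  by (simp add: is_string_Cons)

lemma closed_string_iff:
  "B \<noteq> [] \<Longrightarrow> is_string G (B @ B) \<longleftrightarrow> is_string G B \<and> linked (last B) (hd B)"
  by (auto simp: is_string_append)

lemma closed_string_inverse [simp]:
  "is_string G (string_inverse B @ string_inverse B) \<longleftrightarrow> is_string G (B @ B)"
  by (metis is_string_inverse string_inverse_append)

lemma closed_string_rotate1: "is_string G (B @ B) \<Longrightarrow> is_string G (rotate1 B @ rotate1 B)"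
proof (cases "tl B = []")
  case False
  moreover assume "is_string G (B @ B)"
  ultimately show ?thesis
    by (cases B) (auto simp: is_string_append is_string_Cons)
qed (cases B; simp)

lemma closed_string_rotate: "is_string G (B @ B) \<Longrightarrow> is_string G (rotate n B @ rotate n B)"
  by (induction n) (simp_all add: closed_string_rotate1)

lemma map_head_snoc:
  "is_string G (s @ [x]) \<Longrightarrow> map (\<lambda>x. vert G (edge_inverse x)) s = map (vert G) (tl (s @ [x]))"
  using map_head_butlast[of "s @ [x]"] by simp

lemma map_head_closed:
  assumes "is_string G p" "p \<noteq> []" "vert G (edge_inverse (last p)) = v"
  shows "map (\<lambda>x. vert G (edge_inverse x)) p = map (vert G) (tl p) @ [v]"
proof -
  have "map (\<lambda>x. vert G (edge_inverse x)) p =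
      map (\<lambda>x. vert G (edge_inverse x)) (butlast p) @ [vert G (edge_inverse (last p))]"
    using assms(2) by (metis (no_types) append_butlast_last_id map_append list.simps(8,9))
  then show ?thesis
    using map_head_butlast[OF assms(1)] assms(3) by simp
qed

lemma count_list_vert_Cons: "p \<noteq> [] \<Longrightarrow> count_list (map (vert G) p) u = count_list (vert G (hd p) # map (vert G) (tl p)) u"
  by (cases p) simp_all

text \<open>In an \<open>n\<close>-th power every edge occurs a multiple of \<open>n\<close> times,
  so an edge that occurs once forces \<open>n\<close> to be 1.\<close>

lemma band_if_count:
  assumes "is_string G (B @ B)" "count_list (map fst B) e = 1"
  shows "band G B"
proof -
  have "B \<noteq> []"
    using assms(2) by auto
  moreover have False if "length A < length B" "B = string_power A n" for A n
  proof -
    have "n * count_list (map fst A) e = 1"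
      using assms(2) that(2) by (simp add: count_list_string_power)
    then have "B = A"
      using that(2) by (simp add: string_power_def)
    then show False
      using that(1) by simp
  qed
  ultimately show ?thesis
    using assms(1) unfolding band_def by blast
qed

lemma count_fst_eq_1:
  assumes "edge_inverse x \<notin> set (A @ x # B)" "x \<notin> set (A @ B)"
  shows "count_list (map fst (A @ x # B)) (fst x) = 1"
proof -
  have "fst y \<noteq> fst x" if "y \<in> set (A @ B)" for y
    using assms that fst_eq_iff[of y x] by auto
  then have "fst x \<notin> set (map fst A)" "fst x \<notin> set (map fst B)"
    by fastforce+
  then show ?thesis
    by simp
qed

lemma distinct_map_vert: "distinct (map (vert G) p) \<Longrightarrow> distinct p"
  by (simp add: distinct_map)

lemma closed_count_hd:
  assumes "is_string G B" "B \<noteq> []" "distinct (map (vert G) B)"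
  shows "count_list (map fst B) (fst (hd B)) = 1"
proof -
  obtain x C where B: "B = x # C"
    using assms(2) by (cases B) auto
  have "inner_simple B"
    using assms B by (simp add: inner_simple_def)
  then have "edge_inverse x \<notin> set B"
    using inner_simple_no_inverse[of B x] B by simp
  then show ?thesis
    using count_fst_eq_1[of x "[]" C] distinct_map_vert[OF assms(3)] B by simp
qed

text \<open>The heads of a closed string are its tails in rotated order. The first edge occurs once,
  which gives primitivity by \<open>band_if_count\<close>.\<close>

lemma simple_band_iff:
  "simple_band G B \<longleftrightarrow> B \<noteq> [] \<and> is_string G B \<and> linked (last B) (hd B) \<and> distinct (map (vert G) B)"
proof -
  have "distinct (band_visits G B) \<longleftrightarrow> distinct (map (vert G) B)"
    if "B \<noteq> []" "is_string G B" "linked (last B) (hd B)"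
  proof -
    have "band_visits G B = map (vert G) (tl B) @ [vert G (hd B)]"
      using map_head_closed[OF that(2,1)] opp_vert[OF that(3)] by (simp add: band_visits_def)
    moreover have "mset (map (vert G) (tl B) @ [vert G (hd B)]) = mset (map (vert G) B)"
      using that(1) by (cases B) simp_all
    ultimately show ?thesis
      by (metis mset_eq_imp_distinct_iff)
  qed
  then show ?thesis
    unfolding simple_band_def
    using band_if_count[of B] closed_count_hd[of B] closed_string_iff[of B] band_def by metis
qed

lemma fringe_unique:
  assumes "fringe G v" "vert G x = v" "vert G y = v" shows "x = y"
proof -
  obtain a where "half_edges_at G v = {a}"
    using assms(1) unfolding fringe_def by (rule card_1_singletonE)
  moreover have "x \<in> half_edges_at G v" "y \<in> half_edges_at G v"
    using assms(2,3) by (simp_all add: half_edges_at_def)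
  ultimately show ?thesis
    by simp
qed

lemma inner_simple_internal:
  assumes "is_string G p" "x \<in> set (tl p)" shows "internal G (vert G x)"
proof -
  obtain A e B where "p = A @ e # x # B"
  proof -
    obtain C B where "tl p = C @ x # B"
      using assms(2) by (meson split_list)
    then have "p = butlast (hd p # C) @ last (hd p # C) # x # B"
      using assms(2) by (cases p) (auto simp: append_butlast_last_id simp flip: append_assoc)
    then show ?thesis
      using that by blast
  qed
  then have "linked e x"
    using assms(1) by (simp add: is_string_append is_string_Cons)
  then show ?thesis
    by (rule opp_internal(2))
qed

text \<open>The two ends are distinct vertices: a fringe vertex has only one half-edge, so equal
  ends would make the first edge the inverse of the last. They differ from the inner vertices
  because those are internal.\<close>

lemma simple_route_iff:
  "simple_route G p \<longleftrightarrow>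
     p \<noteq> [] \<and> inner_simple p \<and> fringe G (vert G (hd p)) \<and> fringe G (vert G (edge_inverse (last p)))"
proof
  assume "simple_route G p"
  then show "p \<noteq> [] \<and> inner_simple p \<and> fringe G (vert G (hd p)) \<and> fringe G (vert G (edge_inverse (last p)))"
    using map_head_closed[of p] by (auto simp: simple_route_def route_def inner_simple_def string_visits_def)
next
  assume R: "p \<noteq> [] \<and> inner_simple p \<and> fringe G (vert G (hd p)) \<and> fringe G (vert G (edge_inverse (last p)))"
  have "vert G (hd p) \<noteq> vert G (edge_inverse (last p))"
  proof
    assume "vert G (hd p) = vert G (edge_inverse (last p))"
    then have "hd p = edge_inverse (last p)"
      using R fringe_unique by metis
    then show False
      using R inner_simple_no_inverse[of p "last p"] by (metis hd_in_set last_in_set)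
  qed
  moreover have "v \<notin> set (map (vert G) (tl p))" if "fringe G v" for v
    using R inner_simple_internal[of p] that internal_not_fringe by (auto simp: inner_simple_def)
  ultimately have "distinct (string_visits G p)"
    using R map_head_closed[of p] by (simp add: string_visits_def inner_simple_def)
  then show "simple_route G p"
    using R by (simp add: simple_route_def route_def inner_simple_def)
qed

section \<open>Lollipops and barbells in terms of strings that use each edge once\<close>

lemma count_lollipop_visits:
  assumes "is_string G (s @ \<beta>)" "\<beta> \<noteq> []" "vert G (edge_inverse (last \<beta>)) = vert G (hd \<beta>)"
  shows "count_list (string_visits G (s @ \<beta> @ string_inverse s)) u =
    2 * count_list (map (vert G) (s @ [hd \<beta>])) u + count_list (map (vert G) (tl \<beta>)) u"
proof -
  have "is_string G (s @ [hd \<beta>])" "is_string G \<beta>"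
    using assms(1,2) by (auto simp: is_string_append)
  moreover have "hd (s @ \<beta> @ string_inverse s) = hd (s @ [hd \<beta>])"
    using assms(2) by (cases s) simp_all
  ultimately show ?thesis
    using map_head_snoc[of s "hd \<beta>"] map_head_closed[OF _ assms(2,3)] count_list_vert_Cons[of "s @ [hd \<beta>]" u]
    by (simp add: string_visits_def map_string_inverse split: if_splits)
qed

lemma lollipop_iff: "lollipop G p \<longleftrightarrow> (\<exists>s \<beta>. p = s @ \<beta> @ string_inverse s \<and> lollipop_data s \<beta>)"
proof
  assume "lollipop G p"
  then obtain s \<beta> where p: "p = s @ \<beta> @ string_inverse s" "\<beta> \<noteq> []" and r: "route G p"
    and t: "twice_on_once_off (vertices_of_string_to G s (tail G (hd \<beta>))) (string_visits G p)"
    unfolding lollipop_def by blast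
  have str: "is_string G (s @ \<beta>)" "is_string G \<beta>"
    using r p by (auto simp: route_def is_string_append)
  have V: "vertices_of_string_to G s (tail G (hd \<beta>)) = set (map (vert G) (s @ [hd \<beta>]))"
    by (auto simp: vertices_of_string_to_def)
  \<comment> \<open>For a lazy \<open>s\<close> the required second visit to the start can only be
    at the end of \<beta>. Both ends are then the same fringe vertex, whose only half-edge would
    make the first edge the inverse of the last.\<close>
  have "s \<noteq> []"
  proof
    assume s: "s = []"
    let ?u = "vert G (hd \<beta>)"
    have f: "fringe G ?u" "fringe G (vert G (edge_inverse (last \<beta>)))"
      using r p s by (auto simp: route_def)
    have vis: "string_visits G p = ?u # map (vert G) (tl \<beta>) @ [vert G (edge_inverse (last \<beta>))]"
      using map_head_closed[OF str(2) p(2)] p s by (simp add: string_visits_def)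
    have n: "?u \<notin> set (map (vert G) (tl \<beta>))"
      using inner_simple_internal[OF str(2)] f internal_not_fringe by auto
    have "count_list (string_visits G p) ?u = 2"
      using t V s vis by (simp add: twice_on_once_off_def del: count_list.simps)
    then have u: "vert G (edge_inverse (last \<beta>)) = ?u"
      using vis n by (simp split: if_splits)
    have "distinct (map (vert G) ([] @ [hd \<beta>]) @ map (vert G) (tl \<beta>))"
      using twice_on_once_off_iff[OF count_lollipop_visits[OF str(1) p(2) u]] t V p s by simp
    then have "inner_simple \<beta>"
      using str by (simp add: inner_simple_def)
    moreover have "edge_inverse (last \<beta>) = hd \<beta>"
      using fringe_unique[OF f(1)] u by blast
    ultimately show False
      using inner_simple_no_inverse[of \<beta> "last \<beta>"] p(2) by simp
  qed
  then have l: "linked (last s) (hd \<beta>)" "linked (last \<beta>) (edge_inverse (last s))"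
    using r p by (auto simp: route_def is_string_append)
  have same: "same (hd \<beta>) (edge_inverse (last \<beta>))"
    using opp_opp_trans[OF opp_sym[OF l(1)] opp_sym[OF l(2)]] .
  have "distinct (map (vert G) (s @ [hd \<beta>]) @ map (vert G) (tl \<beta>))"
    using twice_on_once_off_iff[OF count_lollipop_visits[OF str(1) p(2)]] same_vert[OF same] t V p by simp
  then have "distinct (map (vert G) (s @ \<beta>))"
    using p(2) by (cases \<beta>) auto
  then have "inner_simple (s @ \<beta>)"
    using str(1) \<open>s \<noteq> []\<close> by (cases s) (simp_all add: inner_simple_def)
  then have "lollipop_data s \<beta>"
    using same \<open>s \<noteq> []\<close> p r by (simp add: lollipop_data_def route_def)
  then show "\<exists>s \<beta>. p = s @ \<beta> @ string_inverse s \<and> lollipop_data s \<beta>"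
    using p by blast
next
  assume "\<exists>s \<beta>. p = s @ \<beta> @ string_inverse s \<and> lollipop_data s \<beta>"
  then obtain s \<beta> where p: "p = s @ \<beta> @ string_inverse s" and d: "lollipop_data s \<beta>"
    by blast
  note d = d[unfolded lollipop_data_def]
  have str: "is_string G (s @ \<beta>)" and l: "linked (last s) (hd \<beta>)"
    using d by (auto simp: inner_simple_def is_string_append)
  have "opp (edge_inverse (last s)) (edge_inverse (last \<beta>))"
    using opp_same_trans[OF l] d by blast
  then have "linked (last \<beta>) (edge_inverse (last s))"
    by (rule opp_sym)
  then have "route G p"
    using str d p by (auto simp: route_def is_string_append)
  \<comment> \<open>\<open>inner_simple\<close> leaves the first vertex of \<open>s\<close> free. It
    is distinct from the later ones because it is fringe and they are internal.\<close>
  moreover have "distinct (map (vert G) (s @ [hd \<beta>]) @ map (vert G) (tl \<beta>))"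
  proof -
    have "vert G (hd s) \<notin> set (map (vert G) (tl (s @ \<beta>)))"
      using inner_simple_internal[OF str] d internal_not_fringe by fastforce
    then show ?thesis
      using d by (cases s; cases \<beta>) (auto simp: inner_simple_def)
  qed
  then have "twice_on_once_off (set (map (vert G) (s @ [hd \<beta>]))) (string_visits G p)"
    using twice_on_once_off_iff[OF count_lollipop_visits[OF str]] d p same_vert[of "hd \<beta>"] by metis
  moreover have "vertices_of_string_to G s (tail G (hd \<beta>)) = set (map (vert G) (s @ [hd \<beta>]))"
    by (auto simp: vertices_of_string_to_def)
  ultimately show "lollipop G p"
    using d p unfolding lollipop_def by metis
qed

lemma count_barbell_visits:
  assumes "is_string G (\<alpha> @ s @ \<beta>)" "\<alpha> \<noteq> []" "\<beta> \<noteq> []" "vert G (edge_inverse (last \<beta>)) = vert G (hd \<beta>)"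
  shows "count_list (band_visits G (s @ \<beta> @ string_inverse s @ \<alpha>)) u =
    2 * count_list (map (vert G) (s @ [hd \<beta>])) u + count_list (map (vert G) (tl \<alpha> @ tl \<beta>)) u"
proof -
  have str: "is_string G (s @ [hd \<beta>])" "is_string G \<beta>" "is_string G \<alpha>"
    using assms(1-3) by (auto simp: is_string_append)
  have "linked (last \<alpha>) (hd (s @ [hd \<beta>]))"
    using assms(1-3) by (cases s) (auto simp: is_string_append is_string_Cons)
  then have "vert G (edge_inverse (last \<alpha>)) = vert G (hd (s @ [hd \<beta>]))"
    by (rule opp_vert)
  then show ?thesis
    using map_head_snoc[OF str(1)] map_head_closed[OF str(2) assms(3,4)] map_head_closed[OF str(3) assms(2)]
      count_list_vert_Cons[of "s @ [hd \<beta>]" u]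
    by (simp add: band_visits_def map_string_inverse split: if_splits)
qed

text \<open>The definition constrains one of the two cycles directly. That the band closes up forces
  the other cycle to be nonempty and to turn back within one class as well.\<close>

lemma barbell_dataE:
  assumes "barbell G B"
  obtains n \<alpha> s \<beta> where "rotate n B = s @ \<beta> @ string_inverse s @ \<alpha>" "barbell_data \<alpha> s \<beta>"
proof -
  obtain n s \<alpha> \<beta> where b: "\<beta> \<noteq> []" "rotate n B = s @ \<beta> @ string_inverse s @ \<alpha>"
    and same: "same (hd \<beta>) (edge_inverse (last \<beta>))"
    and t: "twice_on_once_off (vertices_of_string_to G s (tail G (hd \<beta>))) (band_visits G B)"
    and band: "band G B"
    using assms unfolding barbell_def head_half_eq tail_half_eq by blast
  let ?C = "s @ \<beta> @ string_inverse s @ \<alpha>"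
  have C: "is_string G (?C @ ?C)"
    using closed_string_rotate[of B n] band b(2) by (simp add: band_def)
  \<comment> \<open>Without \<alpha> the closing junction would either continue \<beta> into itself
    within one class, or step back along the edge of \<open>s\<close> just traversed.\<close>
  have \<alpha>: "\<alpha> \<noteq> []"
  proof
    assume \<alpha>: "\<alpha> = []"
    show False
    proof (cases "s = []")
      case True
      then have "linked (last \<beta>) (hd \<beta>)"
        using C b(1) \<alpha> by (simp add: is_string_append)
      then show False
        using same opp_sym not_opp_and_same by metis
    next
      case False
      have "linked (last (string_inverse s)) (hd s)"
        using C False \<alpha> by (simp add: is_string_append)
      then show False
        using False by simp
    qed
  qed
  \<comment> \<open>Both ends of \<alpha> are opposite to a common half-edge, the start of
    \<open>s\<close>, if there is one. For a lazy \<open>s\<close> they are opposite to the two ends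
    of \<beta>, which share a class.\<close>
  have same_\<alpha>: "same (hd \<alpha>) (edge_inverse (last \<alpha>))"
  proof (cases "s = []")
    case True
    then have "linked (last \<beta>) (hd \<alpha>)" "linked (last \<alpha>) (hd \<beta>)"
      using C b(1) \<alpha> by (auto simp: is_string_append)
    then show ?thesis
      using same by (meson opp_opp_trans opp_same_trans opp_sym)
  next
    case False
    then have "linked (last (string_inverse s)) (hd \<alpha>)" "linked (last \<alpha>) (hd s)"
      using C b(1) \<alpha> by (auto simp: is_string_append)
    then show ?thesis
      using False by simp (meson opp_opp_trans opp_sym)
  qed
  have str: "is_string G (\<alpha> @ s @ \<beta>)"
    using C b(1) \<alpha> by (cases "s = []") (auto simp: is_string_append)
  have "count_list (band_visits G B) u = count_list (band_visits G ?C) u" for u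
    unfolding b(2)[symmetric] by (simp add: band_visits_def flip: rotate_map)
  then have "distinct (map (vert G) (s @ [hd \<beta>]) @ map (vert G) (tl \<alpha> @ tl \<beta>))"
    using twice_on_once_off_iff[of "band_visits G B" "map (vert G) (s @ [hd \<beta>])" "map (vert G) (tl \<alpha> @ tl \<beta>)"]
      count_barbell_visits[OF str \<alpha> b(1)] same_vert[OF same] t
    by (simp add: vertices_of_string_to_def)
  then have "distinct (map (vert G) (tl \<alpha> @ s @ \<beta>))"
    using b(1) by (cases \<beta>) auto
  then have "inner_simple (\<alpha> @ s @ \<beta>)"
    using str \<alpha> by (simp add: inner_simple_def)
  then show ?thesis
    using that b same same_\<alpha> \<alpha> by (simp add: barbell_data_def)
qed

lemma barbell_data_closed:
  assumes "barbell_data \<alpha> s \<beta>"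
  shows "is_string G ((\<alpha> @ s @ \<beta> @ string_inverse s) @ (\<alpha> @ s @ \<beta> @ string_inverse s))"
proof -
  note d = assms[unfolded barbell_data_def]
  have str: "is_string G (\<alpha> @ s @ \<beta>)"
    using d by (simp add: inner_simple_def)
  show ?thesis
  proof (cases "s = []")
    case True
    then have "linked (last \<alpha>) (hd \<beta>)"
      using str d by (simp add: is_string_append)
    then have "linked (last \<beta>) (hd \<alpha>)"
      using d by (meson opp_same_trans opp_sym same_sym)
    then show ?thesis
      using True str d by (simp add: is_string_append)
  next
    case False
    then have "linked (last s) (hd \<beta>)" "linked (last \<alpha>) (hd s)"
      using str d by (auto simp: is_string_append)
    then have "linked (last \<beta>) (edge_inverse (last s))" "opp (hd s) (hd \<alpha>)"
      using d by (meson opp_same_trans opp_sym same_sym)+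
    then show ?thesis
      using False str d by (simp add: is_string_append)
  qed
qed

text \<open>The edges of \<open>s\<close> occur twice, so the edge that occurs once is taken from a
  cycle.\<close>

lemma barbell_data_count:
  assumes "barbell_data \<alpha> s \<beta>"
  shows "count_list (map fst (\<alpha> @ s @ \<beta> @ string_inverse s)) (fst (hd \<beta>)) = 1"
proof -
  note d = assms[unfolded barbell_data_def]
  let ?L = "\<alpha> @ s @ \<beta>"
  have str: "is_string G ?L"
    using d by (simp add: inner_simple_def)
  have "tl ?L = tl \<alpha> @ s @ hd \<beta> # tl \<beta>"
    using d by simp
  then have tl: "distinct (map (vert G) (tl \<alpha> @ s @ hd \<beta> # tl \<beta>))"
    using d unfolding inner_simple_def by metis
  \<comment> \<open>Distinctness of the inner vertices says nothing about the tail of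
    \<open>hd \<alpha>\<close>. If the two edges were equal, the edge after \<alpha> would start at
    the same inner vertex and so be \<open>hd \<alpha>\<close> itself, although \<alpha> cannot
    continue into its own start.\<close>
  have "hd \<alpha> \<noteq> hd \<beta>"
  proof
    assume eq: "hd \<alpha> = hd \<beta>"
    have l: "linked (last \<alpha>) (hd (s @ \<beta>))"
      using str d by (auto simp: is_string_append hd_append)
    then have "vert G (hd (s @ \<beta>)) = vert G (hd \<beta>)"
      using opp_vert[OF l] same_vert[of "hd \<alpha>"] d eq by metis
    moreover have "hd (s @ \<beta>) \<in> set (tl ?L)" "hd \<beta> \<in> set (tl ?L)"
      using d by (auto simp: hd_append)
    ultimately have "hd (s @ \<beta>) = hd \<alpha>"
      using inner_simple_inj[of ?L] d eq by metis
    then show False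
      using l d not_opp_and_same same_sym by metis
  qed
  moreover have "hd \<beta> \<notin> set (tl \<alpha> @ s @ tl \<beta>)"
    using tl by auto
  ultimately have "hd \<beta> \<notin> set (\<alpha> @ s @ tl \<beta>)"
    using d by (cases \<alpha>) auto
  moreover have "edge_inverse (hd \<beta>) \<notin> set ?L"
    using inner_simple_no_inverse[of ?L "hd \<beta>"] d by simp
  then have "edge_inverse (hd \<beta>) \<notin> set ?L" "hd \<beta> \<notin> set (string_inverse s)"
    by (auto simp: image_iff)
  moreover have "edge_inverse (hd \<beta>) \<notin> set (string_inverse s)"
    using \<open>hd \<beta> \<notin> set (\<alpha> @ s @ tl \<beta>)\<close> by (auto simp: image_iff)
  ultimately have "count_list (map fst ((\<alpha> @ s) @ hd \<beta> # tl \<beta> @ string_inverse s)) (fst (hd \<beta>)) = 1"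
    using d by (intro count_fst_eq_1) (auto dest: list.set_sel(2))
  moreover have "(\<alpha> @ s) @ hd \<beta> # tl \<beta> @ string_inverse s = \<alpha> @ s @ \<beta> @ string_inverse s"
    using d by simp
  ultimately show ?thesis
    by (simp only:)
qed

lemma barbell_data_band: "barbell_data \<alpha> s \<beta> \<Longrightarrow> band G (\<alpha> @ s @ \<beta> @ string_inverse s)"
  using band_if_count barbell_data_closed barbell_data_count by blast

lemma barbell_data_barbell:
  assumes "barbell_data \<alpha> s \<beta>"
  shows "barbell G (\<alpha> @ s @ \<beta> @ string_inverse s)"
proof -
  let ?B = "\<alpha> @ s @ \<beta> @ string_inverse s"
  note d = assms[unfolded barbell_data_def]
  have rot: "rotate (length \<alpha>) ?B = s @ \<beta> @ string_inverse s @ \<alpha>"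
    by (simp add: rotate_append)
  have str: "is_string G (\<alpha> @ s @ \<beta>)"
    using d by (simp add: inner_simple_def)
  have "count_list (band_visits G ?B) u = count_list (band_visits G (s @ \<beta> @ string_inverse s @ \<alpha>)) u" for u
    by (simp add: band_visits_def)
  moreover have "mset (map (vert G) (s @ [hd \<beta>]) @ map (vert G) (tl \<alpha> @ tl \<beta>)) = mset (map (vert G) (tl (\<alpha> @ s @ \<beta>)))"
    using d by (cases \<beta>) simp_all
  then have "distinct (map (vert G) (s @ [hd \<beta>]) @ map (vert G) (tl \<alpha> @ tl \<beta>))"
    using d unfolding inner_simple_def by (metis mset_eq_imp_distinct_iff)
  ultimately have "twice_on_once_off (set (map (vert G) (s @ [hd \<beta>]))) (band_visits G ?B)"
    using twice_on_once_off_iff[of "band_visits G ?B" "map (vert G) (s @ [hd \<beta>])" "map (vert G) (tl \<alpha> @ tl \<beta>)"]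
      count_barbell_visits[OF str] d same_vert[of "hd \<beta>" "edge_inverse (last \<beta>)"] by simp
  then have "twice_on_once_off (vertices_of_string_to G s (tail G (hd \<beta>))) (band_visits G ?B)"
    by (simp add: vertices_of_string_to_def)
  then show ?thesis
    using barbell_data_band[OF assms] rot d unfolding barbell_def head_half_eq tail_half_eq by blast
qed

end

section \<open>Existence of trails\<close>

context turbulence
begin

text \<open>In the second alternative \<open>r\<close> is a cycle on which the string can turn back
  towards \<open>q\<close>. A return through the opposite class would instead close \<open>r\<close>
  into a simple band.\<close>

definition ends_well :: "'e oriented_edge list \<Rightarrow> bool" where
  "ends_well p \<longleftrightarrow>
     fringe G (vert G (edge_inverse (last p))) \<or>
     (\<exists>q r. p = q @ r \<and> q \<noteq> [] \<and> r \<noteq> [] \<and> same (hd r) (edge_inverse (last p)))"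

text \<open>Some half-edge of \<open>X\<close> is opposite to the end of \<open>p\<close>. It can
  fail to extend \<open>p\<close> only because the end is already an inner vertex, where some edge
  \<open>f\<close> of \<open>p\<close> starts. The class of \<open>f\<close> decides between a turn
  and a simple band.\<close>

lemma ends_well_if_maximal:
  assumes p: "inner_simple p" "p \<noteq> []" "set p \<subseteq> X"
    and X: "\<And>x. x \<in> X \<Longrightarrow> edge_inverse x \<in> X"
      "\<And>x. x \<in> X \<Longrightarrow> internal G (vert G x) \<Longrightarrow> \<exists>y\<in>X. opp x y"
    and maximal: "\<And>y. y \<in> X \<Longrightarrow> \<not> inner_simple (p @ [y])"
  shows "(\<exists>B. set B \<subseteq> X \<and> simple_band G B) \<or> ends_well p"
proof (cases "fringe G (vert G (edge_inverse (last p)))")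
  case False
  let ?z = "edge_inverse (last p)"
  have "?z \<in> X" "internal G (vert G ?z)"
    using last_in_set[OF p(2)] p(3) X(1)[of "last p"] internal_or_fringe[of ?z] False by blast+
  then obtain y where y: "y \<in> X" "opp ?z y"
    using X(2) by blast
  have "is_string G (p @ [y])"
    using p y by (simp add: is_string_append inner_simple_def)
  then have "\<not> distinct (map (vert G) (tl p @ [y]))"
    using maximal[OF y(1)] p(2) by (simp add: inner_simple_def)
  then have "vert G y \<in> vert G ` set (tl p)"
    using p(1) by (simp add: inner_simple_def)
  then obtain f where f: "f \<in> set (tl p)" "vert G f = vert G ?z"
    using opp_vert[OF y(2)] by auto
  then obtain C B where "tl p = C @ f # B"
    by (meson split_list)
  then have split: "p = (hd p # C) @ f # B"
    using p(2) by (metis append_Cons list.collapse)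
  show ?thesis
  proof (cases "same f ?z")
    case True
    then show ?thesis
      unfolding ends_well_def using split by (metis list.distinct(1) list.sel(1))
  next
    case False
    have last: "last (f # B) = last p"
      by (subst split) simp
    have "opp f ?z"
      using opp_iff_not_same[of f ?z] f(2) \<open>internal G (vert G ?z)\<close> False by simp
    then have "linked (last (f # B)) (hd (f # B))"
      using last opp_sym by simp
    moreover have "distinct (map (vert G) (f # B))"
      using p(1) \<open>tl p = C @ f # B\<close> by (simp add: inner_simple_def)
    moreover have "is_string G (f # B)"
      using p(1) split by (metis inner_simple_string is_string_append)
    ultimately have "simple_band G (f # B)"
      by (simp only: simple_band_iff) simp
    moreover have "set (f # B) \<subseteq> X"
      using p(3) by (subst (asm) split) simp
    ultimately show ?thesis
      by blast
  qed
qed (simp add: ends_well_def)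

text \<open>The turns give an initial cycle \<open>c\<close> and a final cycle \<open>b\<close>. If
  they do not overlap in \<open>p\<close>, they are the two cycles of a barbell. If they overlap in
  \<open>m\<close>, so that \<open>p\<close> is \<open>a @ m @ d\<close>, then skipping
  \<open>m\<close> and running through \<open>d\<close> backwards closes up to a simple
  band.\<close>

lemma trail_if_two_turns:
  assumes p: "inner_simple p" "p = a @ b" "a \<noteq> []" "b \<noteq> []" "same (hd b) (edge_inverse (last p))"
    "p = c @ d" "c \<noteq> []" "d \<noteq> []" "same (edge_inverse (last c)) (hd p)"
  shows "(\<exists>B. set B \<subseteq> halves p \<and> simple_band G B) \<or>
    (\<exists>\<alpha> s \<beta>. barbell_data \<alpha> s \<beta> \<and> p = \<alpha> @ s @ \<beta>)"
proof -
  have ends: "last b = last p" "last d = last p" "hd a = hd p" "hd c = hd p"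
    using p(4,8) p(3,7) unfolding p(2) by (simp, metis p(2,6) last_appendR, simp, metis p(2,6) hd_append2)
  consider s where "a = c @ s" "d = s @ b" | m where "c = a @ m" "b = m @ d" "m \<noteq> []"
    using p(2,6) by (auto simp: append_eq_append_conv2) blast
  then show ?thesis
  proof cases
    case 1
    then have "p = c @ s @ b"
      using p(2) by simp
    moreover from this have "barbell_data c s b"
      using p(1,4,5,7,9) ends same_sym unfolding barbell_data_def by metis
    ultimately show ?thesis
      by blast
  next
    case 2
    let ?c = "a @ string_inverse d"
    have pm: "p = a @ m @ d"
      using p(2) 2 by simp
    then have "is_string G (a @ m @ d)"
      using p(1) by (simp add: inner_simple_def)
    then have str: "is_string G a" "is_string G d" "linked (last a) (hd m)" "linked (last c) (hd d)"
      using p(3,8) 2 by (auto simp: is_string_append)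
    have m: "hd m = hd b"
      using 2 by simp
    have "linked (last a) (edge_inverse (last d))"
      using opp_same_trans[OF str(3)] p(5) m ends by simp
    then have c: "is_string G ?c"
      using str(1,2) p(8) by (simp add: is_string_append)
    have "opp (hd d) (hd p)"
      using opp_same_trans[OF opp_sym[OF str(4)] p(9)] .
    then have "linked (last ?c) (hd ?c)"
      using p(3,8) ends by simp
    moreover have "distinct (map (vert G) ?c)"
    proof -
      have "map (\<lambda>x. vert G (edge_inverse x)) d = map (vert G) (tl d) @ [vert G (hd m)]"
        using map_head_closed[OF str(2) p(8)] ends same_vert[OF p(5)] m by simp
      then have "mset (map (vert G) (string_inverse d)) = mset (map (vert G) (tl d) @ [vert G (hd m)])"
        unfolding map_string_inverse by (simp only: mset_rev)
      moreover have "vert G (hd p) = vert G (hd d)"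
        using opp_vert[OF str(4)] same_vert[OF p(9)] by simp
      then have "mset (map (vert G) a) = mset (vert G (hd d) # map (vert G) (tl a))"
        using ends p(3) by (cases a) simp_all
      ultimately have "mset (map (vert G) ?c) = mset (map (vert G) (tl a @ hd m # hd d # tl d))"
        by simp
      moreover have "tl p = tl a @ (hd m # tl m) @ hd d # tl d"
        using pm p(3,8) 2(3) by simp
      then have "distinct (map (vert G) (tl a @ hd m # hd d # tl d))"
        using p(1) unfolding inner_simple_def by auto
      ultimately show ?thesis
        using mset_eq_imp_distinct_iff by blast
    qed
    moreover have "?c \<noteq> []"
      using p(3) by simp
    ultimately have "simple_band G ?c"
      unfolding simple_band_iff using c by blast
    moreover have "set ?c \<subseteq> halves p"
      unfolding pm by (auto simp: halves_eq)
    ultimately show ?thesis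
      by blast
  qed
qed

lemma trail_if_ends_well:
  assumes "inner_simple p" "p \<noteq> []" "ends_well p" "ends_well (string_inverse p)"
  shows "(\<exists>q. set q \<subseteq> halves p \<and> (simple_route G q \<or> simple_band G q)) \<or>
    (\<exists>s \<beta>. lollipop_data s \<beta> \<and> set (s @ \<beta>) \<subseteq> halves p) \<or>
    (\<exists>\<alpha> s \<beta>. barbell_data \<alpha> s \<beta> \<and> set (\<alpha> @ s @ \<beta>) \<subseteq> halves p)"
proof -
  let ?turn = "\<lambda>q. \<exists>a b. q = a @ b \<and> a \<noteq> [] \<and> b \<noteq> [] \<and> same (hd b) (edge_inverse (last q))"
  have lollipop: "\<exists>s \<beta>. lollipop_data s \<beta> \<and> set (s @ \<beta>) \<subseteq> halves q"
    if q: "inner_simple q" "fringe G (vert G (hd q))" "?turn q" for q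
  proof -
    obtain a b where ab: "q = a @ b" "a \<noteq> []" "b \<noteq> []" "same (hd b) (edge_inverse (last q))"
      using q(3) by blast
    then have "lollipop_data a b"
      using q(1,2) by (simp add: lollipop_data_def)
    then show ?thesis
      using ab(1) set_subset_halves by blast
  qed
  consider
      (a) "fringe G (vert G (edge_inverse (last p)))" "fringe G (vert G (hd p))"
    | (b) "?turn p" "fringe G (vert G (hd p))"
    | (c) "?turn (string_inverse p)" "fringe G (vert G (edge_inverse (last p)))"
    | (d) "?turn p" "?turn (string_inverse p)"
    using assms(2-4) unfolding ends_well_def last_string_inverse[OF assms(2)] edge_inverse_inverse by blast
  then show ?thesis
  proof cases
    case a
    then have "simple_route G p"
      using assms(1,2) by (simp add: simple_route_iff)
    then show ?thesis
      using set_subset_halves by blast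
  next
    case b
    then show ?thesis
      using lollipop[OF assms(1)] by blast
  next
    case c
    have "\<exists>s \<beta>. lollipop_data s \<beta> \<and> set (s @ \<beta>) \<subseteq> halves (string_inverse p)"
      using c assms by (intro lollipop) simp_all
    then show ?thesis
      unfolding halves_string_inverse by blast
  next
    case d
    obtain a b where ab: "p = a @ b" "a \<noteq> []" "b \<noteq> []" "same (hd b) (edge_inverse (last p))"
      using d(1) by blast
    obtain a' b' where ab': "string_inverse p = a' @ b'" "a' \<noteq> []" "b' \<noteq> []"
      "same (hd b') (edge_inverse (last (string_inverse p)))"
      using d(2) by blast
    \<comment> \<open>A turn of the inverse string is a turn at the beginning of \<open>p\<close>,
      with the order of the two pieces exchanged.\<close>
    have "p = string_inverse b' @ string_inverse a'"
      using arg_cong[OF ab'(1), of string_inverse] by simp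
    moreover have "same (edge_inverse (last (string_inverse b'))) (hd p)"
      using ab'(3,4) assms(2) by simp
    moreover have "string_inverse b' \<noteq> []" "string_inverse a' \<noteq> []"
      using ab' by simp_all
    ultimately have "(\<exists>B. set B \<subseteq> halves p \<and> simple_band G B) \<or>
        (\<exists>\<alpha> s \<beta>. barbell_data \<alpha> s \<beta> \<and> p = \<alpha> @ s @ \<beta>)"
      using trail_if_two_turns[OF assms(1) ab] by blast
    then show ?thesis
      using set_subset_halves[of p] by meson
  qed
qed

text \<open>A string in \<open>X\<close> with distinct inner vertices and of maximal length cannot
  be extended at its end, and neither can its inverse, which has the same length.\<close>

proposition exists_trail:
  assumes "X \<noteq> {}"
    and X: "\<And>x. x \<in> X \<Longrightarrow> edge_inverse x \<in> X"
      "\<And>x. x \<in> X \<Longrightarrow> internal G (vert G x) \<Longrightarrow> \<exists>y\<in>X. opp x y"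
  shows "(\<exists>q. set q \<subseteq> X \<and> (simple_route G q \<or> simple_band G q)) \<or>
    (\<exists>s \<beta>. lollipop_data s \<beta> \<and> set (s @ \<beta>) \<subseteq> X) \<or>
    (\<exists>\<alpha> s \<beta>. barbell_data \<alpha> s \<beta> \<and> set (\<alpha> @ s @ \<beta>) \<subseteq> X)"
proof -
  let ?P = "\<lambda>p. p \<noteq> [] \<and> inner_simple p \<and> set p \<subseteq> X"
  obtain x where "x \<in> X"
    using assms(1) by blast
  then have x: "?P [x]"
    by (simp add: inner_simple_def)
  \<comment> \<open>Only the edges of \<open>tl p\<close> are known to be distinct, which costs one;
    the strict inequality costs another one.\<close>
  have bound: "length p < CARD('e half_edge) + 2" if "?P p" for p
  proof -
    have "distinct (tl p)"
      using that by (auto simp: inner_simple_def distinct_map)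
    then have "length (tl p) \<le> CARD('e half_edge)"
      by (metis card_mono distinct_card finite_code top_greatest)
    then show ?thesis
      by simp
  qed
  have "\<exists>p. ?P p \<and> (\<forall>q. ?P q \<longrightarrow> length q \<le> length p)"
    using x by (rule ex_has_greatest_nat) (use bound in blast)
  then obtain p where p: "?P p" and max: "\<And>q. ?P q \<Longrightarrow> length q \<le> length p"
    by meson
  have inv: "?P (string_inverse q)" if "?P q" for q
    using that X(1) by auto
  have "set q \<subseteq> X" if "set q \<subseteq> halves p" for q
    using that p X(1) unfolding halves_eq by blast
  moreover have "(\<exists>B. set B \<subseteq> X \<and> simple_band G B) \<or> ends_well p"
    using p max[of "p @ [_]"] by (intro ends_well_if_maximal X) auto
  moreover have "(\<exists>B. set B \<subseteq> X \<and> simple_band G B) \<or> ends_well (string_inverse p)"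
    using inv[OF p] max[of "string_inverse p @ [_]"] by (intro ends_well_if_maximal X) auto
  ultimately show ?thesis
    using trail_if_ends_well[of p] p by meson
qed

end

section \<open>Flows supported on a trail\<close>

lemma sum_indicator_vector:
  fixes A :: "'e::finite half_edge set"
  shows "(\<Sum>x\<in>A. indicator_vector p $ fst x) =
    (\<Sum>y\<leftarrow>p. of_bool (y \<in> A) + of_bool (edge_inverse y \<in> A))"
proof (induction p)
  case (Cons y p)
  have "indicator_vector (y # p) $ fst x = of_bool (x = y) + of_bool (x = edge_inverse y) + indicator_vector p $ fst x"
    for x :: "'e half_edge"
    using fst_eq_iff[of x y] by (auto simp: indicator_vector_nth)
  moreover have "(\<Sum>x\<in>A. of_bool (x = y) + of_bool (x = edge_inverse y)) =
      (of_bool (y \<in> A) + of_bool (edge_inverse y \<in> A) :: real)"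
    by (simp add: sum.distrib of_bool_def)
  ultimately show ?case
    using Cons by (simp add: sum.distrib)
qed (simp add: indicator_vector_nth)

context turbulence
begin

text \<open>The two half-edges of each traversed edge are regrouped by the junctions where
  consecutive edges meet, and only the two ends of the string are left over. For conservation at the
  vertex of \<open>a\<close> the weight \<open>w\<close> marks that vertex, for the strength it is
  0.\<close>

lemma sum_over_string:
  fixes w :: "'v \<Rightarrow> real"
  assumes "is_string G p" "p \<noteq> []"
    and "\<And>x y. linked x y \<Longrightarrow> of_bool (edge_inverse x \<in> A) + of_bool (y \<in> A) = w (vert G y)"
  shows "(\<Sum>y\<leftarrow>p. of_bool (y \<in> A) + of_bool (edge_inverse y \<in> A)) =
    of_bool (hd p \<in> A) + of_bool (edge_inverse (last p) \<in> A) + (\<Sum>y\<leftarrow>tl p. w (vert G y))"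
  using assms(1,2)
proof (induction p rule: induct_list012)
  case (3 x y p)
  have "of_bool (edge_inverse x \<in> A) + of_bool (y \<in> A) = w (vert G y)"
    using 3(3) by (intro assms(3)) (simp add: is_string_Cons)
  moreover have "is_string G (y # p)"
    using 3(3) by (simp add: is_string_Cons)
  ultimately show ?case
    using 3(2) by (simp del: of_bool_eq_iff)
qed simp_all

text \<open>Passing through a vertex uses exactly one half-edge of each class there.\<close>

lemma linked_class:
  assumes "linked x y" "internal G (vert G a)"
  shows "of_bool (same a (edge_inverse x)) + of_bool (same a y) = (of_bool (vert G y = vert G a) :: real)"
proof (cases "vert G y = vert G a")
  case True
  then have v: "vert G a = vert G (edge_inverse x)" "vert G a = vert G y"
    using opp_vert[OF assms(1)] by simp_all
  have "\<not> (same a (edge_inverse x) \<and> same a y)"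
    using assms(1) same_sym same_trans not_opp_and_same by metis
  moreover have "same a (edge_inverse x) \<or> same a y"
    using opp_iff_not_same[OF assms(2) v(1)] opp_iff_not_same[OF assms(2) v(2)] opp_opp_trans[OF _ assms(1)]
      not_opp_and_same by blast
  ultimately show ?thesis
    using True by auto
next
  case False
  then show ?thesis
    using same_vert[of a y] same_vert[of a "edge_inverse x"] opp_vert[OF assms(1)] by auto
qed

lemma is_flowI:
  assumes "\<And>a b. opp a b \<Longrightarrow> (\<Sum>x | same a x. F $ fst x) = (\<Sum>x | same b x. F $ fst x)"
  shows "is_flow G F"
  unfolding is_flow_def
proof (intro allI impI ballI)
  fix v C D assume v: "internal G v" and C: "C \<in> half_edges_at G v // sim G v" and D: "D \<in> half_edges_at G v // sim G v"
  obtain a where a: "vert G a = v" "C = {y. same a y}"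
    using quotient_eq[OF v C] by blast
  obtain b where b: "vert G b = v" "D = {y. same b y}"
    using quotient_eq[OF v D] by blast
  show "(\<Sum>x\<in>C. F $ fst x) = (\<Sum>x\<in>D. F $ fst x)"
  proof (cases "same a b")
    case True
    then have "C = D"
      using a(2) b(2) same_trans[OF True] same_trans[OF same_sym[OF True]] by blast
    then show ?thesis
      by simp
  next
    case False
    then have "opp a b"
      using opp_iff_not_same[of a b] a(1) b(1) v by simp
    then show ?thesis
      using assms a(2) b(2) by simp
  qed
qed

lemma flow_eq:
  assumes "is_flow G F" "opp a b"
  shows "(\<Sum>x | same a x. F $ fst x) = (\<Sum>x | same b x. F $ fst x)"
proof -
  note v = opp_vert[OF assms(2)] opp_internal[OF assms(2)]
  show ?thesis
    using assms(1)[unfolded is_flow_def, rule_format, OF v(3) class_in_quotient[OF v(2), unfolded v(1)]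
        class_in_quotient[OF v(3)]] .
qed

lemma string_flow:
  assumes "is_string G p" "p \<noteq> []"
    and "route G p \<or> linked (last p) (hd p)"
  shows "is_flow G (indicator_vector p)"
proof (rule is_flowI)
  fix a b assume ab: "opp a b"
  \<comment> \<open>The right-hand side depends on \<open>a\<close> only through its vertex, so both
    classes at this vertex receive the same total.\<close>
  have *: "(\<Sum>x | same a x. indicator_vector p $ fst x) =
      (\<Sum>y\<leftarrow>tl p. of_bool (vert G y = vert G a)) + of_bool (linked (last p) (hd p) \<and> vert G (hd p) = vert G a)"
    if a: "internal G (vert G a)" for a
  proof -
    have "(\<Sum>x | same a x. indicator_vector p $ fst x) =
        of_bool (same a (hd p)) + of_bool (same a (edge_inverse (last p))) + (\<Sum>y\<leftarrow>tl p. of_bool (vert G y = vert G a))"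
      unfolding sum_indicator_vector
      using sum_over_string[OF assms(1,2), of "{x. same a x}" "\<lambda>v. of_bool (v = vert G a)"] linked_class[OF _ a]
      by simp
    moreover have "of_bool (same a (hd p)) + of_bool (same a (edge_inverse (last p))) =
        (of_bool (linked (last p) (hd p) \<and> vert G (hd p) = vert G a) :: real)"
    proof (cases "linked (last p) (hd p)")
      case True
      then show ?thesis
        using linked_class[OF True a] by simp
    next
      case False
      then have "\<not> same a (hd p)" "\<not> same a (edge_inverse (last p))"
        using assms(3) same_internal(2)[of a] internal_not_fringe unfolding route_def tail_eq head_eq by blast+
      then show ?thesis
        using False by simp
    qed
    ultimately show ?thesis
      by simp
  qed
  show "(\<Sum>x | same a x. indicator_vector p $ fst x) = (\<Sum>x | same b x. indicator_vector p $ fst x)"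
    using *[OF opp_internal(1)[OF ab]] *[OF opp_internal(2)[OF ab]] opp_vert[OF ab] by simp
qed

lemma string_strength:
  assumes "is_string G p" "p \<noteq> []"
  shows "2 * strength G (indicator_vector p) =
    of_bool (fringe G (vert G (hd p))) + of_bool (fringe G (vert G (edge_inverse (last p))))"
proof -
  have "of_bool (edge_inverse x \<in> {x. fringe G (vert G x)}) + of_bool (y \<in> {x. fringe G (vert G x)}) = (0 :: real)"
    if "linked x y" for x y
    using opp_internal[OF that] internal_not_fringe by simp
  then show ?thesis
    unfolding strength_def sum_indicator_vector
    using sum_over_string[OF assms, of "{x. fringe G (vert G x)}" "\<lambda>_. 0"] by simp
qed

lemma route_in_polyhedron:
  assumes "route G p" shows "indicator_vector p \<in> turbulence_polyhedron G"
  using assms string_flow[of p] string_strength[of p] indicator_vector_nonneg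
  by (auto simp: turbulence_polyhedron_def nonneg_flows_of_strength_def route_def)

lemma band_in_recession_cone:
  assumes "band G B" shows "indicator_vector B \<in> turbulence_recession_cone G"
proof -
  have B: "B \<noteq> []" "is_string G B" "linked (last B) (hd B)"
    using assms closed_string_iff[of B] by (auto simp: band_def)
  then show ?thesis
    using string_flow[OF B(2,1)] string_strength[OF B(2,1)] opp_internal[OF B(3)]
    by (simp add: turbulence_recession_cone_def nonneg_flows_of_strength_def
        indicator_vector_nonneg internal_not_fringe)
qed

section \<open>Flows that live on the edges of an elementary trail\<close>

definition supported_flow :: "'e half_edge set \<Rightarrow> real ^ 'e \<Rightarrow> bool" where
  "supported_flow H F \<longleftrightarrow> is_flow G F \<and> (\<forall>x. x \<notin> H \<longrightarrow> F $ fst x = 0)"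

text \<open>Conservation, with each class written as the half-edges opposite to a member of the
  other one. This is the form in which \<open>forced\<close> and the fork lemmas describe what lies
  across a vertex.\<close>

lemma supported_flow_eq:
  assumes "supported_flow H F" "opp a b"
  shows "(\<Sum>x \<in> H \<inter> {x. opp a x}. F $ fst x) = (\<Sum>x \<in> H \<inter> {x. opp b x}. F $ fst x)"
proof -
  have *: "(\<Sum>x \<in> H \<inter> {x. opp a x}. F $ fst x) = (\<Sum>x | same b x. F $ fst x)" if "opp a b" for a b
  proof -
    have "opp a x \<longleftrightarrow> same b x" for x
      using opp_same_trans[OF that] opp_opp_trans[OF opp_sym[OF that]] by blast
    then have "{x. opp a x} = {x. same b x}"
      by blast
    then show ?thesis
      using assms(1) unfolding supported_flow_def by (intro sum.mono_neutral_left) auto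
  qed
  show ?thesis
    using *[OF assms(2)] *[OF opp_sym[OF assms(2)]] flow_eq[OF _ assms(2)] assms(1) by (simp add: supported_flow_def)
qed

lemma supported_flow_linked:
  assumes "supported_flow H F" "linked e f" "f \<in> H" "edge_inverse e \<in> H"
    "\<forall>z\<in>H. linked e z \<longrightarrow> z = f" "\<forall>z\<in>H. opp f z \<longrightarrow> z = edge_inverse e"
  shows "F $ fst e = F $ fst f"
proof -
  have "H \<inter> {x. opp (edge_inverse e) x} = {f}" "H \<inter> {x. opp f x} = {edge_inverse e}"
    using assms(2-) opp_sym by blast+
  then show ?thesis
    using supported_flow_eq[OF assms(1,2)] by simp
qed

text \<open>When the continuation is forced in both directions, each class at a junction contains
  only one half-edge of the support, so conservation equates neighbouring edges.\<close>

lemma supported_flow_const: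
  assumes "supported_flow (halves p) F" "is_string G w" "set w \<subseteq> halves p"
    "forced (halves p) w" "forced (halves p) (string_inverse w)" "x \<in> set w"
  shows "F $ fst x = F $ fst (hd w)"
  using assms(2-)
proof (induction w arbitrary: x rule: induct_list012)
  case (3 a b w)
  have ab: "F $ fst a = F $ fst b"
  proof (rule supported_flow_linked[OF assms(1)])
    show "linked a b" "b \<in> halves p" "edge_inverse a \<in> halves p"
      using 3 by (simp_all add: is_string_Cons)
    show "\<forall>z\<in>halves p. linked a z \<longrightarrow> z = b"
      using 3(5) by (simp add: forced_def)
    show "\<forall>z\<in>halves p. opp b z \<longrightarrow> z = edge_inverse a"
      using 3(6) by (auto simp: forced_def successively_append_iff)
  qed
  have b: "F $ fst y = F $ fst b" if "y \<in> set (b # w)" for y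
  proof -
    have "forced (halves p) (b # w)"
      using 3(5) by (simp add: forced_def)
    moreover have "forced (halves p) (string_inverse (b # w))"
      using 3(6) unfolding string_inverse_Cons[of a] forced_append by blast
    moreover have "is_string G (b # w)"
      using 3(3) by (simp add: is_string_Cons)
    ultimately show ?thesis
      using 3(2)[of y] 3(4) that by simp
  qed
  show ?case
  proof (cases "x = a")
    case False
    then have "x \<in> set (b # w)"
      using 3(7) by simp
    then show ?thesis
      using b[of x] ab by simp
  qed simp
qed simp_all

lemma simple_route_flow_zero:
  assumes "simple_route G p" "supported_flow (halves p) F" "F $ fst (hd p) = 0"
  shows "F = 0"
proof -
  have p: "p \<noteq> []" "inner_simple p" "fringe G (vert G (hd p))" "fringe G (vert G (edge_inverse (last p)))"
    using assms(1) by (simp_all add: simple_route_iff)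
  then have "forced (halves p) p" "forced (halves p) (string_inverse p)"
    using simple_route_forced[of p] simple_route_forced[of "string_inverse p"] by simp_all
  then have "F $ fst x = 0" if "x \<in> set p" for x
    using supported_flow_const[OF assms(2), of p x] that p assms(3) by (simp add: inner_simple_string)
  then have "F $ e = 0" for e
    using assms(2) unfolding supported_flow_def halves_def by (cases "e \<in> fst ` set p") force+
  then show ?thesis
    by (simp add: vec_eq_iff)
qed

lemma simple_band_inverse [simp]: "simple_band G (string_inverse B) \<longleftrightarrow> simple_band G B"
proof -
  have *: "simple_band G (string_inverse B)" if "simple_band G B" for B
  proof -
    have B: "B \<noteq> []" "is_string G B" "linked (last B) (hd B)" "distinct (map (vert G) B)"
      using that by (auto simp: simple_band_iff)
    have "mset (map (\<lambda>x. vert G (edge_inverse x)) B) = mset (map (vert G) B)"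
      using map_head_closed[OF B(2,1) opp_vert[OF B(3)]] B(1) by (cases B) simp_all
    then have "distinct (map (vert G) (string_inverse B))"
      unfolding map_string_inverse distinct_rev using B(4) mset_eq_imp_distinct_iff by blast
    then show ?thesis
      using B opp_sym[OF B(3)] by (simp add: simple_band_iff)
  qed
  show ?thesis
    using *[of B] *[of "string_inverse B"] by auto
qed

lemma simple_band_flow_zero:
  assumes "simple_band G B" "supported_flow (halves B) F" "F $ fst (hd B) = 0"
  shows "F = 0"
proof -
  have "forced (halves B) B" "is_string G B" "forced (halves B) (string_inverse B)"
    using assms(1) simple_band_inverse[of B] simple_band_forced[of B] simple_band_forced[of "string_inverse B"]
    unfolding simple_band_iff[of B] simple_band_iff[of "string_inverse B"] halves_string_inverse by blast+
  then have "F $ fst x = 0" if "x \<in> set B" for x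
    using supported_flow_const[OF assms(2), of B x] that assms(3) by simp
  then have "F $ e = 0" for e
    using assms(2) unfolding supported_flow_def halves_def by (cases "e \<in> fst ` set B") force+
  then show ?thesis
    by (simp add: vec_eq_iff)
qed

text \<open>Zeros pass a fork. One class sums to 0, and in the other one all terms equal the value
  on \<open>e\<close>, which occurs at least once. Several equal terms have to be allowed: for a
  barbell with lazy \<open>s\<close> both ends of \<alpha> lie in that class.\<close>

lemma supported_flow_zero_step:
  assumes "supported_flow H F" "linked e f" "edge_inverse e \<in> H"
    "\<forall>z\<in>H. linked e z \<longrightarrow> F $ fst z = 0" "\<forall>z\<in>H. opp f z \<longrightarrow> F $ fst z = F $ fst e"
  shows "F $ fst e = 0"
proof -
  let ?S = "H \<inter> {x. opp f x}"
  have "(\<Sum>x\<in>?S. F $ fst x) = (\<Sum>x\<in>H \<inter> {x. opp (edge_inverse e) x}. F $ fst x)"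
    using supported_flow_eq[OF assms(1,2)] by simp
  also have "\<dots> = 0"
    using assms(4) by (intro sum.neutral) blast
  also have "(\<Sum>x\<in>?S. F $ fst x) = (\<Sum>x\<in>?S. F $ fst e)"
    using assms(5) by (intro sum.cong) blast+
  finally have "card ?S = 0 \<or> F $ fst e = 0"
    by simp
  moreover have "edge_inverse e \<in> ?S"
    using assms(2,3) opp_sym by blast
  ultimately show ?thesis
    by auto
qed

lemma lollipop_flow_zero:
  assumes d: "lollipop_data s \<beta>" and F: "supported_flow (halves (s @ \<beta>)) F" "F $ fst (hd \<beta>) = 0"
  shows "F = 0"
proof -
  let ?H = "halves (s @ \<beta>)"
  note d' = d[unfolded lollipop_data_def]
  have str: "is_string G (s @ \<beta>)"
    using d' by (simp add: inner_simple_def)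
  have f: "forced ?H (string_inverse \<beta> @ string_inverse s)" "forced ?H (\<beta> @ string_inverse s)" "forced ?H s"
    using lollipop_forced_inverse[OF d] lollipop_forced_inverse[OF lollipop_data_flip[OF d]]
      stem_forced[OF lollipop_stem[OF d]] by simp_all
  have \<beta>: "F $ fst x = 0" if "x \<in> set \<beta>" for x
    using supported_flow_const[OF F(1) _ _ _ _ that] str f F(2) that set_subset_halves[of \<beta>]
    by (simp add: is_string_append forced_append le_supI2)
  have s: "F $ fst x = F $ fst (hd s)" if "x \<in> set s" for x
    using supported_flow_const[OF F(1) _ _ _ _ that] str f that set_subset_halves[of s]
    by (simp add: is_string_append forced_append le_supI1)
  have "F $ fst (last s) = 0"
  proof (rule supported_flow_zero_step[OF F(1)])
    show "linked (last s) (hd \<beta>)"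
      using str d' by (simp add: is_string_append)
    show "edge_inverse (last s) \<in> ?H"
      using d' by (simp add: in_halves_self)
    show "\<forall>z\<in>?H. linked (last s) z \<longrightarrow> F $ fst z = 0"
    proof (intro ballI impI)
      fix z assume "z \<in> ?H" "linked (last s) z"
      then have "z \<in> {hd \<beta>, edge_inverse (last \<beta>)}"
        by (rule stem_fork[OF lollipop_stem[OF d]])
      then show "F $ fst z = 0"
        using \<beta>[of "hd \<beta>"] \<beta>[of "last \<beta>"] d' by auto
    qed
    show "\<forall>z\<in>?H. opp (hd \<beta>) z \<longrightarrow> F $ fst z = F $ fst (last s)"
      using f(1) d' by (auto simp: forced_append simp del: halves_append)
  qed
  then have "F $ fst x = 0" if "x \<in> set (s @ \<beta>)" for x
    using that \<beta> s d' by (metis UnE last_in_set set_append)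
  then have "F $ e = 0" for e
    using F(1) unfolding supported_flow_def halves_def by (cases "e \<in> fst ` set (s @ \<beta>)") force+
  then show ?thesis
    by (simp add: vec_eq_iff)
qed

text \<open>Inversion exchanges the two cycles and flipping reverses one of them, so their
  combinations carry the first statement to the other three.\<close>

lemma barbell_forced:
  assumes "barbell_data \<alpha> s \<beta>"
  shows "forced (halves (\<alpha> @ s @ \<beta>)) (\<alpha> @ s)" "forced (halves (\<alpha> @ s @ \<beta>)) (string_inverse \<alpha> @ s)"
    "forced (halves (\<alpha> @ s @ \<beta>)) (\<beta> @ string_inverse s)"
    "forced (halves (\<alpha> @ s @ \<beta>)) (string_inverse \<beta> @ string_inverse s)"
proof -
  have *: "forced (halves (\<alpha> @ s @ \<beta>)) (\<alpha> @ s)" if "barbell_data \<alpha> s \<beta>" for \<alpha> s \<beta>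
    using stem_forced[OF barbell_stem[OF that]] by (simp add: Un_assoc)
  note [simp] = Un_ac
  show "forced (halves (\<alpha> @ s @ \<beta>)) (\<alpha> @ s)"
    by (rule *[OF assms])
  show "forced (halves (\<alpha> @ s @ \<beta>)) (\<beta> @ string_inverse s)"
    using *[OF barbell_data_inverse[OF barbell_data_flip[OF assms]]] by simp
  show "forced (halves (\<alpha> @ s @ \<beta>)) (string_inverse \<beta> @ string_inverse s)"
    using *[OF barbell_data_inverse[OF assms]] by simp
  show "forced (halves (\<alpha> @ s @ \<beta>)) (string_inverse \<alpha> @ s)"
    using *[OF barbell_data_inverse[OF barbell_data_flip[OF barbell_data_inverse[OF assms]]]] by simp
qed

lemma barbell_fork:
  assumes "barbell_data \<alpha> s \<beta>" "z \<in> halves (\<alpha> @ s @ \<beta>)"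
  shows "linked (last (\<alpha> @ s)) z \<Longrightarrow> z \<in> {hd \<beta>, edge_inverse (last \<beta>)}"
    and "opp (hd (s @ \<beta>)) z \<Longrightarrow> z \<in> {hd \<alpha>, edge_inverse (last \<alpha>)}"
proof -
  have *: "z \<in> {hd \<beta>, edge_inverse (last \<beta>)}"
    if "barbell_data \<alpha> s \<beta>" "z \<in> halves (\<alpha> @ s @ \<beta>)" "linked (last (\<alpha> @ s)) z" for \<alpha> s \<beta>
    using stem_fork[OF barbell_stem[OF that(1)] _ that(3)] that(2) by simp
  show "linked (last (\<alpha> @ s)) z \<Longrightarrow> z \<in> {hd \<beta>, edge_inverse (last \<beta>)}"
    by (rule *[OF assms])
  assume z: "opp (hd (s @ \<beta>)) z"
  have ne: "\<alpha> \<noteq> []" "s @ \<beta> \<noteq> []"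
    using assms(1) by (simp_all add: barbell_data_def)
  have "last (string_inverse \<beta> @ string_inverse s) = edge_inverse (hd (s @ \<beta>))"
    using last_string_inverse[OF ne(2)] by simp
  then have "z \<in> {hd (string_inverse \<alpha>), edge_inverse (last (string_inverse \<alpha>))}"
    using *[OF barbell_data_inverse[OF assms(1)]] assms(2) z by auto
  then show "z \<in> {hd \<alpha>, edge_inverse (last \<alpha>)}"
    using ne(1) by auto
qed

text \<open>The zero spreads round \<beta>, through the fork to \<open>s\<close>, and through the
  other fork to \<alpha>.\<close>

lemma barbell_flow_zero:
  assumes d: "barbell_data \<alpha> s \<beta>" and F: "supported_flow (halves (\<alpha> @ s @ \<beta>)) F" "F $ fst (hd \<beta>) = 0"
  shows "F = 0"
proof -
  let ?H = "halves (\<alpha> @ s @ \<beta>)"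
  note d' = d[unfolded barbell_data_def]
  have ne: "\<alpha> \<noteq> []" "\<beta> \<noteq> []"
    using d' by blast+
  have str: "is_string G (\<alpha> @ s @ \<beta>)"
    using d' by (simp add: inner_simple_def)
  note f = barbell_forced[OF d] barbell_forced[OF barbell_data_inverse[OF d]]
  have parts: "set \<alpha> \<subseteq> ?H" "set s \<subseteq> ?H" "set \<beta> \<subseteq> ?H"
    using set_subset_halves[of "\<alpha> @ s @ \<beta>"] by auto
  have \<beta>: "F $ fst x = 0" if "x \<in> set \<beta>" for x
    using supported_flow_const[OF F(1) _ parts(3) _ _ that] str f(3,4) F(2) ne
    by (simp add: is_string_append forced_append del: halves_append)
  have s: "F $ fst x = F $ fst (hd s)" if "x \<in> set s" for x
    using supported_flow_const[OF F(1) _ parts(2) _ _ that] str f(1,4)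
    by (auto simp add: is_string_append forced_append simp del: halves_append)
  have \<alpha>: "F $ fst x = F $ fst (hd \<alpha>)" if "x \<in> set \<alpha>" for x
    using supported_flow_const[OF F(1) _ parts(1) _ _ that] str f(1,2) ne
    by (simp add: is_string_append forced_append del: halves_append)
  have fork: "F $ fst z = 0" if "z \<in> ?H" "linked (last (\<alpha> @ s)) z" for z
    using barbell_fork(1)[OF d that] \<beta>[of "hd \<beta>"] \<beta>[of "last \<beta>"] ne by auto
  have s0: "F $ fst x = 0" if "x \<in> set s" for x
  proof -
    have sne: "s \<noteq> []"
      using that by auto
    have "F $ fst (last s) = 0"
    proof (rule supported_flow_zero_step[OF F(1)])
      show "linked (last s) (hd \<beta>)"
        using str ne sne by (auto simp: is_string_append)
      show "edge_inverse (last s) \<in> ?H"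
        using sne by (simp add: in_halves_self)
      show "\<forall>z\<in>?H. linked (last s) z \<longrightarrow> F $ fst z = 0"
        using fork sne by simp
      show "\<forall>z\<in>?H. opp (hd \<beta>) z \<longrightarrow> F $ fst z = F $ fst (last s)"
        using f(4) ne sne by (auto simp: forced_append simp del: halves_append)
    qed
    then show ?thesis
      using s[OF that] s[of "last s"] sne by simp
  qed
  have "F $ fst (last \<alpha>) = 0"
  proof (rule supported_flow_zero_step[OF F(1)])
    show "linked (last \<alpha>) (hd (s @ \<beta>))"
      using str ne by (auto simp: is_string_append)
    show "edge_inverse (last \<alpha>) \<in> ?H"
      using ne by (simp add: in_halves_self)
    show "\<forall>z\<in>?H. linked (last \<alpha>) z \<longrightarrow> F $ fst z = 0"
    \<comment> \<open>For a lazy \<open>s\<close> the two forks are the same vertex, and \<alpha> is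
      followed directly by one of the ends of \<beta>.\<close>
    proof (cases "s = []")
      case True
      then show ?thesis
        using fork by simp
    next
      case False
      then show ?thesis
        using f(1) ne s0[of "hd s"] by (auto simp: forced_append simp del: halves_append)
    qed
    show "\<forall>z\<in>?H. opp (hd (s @ \<beta>)) z \<longrightarrow> F $ fst z = F $ fst (last \<alpha>)"
      using barbell_fork(2)[OF d] \<alpha>[of "last \<alpha>"] ne by fastforce
  qed
  then have "F $ fst (hd \<alpha>) = 0"
    using \<alpha>[of "last \<alpha>"] ne by simp
  then have "F $ fst x = 0" if "x \<in> set (\<alpha> @ s @ \<beta>)" for x
    using that \<beta>[of x] s0[of x] \<alpha>[of x] by auto
  then have "F $ e = 0" for e
    using F(1) unfolding supported_flow_def halves_def by (cases "e \<in> fst ` set (\<alpha> @ s @ \<beta>)") force+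
  then show ?thesis
    by (simp add: vec_eq_iff)
qed

end

section \<open>Compatibility\<close>

lemma string_power_0 [simp]: "string_power B 0 = []"
  by (simp add: string_power_def)

lemma string_power_Suc [simp]: "string_power B (Suc n) = B @ string_power B n"
  by (simp add: string_power_def)

lemma set_string_power: "set (string_power B n) \<subseteq> set B"
  by (induction n) auto

lemma string_power_swap: "string_power (u @ v) n @ u = u @ string_power (v @ u) n"
  by (induction n) auto

lemma rotate_split: obtains u v where "B = u @ v" "rotate k B = v @ u"
  by (metis append_take_drop_id rotate_drop_take)

lemma string_inverse_rotate: "\<exists>k'. string_inverse (rotate k B) = rotate k' (string_inverse B)"
proof (rule rotate_split[of B k])
  fix u v assume "B = u @ v" "rotate k B = v @ u"
  then have "string_inverse (rotate k B) = rotate (length (string_inverse v)) (string_inverse B)"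
    by (simp add: rotate_append del: length_string_inverse)
  then show ?thesis
    by blast
qed

text \<open>One extra period makes up for the shift: the power \<open>n + 1\<close> of
  \<open>v @ u\<close> is \<open>v\<close>, then the power \<open>n\<close> of \<open>u @ v\<close>,
  then \<open>u\<close>.\<close>

lemma sublist_power_rotate:
  assumes "sublist w (string_power B n)"
  shows "sublist w (string_power (rotate k B) (Suc n))"
proof (rule rotate_split[of B k])
  fix u v assume B: "B = u @ v" "rotate k B = v @ u"
  have "string_power (v @ u) (Suc n) = v @ string_power (u @ v) n @ u"
    by (simp add: string_power_swap)
  then have "sublist (string_power B n) (string_power (rotate k B) (Suc n))"
    unfolding B(2) unfolding B(1) sublist_def by metis
  then show ?thesis
    using assms sublist_order.order.trans by blast
qed

text \<open>\<open>x\<close> occurs once in each period, so an occurrence of \<open>w\<close>, which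
  starts with \<open>x\<close>, begins at the start of a period.\<close>

lemma sublist_power_prefix:
  assumes "sublist w (string_power (x # r) n)" "x \<notin> set r" "w \<noteq> []" "hd w = x"
  shows "\<exists>m>0. prefix w (string_power (x # r) m)"
proof -
  obtain a b where "string_power (x # r) n = a @ w @ b"
    using assms(1) unfolding sublist_def by blast
  then show ?thesis
  proof (induction n arbitrary: a)
    case (Suc n)
    show ?case
    proof (cases a)
      case Nil
      then have "prefix w (string_power (x # r) (Suc n))"
        using Suc.prems by (simp add: prefix_def)
      then show ?thesis
        by blast
    next
      case (Cons y c)
      then have eq: "r @ string_power (x # r) n = c @ w @ b"
        using Suc.prems by auto
      have "\<not> length c < length r"
      proof
        assume l: "length c < length r"
        have "(r @ string_power (x # r) n) ! length c = x"
          unfolding eq using assms(3,4) by (simp add: nth_append hd_conv_nth)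
        then have "r ! length c = x"
          using l by (simp add: nth_append)
        then show False
          using assms(2) l by (metis nth_mem)
      qed
      then have "prefix r c"
        using eq by (metis leI prefixI prefix_length_prefix)
      then obtain d where "c = r @ d"
        by (auto simp: prefix_def)
      then show ?thesis
        using Suc.IH eq by simp
    qed
  qed (use assms(3) in simp)
qed

text \<open>Two words that part after \<open>t\<close> are each comparable with one of two words
  that part after \<open>s\<close>. Parting earlier or later would make the diverging letters agree.
  Applied to an incompatibility, this shows that its common part is the whole connecting string of a
  barbell.\<close>

lemma prefix_fork:
  assumes "prefix (t @ [a]) (s @ [c]) \<or> prefix (s @ [c]) (t @ [a])"
    "prefix (t @ [b]) (s @ [d]) \<or> prefix (s @ [d]) (t @ [b])" "a \<noteq> b" "c \<noteq> d"
  shows "t = s \<and> a = c \<and> b = d"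
  using assms
proof (induction s arbitrary: t)
  case Nil
  then show ?case
    by (cases t) auto
next
  case (Cons x s)
  show ?case
  proof (cases t)
    case Nil
    then have "a = x" "b = x"
      using Cons.prems(1,2) by auto
    then show ?thesis
      using Cons.prems(3) by simp
  next
    case t: (Cons y u)
    have "prefix (u @ [a]) (s @ [c]) \<or> prefix (s @ [c]) (u @ [a])"
      "prefix (u @ [b]) (s @ [d]) \<or> prefix (s @ [d]) (u @ [b])" "y = x"
      using Cons.prems(1,2) unfolding t append_Cons Cons_prefix_Cons by blast+
    then show ?thesis
      using Cons.IH[of u] Cons.prems(3,4) t by blast
  qed
qed

text \<open>The two alternatives for a band and its inverse are merged, so that the notion is
  invariant under \<open>band_equiv\<close>.\<close>

definition band_substring :: "'e oriented_edge list \<Rightarrow> 'e oriented_edge list \<Rightarrow> bool" where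
  "band_substring B w \<longleftrightarrow>
     (\<exists>n. sublist w (string_power B n)) \<or> (\<exists>n. sublist w (string_power (string_inverse B) n))"

lemma band_substring_inverse [simp]: "band_substring (string_inverse B) w \<longleftrightarrow> band_substring B w"
  by (auto simp: band_substring_def)

lemma band_substring_rotate [simp]: "band_substring (rotate k B) w \<longleftrightarrow> band_substring B w"
proof -
  have *: "band_substring (rotate k B) w" if "band_substring B w" for k and B :: "'a oriented_edge list"
  proof -
    obtain k' where "string_inverse (rotate k B) = rotate k' (string_inverse B)"
      using string_inverse_rotate by blast
    then show ?thesis
      using that sublist_power_rotate unfolding band_substring_def by metis
  qed
  obtain u v where B: "B = u @ v" "rotate k B = v @ u"
    by (rule rotate_split)
  then have "rotate (length v) (rotate k B) = B"
    by (simp add: rotate_append)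
  then show ?thesis
    using *[of B k] *[of "rotate k B" "length v"] by auto
qed

lemma equiv_band_equiv: "equiv UNIV (band_equiv :: ('a oriented_edge list \<times> 'a oriented_edge list) set)"
proof (rule equivI)
  show "(band_equiv :: ('a oriented_edge list \<times> 'a oriented_edge list) set) \<subseteq> UNIV \<times> UNIV"
    by simp
  show "refl (band_equiv :: ('a oriented_edge list \<times> 'a oriented_edge list) set)"
    by (auto simp: refl_on_def band_equiv_def intro: exI[of _ 0])
  show "sym (band_equiv :: ('a oriented_edge list \<times> 'a oriented_edge list) set)"
  proof (rule symI)
    fix B C :: "'a oriented_edge list" assume "(B, C) \<in> band_equiv"
    then obtain n where n: "C = rotate n B \<or> C = rotate n (string_inverse B)"
      by (auto simp: band_equiv_def)
    have undo: "\<exists>m. rotate m (rotate n D) = D" for D :: "'a oriented_edge list"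
      by (rule rotate_split[of D n]) (metis rotate_append)
    show "(C, B) \<in> band_equiv"
    proof (cases "C = rotate n B")
      case True
      then show ?thesis
        using undo[of B] by (auto simp: band_equiv_def) metis
    next
      case False
      then have "string_inverse C = string_inverse (rotate n (string_inverse B))"
        using n by simp
      then obtain k where "string_inverse C = rotate k B"
        using string_inverse_rotate[of n "string_inverse B"] by auto
      moreover obtain m where "rotate m (rotate k B) = B"
        by (rule rotate_split[of B k]) (metis rotate_append)
      ultimately have "B = rotate m (string_inverse C)"
        by simp
      then show ?thesis
        by (auto simp: band_equiv_def)
    qed
  qed
  show "trans (band_equiv :: ('a oriented_edge list \<times> 'a oriented_edge list) set)"
  proof (rule transI)
    fix B C D :: "'a oriented_edge list" assume "(B, C) \<in> band_equiv" "(C, D) \<in> band_equiv"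
    then obtain m n where "C = rotate m B \<or> C = rotate m (string_inverse B)"
      and "D = rotate n C \<or> D = rotate n (string_inverse C)"
      by (auto simp: band_equiv_def)
    moreover obtain k where "string_inverse (rotate m B) = rotate k (string_inverse B)"
      using string_inverse_rotate by blast
    moreover obtain l where "string_inverse (rotate m (string_inverse B)) = rotate l B"
      using string_inverse_rotate[of m "string_inverse B"] by auto
    ultimately show "(B, D) \<in> band_equiv"
      by (auto simp: band_equiv_def rotate_rotate)
  qed
qed

lemma band_equiv_substring: "(B, C) \<in> band_equiv \<Longrightarrow> band_substring C w \<longleftrightarrow> band_substring B w"
  by (auto simp: band_equiv_def)

lemma band_equiv_indicator: "(B, C) \<in> band_equiv \<Longrightarrow> indicator_vector C = indicator_vector B"
  by (auto simp: band_equiv_def)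

lemma band_substring_prefix:
  assumes "band_substring B w" "rotate k B = x # r" "count_list (map fst B) (fst x) = 1" "w \<noteq> []" "hd w = x"
  shows "\<exists>m>0. prefix w (string_power (x # r) m)"
proof -
  have "count_list (map fst (rotate k B)) (fst x) = 1"
    using assms(3) by (simp flip: rotate_map)
  then have r: "fst x \<notin> fst ` set r"
    unfolding assms(2) by (simp add: count_list_0_iff)
  have "band_substring (rotate k B) w"
    using assms(1) by simp
  then consider n where "sublist w (string_power (x # r) n)" | n where "sublist w (string_power (string_inverse (x # r)) n)"
    unfolding assms(2) band_substring_def by blast
  then show ?thesis
  proof cases
    case 1
    then show ?thesis
      using sublist_power_prefix[OF 1] assms(4,5) r by blast
  next
    case 2
    then have "x \<in> set (string_inverse (x # r))"
      using set_mono_sublist[OF 2] set_string_power assms(4,5) hd_in_set by blast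
    then obtain y where "y \<in> set r" "x = edge_inverse y"
      by auto
    then show ?thesis
      using r by auto
  qed
qed

section \<open>Framings and self-compatibility of simple trails and lollipops\<close>

locale framed_turbulence = turbulence G for G :: "('v, 'e::finite) chart" +
  fixes R :: "('v, 'e) framing"
  assumes framing: "is_framing G R"
begin

abbreviation less :: "'e half_edge \<Rightarrow> 'e half_edge \<Rightarrow> bool" where
  "less \<equiv> framing_less G R"

lemma less_same: "less x y \<Longrightarrow> same x y"
  by (simp add: framing_less_def)

lemma framing_order:
  "same x y \<Longrightarrow> linear_order_on {z. same x z} (R (vert G x) {z. same x z})"
  using framing class_in_quotient[of x] same_internal(1)[of x y] unfolding is_framing_def by blast

lemma framing_less_iff: "less x y \<longleftrightarrow> same x y \<and> x \<noteq> y \<and> (x, y) \<in> R (vert G x) {z. same x z}"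
  unfolding framing_less_def using class_eq[OF same_internal(1)] by metis

lemma same_Collect: "same x y \<Longrightarrow> {z. same x z} = {z. same y z}"
  using same_trans same_sym by blast

lemma less_asym: "less x y \<Longrightarrow> \<not> less y x"
proof
  assume xy: "less x y" and yx: "less y x"
  from xy have s: "same x y"
    by (rule less_same)
  have "(x, y) \<in> R (vert G x) {z. same x z}" "(y, x) \<in> R (vert G x) {z. same x z}"
    using xy yx same_Collect[OF s] same_vert[OF s] unfolding framing_less_iff by simp_all
  moreover have "antisym (R (vert G x) {z. same x z})"
    using framing_order[OF s] unfolding linear_order_on_def partial_order_on_def by blast
  ultimately show False
    using xy by (auto simp: framing_less_iff dest: antisymD)
qed

lemma less_total: assumes s: "same x y" and "x \<noteq> y" shows "less x y \<or> less y x"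
proof -
  have "total_on {z. same x z} (R (vert G x) {z. same x z})"
    using framing_order[OF s] unfolding linear_order_on_def by blast
  moreover have "x \<in> {z. same x z}" "y \<in> {z. same x z}"
    using s same_refl[OF same_internal(1)[OF s]] by simp_all
  ultimately have "(x, y) \<in> R (vert G x) {z. same x z} \<or> (y, x) \<in> R (vert G x) {z. same x z}"
    using assms(2) unfolding total_on_def by blast
  then show ?thesis
    using same_Collect[OF s] same_vert[OF s] s same_sym[OF s] assms(2) unfolding framing_less_iff by auto
qed

lemma substring_of_trail_set: "substring_of_trail G w p \<Longrightarrow> set w \<subseteq> set p"
  unfolding substring_of_trail_def using set_mono_sublist set_string_power by blast

text \<open>Only the edges of the two substrings are remembered, not the order in which the trail
  runs through them. This is too coarse for barbells, whose support also contains the strings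
  obtained by reversing one of the cycles.\<close>

lemma self_compatible_if:
  assumes "\<And>e1 e2 s f1 f2. is_string G ([e1] @ s @ [f1]) \<Longrightarrow> is_string G ([e2] @ s @ [f2]) \<Longrightarrow>
      set ([e1] @ s @ [f1]) \<subseteq> halves p \<Longrightarrow> set ([e2] @ s @ [f2]) \<subseteq> halves p \<Longrightarrow>
      less (edge_inverse e1) (edge_inverse e2) \<Longrightarrow> less f1 f2 \<Longrightarrow> False"
  shows "self_compatible G R p"
  unfolding self_compatible_def
proof
  assume "incompatible G R p p"
  then obtain v w where vw: "incompatibility G R v w"
    and "substring_of_trail G v p \<or> substring_of_trail G v (string_inverse p)"
    and "substring_of_trail G w p \<or> substring_of_trail G w (string_inverse p)"
    unfolding incompatible_def by blast
  then have "set v \<subseteq> halves p" "set w \<subseteq> halves p"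
    using substring_of_trail_set[of v p] substring_of_trail_set[of v "string_inverse p"]
      substring_of_trail_set[of w p] substring_of_trail_set[of w "string_inverse p"]
    unfolding set_string_inverse halves_eq by blast+
  moreover obtain e1 e2 s f1 f2 where "v = [e1] @ s @ [f1]" "w = [e2] @ s @ [f2]"
    "is_string G v" "is_string G w" "less (edge_inverse e1) (edge_inverse e2)" "less f1 f2"
    using vw unfolding incompatibility_def head_half_eq tail_half_eq by blast
  ultimately show False
    using assms by blast
qed

text \<open>A string passes an inner vertex from one class to the other and only once. Hence a
  second half-edge in the same class can come only from a free end.\<close>

lemma inner_simple_same:
  assumes p: "inner_simple p" "x \<in> halves p" "y \<in> halves p" "same x y" "x \<noteq> y"
  shows "x \<in> {hd p, edge_inverse (last p)} \<or> y \<in> {hd p, edge_inverse (last p)}"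
proof (rule ccontr)
  assume n: "\<not> ?thesis"
  obtain A e f B where split: "p = A @ [e, f] @ B" "x = f \<or> x = edge_inverse e"
  proof (cases "x \<in> set p")
    case True
    then obtain A B where p: "p = A @ x # B"
      by (meson split_list)
    then have "A \<noteq> []"
      using n by auto
    then have "p = butlast A @ [last A, x] @ B"
      using p by simp
    then show ?thesis
      using that by blast
  next
    case False
    then have "edge_inverse x \<in> set p"
      using p(2) by (auto simp: halves_eq)
    then obtain A B where p: "p = A @ edge_inverse x # B"
      by (meson split_list)
    then have "B \<noteq> []"
      using n by auto
    then have "p = A @ [edge_inverse x, hd B] @ tl B"
      using p by simp
    then show ?thesis
      using that by (metis edge_inverse_inverse)
  qed
  have "linked e f"
    using p(1) split(1) by (simp add: inner_simple_def is_string_append is_string_Cons)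
  then have "vert G x = vert G f"
    using split(2) opp_vert[of "edge_inverse e" f] by auto
  then have "vert G y = vert G f"
    using same_vert[OF p(4)] by simp
  then have "y = f \<or> y = edge_inverse e"
    using inner_simple_at[OF p(1) split(1) p(3)] n by blast
  then have "opp x y \<or> opp y x"
    using split(2) p(5) \<open>linked e f\<close> by blast
  then show False
    using p(4) opp_sym not_opp_and_same by blast
qed

text \<open>An incompatibility needs two different half-edges of the support in one class. The free
  ends of a simple route are at fringe vertices, so there is no such pair.\<close>

lemma simple_route_compatible:
  assumes "simple_route G p" shows "self_compatible G R p"
proof (rule self_compatible_if)
  fix e1 e2 s f1 f2
  assume "set ([e1] @ s @ [f1]) \<subseteq> halves p" "set ([e2] @ s @ [f2]) \<subseteq> halves p" "less f1 f2"
  then have "f1 \<in> halves p" "f2 \<in> halves p" "same f1 f2" "f1 \<noteq> f2"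
    by (auto simp: framing_less_def)
  then show False
    using assms inner_simple_same[of p f1 f2] same_internal[of f1 f2] internal_not_fringe
    unfolding simple_route_iff by blast
qed

lemma simple_band_at_start:
  assumes "simple_band G B" "y \<in> halves B" "vert G y = vert G (hd B)"
  shows "y = hd B \<or> y = edge_inverse (last B)"
proof -
  have *: "y = hd C" if "simple_band G C" "y \<in> set C" "vert G y = vert G (hd C)" for C
  proof -
    have "distinct (map (vert G) C)" "C \<noteq> []"
      using that(1) by (simp_all add: simple_band_iff)
    then show ?thesis
      using that(2,3) by (meson distinct_map hd_in_set inj_onD)
  qed
  have B: "B \<noteq> []" "vert G (edge_inverse (last B)) = vert G (hd B)"
    using assms(1) opp_vert unfolding simple_band_iff by blast+
  then show ?thesis
    using *[of B] *[of "string_inverse B"] assms by (auto simp: halves_eq)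
qed

text \<open>The only free ends meet at the closing junction, and there they are in opposite
  classes.\<close>

lemma simple_band_compatible:
  assumes "simple_band G B" shows "self_compatible G R B"
proof (rule self_compatible_if)
  fix e1 e2 s f1 f2
  assume "set ([e1] @ s @ [f1]) \<subseteq> halves B" "set ([e2] @ s @ [f2]) \<subseteq> halves B" "less f1 f2"
  then have f: "f1 \<in> halves B" "f2 \<in> halves B" "same f1 f2" "f1 \<noteq> f2"
    by (auto simp: framing_less_def)
  have B: "B \<noteq> []" "inner_simple B" "linked (last B) (hd B)"
    using assms by (cases B; auto simp: simple_band_iff inner_simple_def)+
  then have "f1 \<in> {hd B, edge_inverse (last B)} \<or> f2 \<in> {hd B, edge_inverse (last B)}"
    using inner_simple_same f by blast
  then have "vert G f1 = vert G (hd B)" "vert G f2 = vert G (hd B)"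
    using same_vert[OF f(3)] opp_vert[OF B(3)] by auto
  then have "f1 \<in> {hd B, edge_inverse (last B)}" "f2 \<in> {hd B, edge_inverse (last B)}"
    using simple_band_at_start[OF assms] f by blast+
  then have "opp f1 f2 \<or> opp f2 f1"
    using f(4) B(3) by blast
  then show False
    using f(3) opp_sym not_opp_and_same by blast
qed

lemma lollipop_same:
  assumes d: "lollipop_data s \<beta>" and xy: "x \<in> halves (s @ \<beta>)" "y \<in> halves (s @ \<beta>)" "same x y" "x \<noteq> y"
  shows "x \<in> {hd \<beta>, edge_inverse (last \<beta>)} \<and> y \<in> {hd \<beta>, edge_inverse (last \<beta>)}"
proof -
  note d' = d[unfolded lollipop_data_def]
  let ?z = "edge_inverse (last \<beta>)"
  have l: "linked (last s) (hd \<beta>)"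
    using d' by (auto simp: inner_simple_def is_string_append)
  have *: "y \<in> {hd \<beta>, ?z}" if "same ?z y" "y \<in> halves (s @ \<beta>)" for y
  proof -
    have "same (hd \<beta>) y"
      using d' same_trans that(1) by blast
    then show ?thesis
      using stem_fork[OF lollipop_stem[OF d] that(2)] opp_same_trans[OF l] by blast
  qed
  have "x \<in> {hd s, ?z} \<or> y \<in> {hd s, ?z}"
    using inner_simple_same[OF _ xy] d' by simp
  moreover have "x \<noteq> hd s" "y \<noteq> hd s"
    using d' same_internal[OF xy(3)] internal_not_fringe by blast+
  ultimately show ?thesis
    using *[of x] *[of y] xy same_sym by blast
qed

text \<open>The only two half-edges in a common class are the ends of the cycle. The common part of
  an incompatibility would therefore start and end at the fork, but a string that leaves the cycle
  there is forced along \<open>s\<close> to the fringe vertex and never returns.\<close>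

lemma lollipop_compatible:
  assumes d: "lollipop_data s \<beta>" shows "self_compatible G R (s @ \<beta> @ string_inverse s)"
proof (rule self_compatible_if)
  let ?H = "halves (s @ \<beta>)"
  have H: "halves (s @ \<beta> @ string_inverse s) = ?H"
    by auto
  note d' = d[unfolded lollipop_data_def]
  fix e1 e2 t f1 f2
  assume str: "is_string G ([e1] @ t @ [f1])"
    and "set ([e1] @ t @ [f1]) \<subseteq> halves (s @ \<beta> @ string_inverse s)"
    and "set ([e2] @ t @ [f2]) \<subseteq> halves (s @ \<beta> @ string_inverse s)"
    and less: "less (edge_inverse e1) (edge_inverse e2)" "less f1 f2"
  then have sub: "set ([e1] @ t @ [f1]) \<subseteq> ?H" "set ([e2] @ t @ [f2]) \<subseteq> ?H"
    unfolding H by blast+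
  have "edge_inverse e1 \<in> {hd \<beta>, edge_inverse (last \<beta>)}"
    using lollipop_same[OF d, of "edge_inverse e1" "edge_inverse e2"] sub less(1) by (auto simp: framing_less_def)
  then have e1: "e1 = edge_inverse (hd \<beta>) \<or> e1 = last \<beta>"
    by (metis edge_inverse_inverse empty_iff insert_iff)
  have f1: "f1 \<in> {hd \<beta>, edge_inverse (last \<beta>)}"
    using lollipop_same[OF d, of f1 f2] sub less(2) by (auto simp: framing_less_def)
  have "forced ?H (e1 # string_inverse s)"
  proof -
    have "forced ?H (string_inverse \<beta> @ string_inverse s)" "forced ?H (\<beta> @ string_inverse s)"
      using lollipop_forced_inverse[OF d] lollipop_forced_inverse[OF lollipop_data_flip[OF d]] by simp_all
    then have "forced ?H ([last \<beta>] @ string_inverse s)" "forced ?H ([edge_inverse (hd \<beta>)] @ string_inverse s)"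
      unfolding forced_append using d' by (auto simp: forced_def)
    then show ?thesis
      using e1 by auto
  qed
  then consider "prefix ([e1] @ t @ [f1]) (e1 # string_inverse s)" | "prefix (e1 # string_inverse s) ([e1] @ t @ [f1])"
    using forced_follow[of ?H "e1 # string_inverse s" "[e1] @ t @ [f1]"] str sub(1) by auto
  then have "prefix (t @ [f1]) (string_inverse s)"
  proof cases
    case 2
    then obtain r where r: "t @ [f1] = string_inverse s @ r"
      by (auto simp: prefix_def)
    have "r = []"
    proof (rule ccontr)
      assume "r \<noteq> []"
      moreover have "is_string G (string_inverse s @ r)"
        using str is_string_append[of "[e1]" "t @ [f1]"] unfolding r by blast
      ultimately have "opp (hd s) (hd r)"
        using d' by (simp add: is_string_append)
      then show False
        using opp_internal(1) internal_not_fringe d' by blast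
    qed
    then show ?thesis
      using r by simp
  qed simp
  then have "f1 \<in> set (string_inverse s)"
    using set_mono_prefix by fastforce
  then have "edge_inverse f1 \<in> set s"
    by auto
  moreover have "edge_inverse f1 \<notin> set (s @ \<beta>)" if "f1 = hd \<beta>"
    using inner_simple_no_inverse[of "s @ \<beta>" f1] d' that by simp
  \<comment> \<open>In this case \<open>f1\<close> belongs to the reversed cycle, so the argument is
    applied to the flipped lollipop.\<close>
  moreover have "edge_inverse f1 \<notin> set (s @ string_inverse \<beta>)" if "f1 = edge_inverse (last \<beta>)"
    using inner_simple_no_inverse[of "s @ string_inverse \<beta>" f1] lollipop_data_flip[OF d] d' that
    unfolding lollipop_data_def by simp
  ultimately show False
    using f1 by auto
qed

end

section \<open>Uniqueness of trails\<close>

lemma halves_rotate: "halves (rotate n p) = halves p"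
  by (simp add: halves_def)

lemma band_equiv_rotate: "(B, rotate n B) \<in> band_equiv" "(B, rotate n (string_inverse B)) \<in> band_equiv"
  by (auto simp: band_equiv_def)

lemma band_equiv_refl: "(B, B) \<in> band_equiv"
  using band_equiv_rotate(1)[of B 0] by simp

lemma band_equiv_swap: "(u @ v, v @ u) \<in> band_equiv"
  using band_equiv_rotate(1)[of "u @ v" "length u"] by (simp add: rotate_append)

lemma band_equiv_sym: "(B, C) \<in> band_equiv \<Longrightarrow> (C, B) \<in> band_equiv"
  using equiv_band_equiv unfolding equiv_def by (metis symD)

lemma band_equiv_trans: "(B, C) \<in> band_equiv \<Longrightarrow> (C, D) \<in> band_equiv \<Longrightarrow> (B, D) \<in> band_equiv"
  using equiv_band_equiv unfolding equiv_def by (metis transD)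

lemma band_equiv_count:
  fixes B C :: "'e::finite oriented_edge list"
  shows "(B, C) \<in> band_equiv \<Longrightarrow> count_list (map fst C) e = count_list (map fst B) e"
  using band_equiv_indicator[of B C] by (metis indicator_vector_nth of_nat_eq_iff)

lemma length_eq_if_indicator_vector_eq:
  assumes "indicator_vector p = indicator_vector q" shows "length p = length q"
proof -
  have "count_list (map fst p) = count_list (map fst q)"
    using assms by (metis (no_types) ext indicator_vector_nth of_nat_eq_iff)
  then have "sum (count_list (map fst p)) UNIV = sum (count_list (map fst q)) UNIV"
    by simp
  then show ?thesis
    using sum_count_set[of "map fst p" UNIV] sum_count_set[of "map fst q" UNIV] by simp
qed

lemma halves_eq_if_indicator_vector_eq:
  assumes "indicator_vector p = indicator_vector q" shows "halves p = halves q"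
proof -
  have "fst ` set p = fst ` set q"
    using assms indicator_vector_eq_0_iff by (metis (no_types) set_eqI)
  then show ?thesis
    by (simp add: halves_def)
qed

lemma band_equiv_start:
  assumes "x \<in> halves q"
  obtains n q' where "(q, q') \<in> band_equiv" "hd q' = x" "q' \<noteq> []"
    "q' = rotate n q \<or> q' = rotate n (string_inverse q)"
proof -
  have *: "\<exists>n. hd (rotate n p) = x \<and> rotate n p \<noteq> []" if x: "x \<in> set p" for p
  proof -
    obtain u v where "p = u @ x # v"
      using split_list[OF x] by blast
    then have "rotate (length u) p = (x # v) @ u"
      by (simp only: rotate_append)
    then show ?thesis
      by (metis append_Cons list.distinct(1) list.sel(1))
  qed
  have "x \<in> set q \<or> x \<in> set (string_inverse q)"
    using assms by (simp add: halves_eq)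
  then show ?thesis
    using * that band_equiv_rotate by metis
qed

context turbulence
begin

lemma band_equiv_closed:
  assumes "(B, C) \<in> band_equiv" "is_string G (B @ B)" shows "is_string G (C @ C)"
  using assms closed_string_rotate closed_string_inverse by (auto simp: band_equiv_def)

lemma band_equiv_band:
  assumes "(B, C) \<in> band_equiv" "is_string G (B @ B)" "count_list (map fst B) e = 1"
  shows "band G C"
  using band_if_count[OF band_equiv_closed[OF assms(1,2)]] band_equiv_count[OF assms(1)] assms(3) by metis

text \<open>No string continues beyond a fringe vertex.\<close>

lemma route_prefix_eq:
  assumes "route G p" "route G q" "prefix p q" shows "p = q"
proof -
  obtain r where r: "q = p @ r"
    using assms(3) by (auto simp: prefix_def)
  have "r = []"
  proof (rule ccontr)
    assume "r \<noteq> []"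
    then have "linked (last p) (hd r)"
      using assms(1,2) r by (simp add: route_def is_string_append)
    then show False
      using opp_internal(1) internal_not_fringe assms(1) unfolding route_def head_eq by blast
  qed
  then show ?thesis
    using r by simp
qed

lemma fringe_half:
  assumes "is_string G p" "x \<in> halves p" "fringe G (vert G x)"
  shows "x = hd p \<or> x = edge_inverse (last p)"
proof -
  have *: "x = hd q" if "is_string G q" "x \<in> set q" for q
    using that assms(3) inner_simple_internal[of q x] internal_not_fringe by (cases q) auto
  have "p \<noteq> []"
    using assms(2) by auto
  then show ?thesis
    using *[OF assms(1)] *[of "string_inverse p"] assms(1,2) by (auto simp: halves_eq)
qed

lemma simple_route_unique:
  assumes "simple_route G p" "route G q" "set q \<subseteq> halves p"
  shows "q = p \<or> q = string_inverse p"
proof -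
  have p: "p \<noteq> []" "inner_simple p" "fringe G (vert G (hd p))" "fringe G (vert G (edge_inverse (last p)))"
    using assms(1) by (simp_all add: simple_route_iff)
  have q: "q \<noteq> []" "is_string G q" "fringe G (vert G (hd q))"
    using assms(2) by (simp_all add: route_def)
  have *: "q = w" if "forced (halves p) w" "route G w" "hd q = hd w" for w
    using forced_follow[OF that(1) q(2) assms(3) _ q(1) that(3)] that(2) assms(2)
      route_prefix_eq[of q w] route_prefix_eq[of w q] by (auto simp: route_def)
  have routes: "route G p" "route G (string_inverse p)"
    using p by (simp_all add: route_def inner_simple_string)
  have "forced (halves p) p" "forced (halves p) (string_inverse p)"
    using simple_route_forced[of p] simple_route_forced[of "string_inverse p"] p by simp_all
  moreover have "hd q \<in> halves p"
    using assms(3) hd_in_set[OF q(1)] by blast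
  then have "hd q = hd p \<or> hd q = hd (string_inverse p)"
    using fringe_half[OF inner_simple_string[OF p(2)]] p(1) q(3) by auto
  ultimately show ?thesis
    using * routes by blast
qed

text \<open>\<open>q\<close> must start at the only fringe half-edge and run along \<open>s\<close>.
  The one choice left is the direction round the cycle, and the two choices are inverse to each
  other as routes.\<close>

lemma lollipop_unique:
  assumes d: "lollipop_data s \<beta>" and q: "route G q" "set q \<subseteq> halves (s @ \<beta>)"
  shows "q = s @ \<beta> @ string_inverse s \<or> q = string_inverse (s @ \<beta> @ string_inverse s)"
proof -
  let ?H = "halves (s @ \<beta>)"
  note d' = d[unfolded lollipop_data_def]
  have q': "q \<noteq> []" "is_string G q" "fringe G (vert G (hd q))"
    using q(1) by (simp_all add: route_def)
  have str: "is_string G (s @ \<beta>)"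
    using d' by (simp add: inner_simple_string)
  have routes: "route G (s @ \<beta> @ string_inverse s)" "route G (s @ string_inverse \<beta> @ string_inverse s)"
    using lollipop_iff d lollipop_data_flip[OF d] unfolding lollipop_def by metis+
  have "hd q \<noteq> edge_inverse (last \<beta>)"
    using d' same_internal(2) internal_not_fringe q'(3) by metis
  moreover have "hd q \<in> ?H"
    using q(2) hd_in_set[OF q'(1)] by blast
  ultimately have "hd q = hd s"
    using fringe_half[OF str _ q'(3)] d' by auto
  then have "prefix q s \<or> prefix s q"
    using forced_follow[OF stem_forced[OF lollipop_stem[OF d]] q'(2) q(2)] q' d' by blast
  moreover have "\<not> prefix q s"
  proof
    assume "prefix q s"
    then obtain r where "s = q @ r"
      by (auto simp: prefix_def)
    then have "is_string G (q @ r @ \<beta>)"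
      using str by simp
    then have "linked (last q) (hd (r @ \<beta>))"
      using q'(1) d' unfolding is_string_append[of q] by blast
    then show False
      using opp_internal(1) internal_not_fringe q(1) unfolding route_def head_eq by blast
  qed
  ultimately obtain r where r: "q = s @ r" "r \<noteq> []"
    by (auto simp: prefix_def)
  then have r': "is_string G r" "set r \<subseteq> ?H" "linked (last s) (hd r)"
    using q'(2) q(2) d' by (auto simp: is_string_append)
  have *: "q = s @ w" if "forced ?H w" "w \<noteq> []" "route G (s @ w)" "hd r = hd w" for w
  proof -
    have "prefix q (s @ w) \<or> prefix (s @ w) q"
      using forced_follow[OF that(1) r'(1,2) that(2) r(2) that(4)] r(1) by simp
    then show ?thesis
      using route_prefix_eq q(1) that(3) by metis
  qed
  have "hd r \<in> {hd \<beta>, edge_inverse (last \<beta>)}"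
    using stem_fork[OF lollipop_stem[OF d] _ r'(3)] r'(2) r(2) hd_in_set by blast
  moreover have "forced ?H (\<beta> @ string_inverse s)" "forced ?H (string_inverse \<beta> @ string_inverse s)"
    using lollipop_forced_inverse[OF d] lollipop_forced_inverse[OF lollipop_data_flip[OF d]] by simp_all
  ultimately show ?thesis
    using *[of "\<beta> @ string_inverse s"] *[of "string_inverse \<beta> @ string_inverse s"] routes d' by auto
qed

end

context framed_turbulence
begin

lemma elementary_route_unique:
  assumes "elementary_route G R p" "elementary_route G R q" "indicator_vector p = indicator_vector q"
  shows "(p, q) \<in> route_equiv"
proof -
  have q: "route G q"
    using assms(2) by (auto simp: elementary_route_def simple_route_def lollipop_def)
  have sub: "set q \<subseteq> halves p"
    using halves_eq_if_indicator_vector_eq[OF assms(3)] set_subset_halves by metis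
  consider "simple_route G p" | s \<beta> where "p = s @ \<beta> @ string_inverse s" "lollipop_data s \<beta>"
    using assms(1) lollipop_iff unfolding elementary_route_def by blast
  then have "q = p \<or> q = string_inverse p"
  proof cases
    case 1
    then show ?thesis
      using simple_route_unique q sub by blast
  next
    case 2
    have "halves p = halves (s @ \<beta>)"
      unfolding 2 by auto
    then show ?thesis
      using lollipop_unique[OF 2(2) q] sub unfolding 2(1) by blast
  qed
  then show ?thesis
    by (simp add: route_equiv_def)
qed

text \<open>The framing condition for \<open>\<alpha> s \<beta> s\<^sup>-\<^sup>1\<close> to be self-compatible: reversing one of the two cycles negates it.\<close>

definition aligned :: "'e oriented_edge list \<Rightarrow> 'e oriented_edge list \<Rightarrow> bool" where
  "aligned \<alpha> \<beta> \<longleftrightarrow> (less (hd \<alpha>) (edge_inverse (last \<alpha>)) \<longleftrightarrow> less (hd \<beta>) (edge_inverse (last \<beta>)))"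

lemma barbell_ends_neq:
  assumes "barbell_data \<alpha> s \<beta>"
  shows "hd \<alpha> \<noteq> edge_inverse (last \<alpha>)" "hd \<beta> \<noteq> edge_inverse (last \<beta>)"
proof -
  note d = assms[unfolded barbell_data_def]
  let ?L = "\<alpha> @ s @ \<beta>"
  have "hd \<alpha> \<in> set ?L" "last \<alpha> \<in> set ?L" "hd \<beta> \<in> set ?L" "last \<beta> \<in> set ?L"
    using d by simp_all
  then show "hd \<alpha> \<noteq> edge_inverse (last \<alpha>)" "hd \<beta> \<noteq> edge_inverse (last \<beta>)"
    using inner_simple_no_inverse[of ?L] d by metis+
qed

lemma turn_less_flip:
  assumes "same (hd \<beta>) (edge_inverse (last \<beta>))" "hd \<beta> \<noteq> edge_inverse (last \<beta>)" "\<beta> \<noteq> []"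
  shows "less (hd (string_inverse \<beta>)) (edge_inverse (last (string_inverse \<beta>))) \<longleftrightarrow>
    \<not> less (hd \<beta>) (edge_inverse (last \<beta>))"
  using less_total[OF assms(1,2)] less_asym[of "hd \<beta>" "edge_inverse (last \<beta>)"] assms(3) by auto

lemma aligned_flip:
  assumes "barbell_data \<alpha> s \<beta>"
  shows "aligned \<alpha> (string_inverse \<beta>) \<longleftrightarrow> \<not> aligned \<alpha> \<beta>"
    "aligned (string_inverse \<alpha>) \<beta> \<longleftrightarrow> \<not> aligned \<alpha> \<beta>"
    "aligned (string_inverse \<beta>) (string_inverse \<alpha>) \<longleftrightarrow> aligned \<alpha> \<beta>"
  using assms barbell_ends_neq[OF assms] turn_less_flip[of \<alpha>] turn_less_flip[of \<beta>]
  unfolding aligned_def barbell_data_def by blast+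

lemma barbell_same_start:
  assumes d: "barbell_data \<alpha> s \<beta>" and y: "y \<in> halves (\<alpha> @ s @ \<beta>)" "same (hd \<alpha>) y"
  shows "y = hd \<alpha> \<or> y = edge_inverse (last \<alpha>)"
proof -
  note d' = d[unfolded barbell_data_def]
  have "linked (last \<alpha>) (hd (s @ \<beta>))"
    using d' by (auto simp: inner_simple_def is_string_append)
  then have "opp (hd (s @ \<beta>)) y"
    using d' y(2) opp_same_trans opp_sym same_sym by metis
  then show ?thesis
    using barbell_fork(2)[OF d y(1)] by blast
qed

text \<open>A pair in one class involves a free end of \<open>\<alpha> @ s @ \<beta>\<close>, and
  the partner of a free end is the other end of the same cycle.\<close>

lemma barbell_same:
  assumes d: "barbell_data \<alpha> s \<beta>" and xy: "x \<in> halves (\<alpha> @ s @ \<beta>)" "y \<in> halves (\<alpha> @ s @ \<beta>)" "same x y" "x \<noteq> y"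
  shows "{x, y} = {hd \<alpha>, edge_inverse (last \<alpha>)} \<or> {x, y} = {hd \<beta>, edge_inverse (last \<beta>)}"
proof -
  note d' = d[unfolded barbell_data_def]
  have \<alpha>: "z = hd \<alpha> \<or> z = edge_inverse (last \<alpha>)" if "z \<in> halves (\<alpha> @ s @ \<beta>)" "same (hd \<alpha>) z" for z
    using barbell_same_start[OF d that] .
  have \<beta>: "z = edge_inverse (last \<beta>) \<or> z = hd \<beta>"
    if "z \<in> halves (\<alpha> @ s @ \<beta>)" "same (edge_inverse (last \<beta>)) z" for z
  proof -
    have "z \<in> halves (string_inverse \<beta> @ string_inverse s @ string_inverse \<alpha>)"
      using that(1) by auto
    then show ?thesis
      using barbell_same_start[OF barbell_data_inverse[OF d], of z] that(2) d' by simp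
  qed
  have "x \<in> {hd \<alpha>, edge_inverse (last \<beta>)} \<or> y \<in> {hd \<alpha>, edge_inverse (last \<beta>)}"
    using inner_simple_same[OF _ xy] d' by simp
  then consider "x = hd \<alpha>" | "x = edge_inverse (last \<beta>)" | "y = hd \<alpha>" | "y = edge_inverse (last \<beta>)"
    by blast
  then show ?thesis
  proof cases
    case 1
    then show ?thesis
      using \<alpha>[OF xy(2)] xy(3,4) by blast
  next
    case 2
    then show ?thesis
      using \<beta>[OF xy(2)] xy(3,4) by blast
  next
    case 3
    then show ?thesis
      using \<alpha>[OF xy(1)] same_sym[OF xy(3)] xy(4) by blast
  next
    case 4
    then show ?thesis
      using \<beta>[OF xy(1)] same_sym[OF xy(3)] xy(4) by blast
  qed
qed

text \<open>Inverting the band reverses both cycles at once. So a barbell is determined by the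
  relative direction of its cycles, and \<open>aligned\<close> must not change when both are
  reversed.\<close>

lemma barbell_rotations:
  fixes \<alpha> s \<beta> :: "'e oriented_edge list"
  shows "(\<alpha> @ s @ \<beta> @ string_inverse s, string_inverse \<alpha> @ s @ string_inverse \<beta> @ string_inverse s) \<in> band_equiv"
  "(\<alpha> @ s @ \<beta> @ string_inverse s, string_inverse \<beta> @ string_inverse s @ string_inverse \<alpha> @ s) \<in> band_equiv"
proof -
  have inv: "(B, string_inverse B) \<in> band_equiv" for B :: "'e oriented_edge list"
    using band_equiv_rotate(2)[of B 0] by simp
  have eq: "string_inverse (\<alpha> @ s @ \<beta> @ string_inverse s) = s @ string_inverse \<beta> @ string_inverse s @ string_inverse \<alpha>"
    by simp
  show "(\<alpha> @ s @ \<beta> @ string_inverse s, string_inverse \<alpha> @ s @ string_inverse \<beta> @ string_inverse s) \<in> band_equiv"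
    using band_equiv_trans[OF inv[of "\<alpha> @ s @ \<beta> @ string_inverse s"]]
      band_equiv_swap[of "s @ string_inverse \<beta> @ string_inverse s" "string_inverse \<alpha>"]
    unfolding eq by simp
  show "(\<alpha> @ s @ \<beta> @ string_inverse s, string_inverse \<beta> @ string_inverse s @ string_inverse \<alpha> @ s) \<in> band_equiv"
    using band_equiv_trans[OF inv[of "\<alpha> @ s @ \<beta> @ string_inverse s"]]
      band_equiv_swap[of s "string_inverse \<beta> @ string_inverse s @ string_inverse \<alpha>"]
    unfolding eq by simp
qed

text \<open>The band traverses the edge of \<open>last \<alpha>\<close> once, so every substring
  that starts with \<open>last \<alpha>\<close> follows the band from that place on.\<close>

lemma barbell_continuation:
  assumes d: "barbell_data \<alpha> s \<beta>" and w: "band_substring (\<alpha> @ s @ \<beta> @ string_inverse s) (last \<alpha> # w)"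
  shows "prefix w (s @ [hd \<beta>]) \<or> prefix (s @ [hd \<beta>]) w"
proof -
  let ?B = "\<alpha> @ s @ \<beta> @ string_inverse s"
  note d' = d[unfolded barbell_data_def]
  let ?r = "s @ \<beta> @ string_inverse s @ butlast \<alpha>"
  have split: "?B = butlast \<alpha> @ last \<alpha> # s @ \<beta> @ string_inverse s"
    using d' by simp
  have rot: "rotate (length (butlast \<alpha>)) ?B = last \<alpha> # ?r"
    unfolding split rotate_append by simp
  \<comment> \<open>For the inverted barbell the edge counted in \<open>barbell_data_count\<close>
    is the one of \<open>last \<alpha>\<close>.\<close>
  have "count_list (map fst (string_inverse \<beta> @ string_inverse s @ string_inverse \<alpha> @ s))
      (fst (hd (string_inverse \<alpha>))) = 1"
    using barbell_data_count[OF barbell_data_inverse[OF d]] by simp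
  then have "count_list (map fst ?B) (fst (last \<alpha>)) = 1"
    using band_equiv_count[OF barbell_rotations(2)[of \<alpha> s \<beta>]] d' by (simp del: map_append)
  then obtain m where m: "m > 0" "prefix (last \<alpha> # w) (string_power (last \<alpha> # ?r) m)"
    using band_substring_prefix[OF w rot] by auto
  then obtain n where "string_power (last \<alpha> # ?r) m = (last \<alpha> # ?r) @ string_power (last \<alpha> # ?r) n"
    by (metis gr0_conv_Suc string_power_Suc)
  then have "prefix w (?r @ string_power (last \<alpha> # ?r) n)"
    using m(2) by simp
  moreover have "?r = (s @ [hd \<beta>]) @ tl \<beta> @ string_inverse s @ butlast \<alpha>"
    using d' by simp
  then have "prefix (s @ [hd \<beta>]) (?r @ string_power (last \<alpha> # ?r) n)"
    by (metis append_assoc prefixI)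
  ultimately show ?thesis
    by (rule prefix_same_cases)
qed

lemma barbell_continuation':
  assumes d: "barbell_data \<alpha> s \<beta>"
    and w: "band_substring (\<alpha> @ s @ \<beta> @ string_inverse s) (edge_inverse (hd \<alpha>) # w)"
  shows "prefix w (s @ [edge_inverse (last \<beta>)]) \<or> prefix (s @ [edge_inverse (last \<beta>)]) w"
proof -
  have d': "barbell_data (string_inverse \<alpha>) s (string_inverse \<beta>)"
    using barbell_data_inverse[OF barbell_data_flip[OF barbell_data_inverse[OF barbell_data_flip[OF d]]]] by simp
  have "\<alpha> \<noteq> []" "\<beta> \<noteq> []"
    using d by (simp_all add: barbell_data_def)
  then show ?thesis
    using barbell_continuation[OF d', of w] w band_equiv_substring[OF barbell_rotations(1)[of \<alpha> s \<beta>]] by simp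
qed

text \<open>The two substrings come out of \<alpha> at its two ends. Both then follow
  \<open>s\<close> up to the other fork and part there into the two ends of \<beta>, in the order
  that \<open>aligned\<close> forbids for an incompatibility.\<close>

lemma barbell_no_crossing:
  assumes d: "barbell_data \<alpha> s \<beta>" "aligned \<alpha> \<beta>"
    and w: "band_substring (\<alpha> @ s @ \<beta> @ string_inverse s) ([e1] @ t @ [f1])"
      "band_substring (\<alpha> @ s @ \<beta> @ string_inverse s) ([e2] @ t @ [f2])"
    and less: "less (edge_inverse e1) (edge_inverse e2)" "less f1 f2"
  shows "{edge_inverse e1, edge_inverse e2} \<noteq> {hd \<alpha>, edge_inverse (last \<alpha>)}"
proof
  have ends: "hd \<beta> \<noteq> edge_inverse (last \<beta>)" "f1 \<noteq> f2"
    using barbell_ends_neq[OF d(1)] less(2) by (auto simp: framing_less_def)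
  assume "{edge_inverse e1, edge_inverse e2} = {hd \<alpha>, edge_inverse (last \<alpha>)}"
  then consider "edge_inverse e1 = hd \<alpha>" "e2 = last \<alpha>" | "e1 = last \<alpha>" "edge_inverse e2 = hd \<alpha>"
    by (auto simp: doubleton_eq_iff)
  then show False
  proof cases
    case 1
    then have e1: "e1 = edge_inverse (hd \<alpha>)"
      by (metis edge_inverse_inverse)
    have "t = s \<and> f1 = edge_inverse (last \<beta>) \<and> f2 = hd \<beta>"
      using barbell_continuation'[OF d(1), of "t @ [f1]"] barbell_continuation[OF d(1), of "t @ [f2]"] w 1 e1 ends
      by (intro prefix_fork) auto
    then show False
      using less d(2) 1 less_asym unfolding aligned_def by metis
  next
    case 2
    then have e2: "e2 = edge_inverse (hd \<alpha>)"
      by (metis edge_inverse_inverse)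
    have "t = s \<and> f1 = hd \<beta> \<and> f2 = edge_inverse (last \<beta>)"
      using barbell_continuation'[OF d(1), of "t @ [f2]"] barbell_continuation[OF d(1), of "t @ [f1]"] w 2 e2 ends
      by (intro prefix_fork) auto
    then show False
      using less d(2) 2 less_asym unfolding aligned_def by metis
  qed
qed

lemma band_not_route: "band G B \<Longrightarrow> \<not> route G B"
proof
  assume "band G B" "route G B"
  then have "linked (last B) (hd B)"
    using closed_string_iff[of B] by (simp add: band_def)
  then show False
    using opp_internal(2) internal_not_fringe \<open>route G B\<close> unfolding route_def tail_eq by blast
qed

lemma substring_of_band:
  assumes "band G B" "band G (string_inverse B)"
  shows "substring_of_trail G w B \<or> substring_of_trail G w (string_inverse B) \<longleftrightarrow> band_substring B w"
  using assms band_not_route unfolding substring_of_trail_def band_substring_def by blast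

lemma barbell_band_inverse:
  assumes "barbell_data \<alpha> s \<beta>" "(\<alpha> @ s @ \<beta> @ string_inverse s, B) \<in> band_equiv"
  shows "band G B \<and> band G (string_inverse B)"
proof -
  have "(B, string_inverse B) \<in> band_equiv"
    using band_equiv_rotate(2)[of B 0] by simp
  then show ?thesis
    using band_equiv_band[OF _ barbell_data_closed[OF assms(1)] barbell_data_count[OF assms(1)]]
      assms(2) band_equiv_trans by blast
qed

lemma barbell_compatible:
  assumes d: "barbell_data \<alpha> s \<beta>" "aligned \<alpha> \<beta>"
  shows "self_compatible G R (\<alpha> @ s @ \<beta> @ string_inverse s)"
  unfolding self_compatible_def
proof
  let ?B = "\<alpha> @ s @ \<beta> @ string_inverse s"
  let ?C = "string_inverse \<beta> @ string_inverse s @ string_inverse \<alpha> @ s"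
  assume "incompatible G R ?B ?B"
  moreover have "band G ?B \<and> band G (string_inverse ?B)"
    using barbell_band_inverse[OF d(1) band_equiv_refl] .
  ultimately obtain v w where vw: "band_substring ?B v" "band_substring ?B w" "incompatibility G R v w"
    unfolding incompatible_def using substring_of_band[of ?B] by blast
  obtain e1 e2 t f1 f2 where e: "v = [e1] @ t @ [f1]" "w = [e2] @ t @ [f2]"
    and less: "less (edge_inverse e1) (edge_inverse e2)" "less f1 f2"
    using vw(3) unfolding incompatibility_def head_half_eq tail_half_eq by blast
  have sub: "set u \<subseteq> halves (\<alpha> @ s @ \<beta>)" if "band_substring ?B u" for u
  proof -
    have "set u \<subseteq> set ?B \<or> set u \<subseteq> set (string_inverse ?B)"
      using that set_mono_sublist set_string_power unfolding band_substring_def by blast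
    then have "set u \<subseteq> halves ?B"
      unfolding halves_eq by auto
    then show ?thesis
      by auto
  qed
  have "e1 \<in> halves (\<alpha> @ s @ \<beta>)" "e2 \<in> halves (\<alpha> @ s @ \<beta>)"
    using sub[OF vw(1)] sub[OF vw(2)] e by auto
  then have "{edge_inverse e1, edge_inverse e2} = {hd \<alpha>, edge_inverse (last \<alpha>)} \<or>
      {edge_inverse e1, edge_inverse e2} = {hd \<beta>, edge_inverse (last \<beta>)}"
    using barbell_same[OF d(1), of "edge_inverse e1" "edge_inverse e2"] less(1)
    by (simp add: framing_less_def del: halves_append)
  then show False
  proof
    assume "{edge_inverse e1, edge_inverse e2} = {hd \<alpha>, edge_inverse (last \<alpha>)}"
    then show False
      using barbell_no_crossing[OF d] vw(1,2) less e by blast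
  next
    have sub: "band_substring ?C u \<longleftrightarrow> band_substring ?B u" for u
      by (rule band_equiv_substring[OF barbell_rotations(2)])
    have ne: "\<alpha> \<noteq> []" "\<beta> \<noteq> []"
      using d(1) by (simp_all add: barbell_data_def)
    \<comment> \<open>An incompatibility that starts at the ends of \<beta> is one of the first kind
      for the inverted barbell.\<close>
    assume "{edge_inverse e1, edge_inverse e2} = {hd \<beta>, edge_inverse (last \<beta>)}"
    then have "{edge_inverse e1, edge_inverse e2} =
        {hd (string_inverse \<beta>), edge_inverse (last (string_inverse \<beta>))}"
      using ne by auto
    moreover have "aligned (string_inverse \<beta>) (string_inverse \<alpha>)"
      using aligned_flip(3)[OF d(1)] d(2) by blast
    ultimately show False
      using barbell_no_crossing[OF barbell_data_inverse[OF d(1)], of e1 t f1 e2 f2] vw(1,2) less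
      unfolding e sub[symmetric] by simp
  qed
qed

text \<open>The band contains a substring through \<open>s\<close> from one end of \<alpha>, and its
  inverse one from the other end of \<alpha>. If the cycles are not aligned, these two are ordered
  the same way at both forks, which is an incompatibility.\<close>

lemma aligned_if_compatible:
  assumes d: "barbell_data \<alpha> s \<beta>" and B: "(\<alpha> @ s @ \<beta> @ string_inverse s, B) \<in> band_equiv" "self_compatible G R B"
  shows "aligned \<alpha> \<beta>"
proof (rule ccontr)
  assume n: "\<not> aligned \<alpha> \<beta>"
  note d' = d[unfolded barbell_data_def]
  let ?v = "[last \<alpha>] @ s @ [hd \<beta>]" and ?w = "[edge_inverse (hd \<alpha>)] @ s @ [edge_inverse (last \<beta>)]"
  have *: "band_substring (\<alpha> @ s @ \<beta> @ string_inverse s) ([last \<alpha>] @ s @ [hd \<beta>]) \<and> is_string G ([last \<alpha>] @ s @ [hd \<beta>])"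
    if d: "barbell_data \<alpha> s \<beta>" for \<alpha> s \<beta>
  proof -
    let ?B = "\<alpha> @ s @ \<beta> @ string_inverse s"
    have ne: "\<alpha> \<noteq> []" "\<beta> \<noteq> []"
      using d by (simp_all add: barbell_data_def)
    then have "string_power ?B 1 = butlast \<alpha> @ ([last \<alpha>] @ s @ [hd \<beta>]) @ tl \<beta> @ string_inverse s"
      by simp
    then have "sublist ([last \<alpha>] @ s @ [hd \<beta>]) (string_power ?B 1)"
      unfolding sublist_def by blast
    then have "\<exists>n. sublist ([last \<alpha>] @ s @ [hd \<beta>]) (string_power ?B n)"
      by (rule exI)
    moreover have "butlast \<alpha> @ ([last \<alpha>] @ s @ [hd \<beta>]) @ tl \<beta> = \<alpha> @ s @ \<beta>"
      using ne by (metis append_butlast_last_id append_Cons append_Nil append_assoc list.collapse)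
    then have "is_string G (butlast \<alpha> @ ([last \<alpha>] @ s @ [hd \<beta>]) @ tl \<beta>)"
      using d unfolding barbell_data_def inner_simple_def by metis
    then have "is_string G ([last \<alpha>] @ s @ [hd \<beta>])"
      using is_string_append by blast
    ultimately show ?thesis
      unfolding band_substring_def by (intro conjI disjI1)
  qed
  have v: "band_substring B ?v" "is_string G ?v"
    using *[OF d] band_equiv_substring[OF B(1)] by blast+
  have "barbell_data (string_inverse \<alpha>) s (string_inverse \<beta>)"
    using barbell_data_inverse[OF barbell_data_flip[OF barbell_data_inverse[OF barbell_data_flip[OF d]]]] by simp
  from *[OF this] have w: "band_substring B ?w" "is_string G ?w"
    using band_equiv_substring[OF barbell_rotations(1)] band_equiv_substring[OF B(1)] d' by auto
  have "less (hd \<alpha>) (edge_inverse (last \<alpha>)) \<or> less (edge_inverse (last \<alpha>)) (hd \<alpha>)"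
    "less (hd \<beta>) (edge_inverse (last \<beta>)) \<or> less (edge_inverse (last \<beta>)) (hd \<beta>)"
    using less_total d' barbell_ends_neq[OF d] by blast+
  then have "incompatibility G R ?w ?v \<or> incompatibility G R ?v ?w"
    using n v(2) w(2) less_asym unfolding incompatibility_def aligned_def head_half_eq tail_half_eq
    by (metis edge_inverse_inverse)
  then have "incompatible G R B B"
    unfolding incompatible_def using substring_of_band[of B] barbell_band_inverse[OF d B(1)] v(1) w(1) by blast
  then show False
    using B(2) by (simp add: self_compatible_def)
qed

text \<open>An entry 1 in the indicator vector; it makes the vector nonzero and normalises its
  scale.\<close>

lemma elementary_band_count:
  assumes "elementary_band G B" shows "\<exists>e. count_list (map fst B) e = 1"
proof (cases "simple_band G B")
  case True
  then show ?thesis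
    using closed_count_hd unfolding simple_band_iff by blast
next
  case False
  then have "barbell G B"
    using assms by (simp add: elementary_band_def)
  then obtain n \<alpha> s \<beta> where "rotate n B = s @ \<beta> @ string_inverse s @ \<alpha>" and d: "barbell_data \<alpha> s \<beta>"
    by (rule barbell_dataE)
  then have "(B, (s @ \<beta> @ string_inverse s) @ \<alpha>) \<in> band_equiv"
    using band_equiv_rotate(1)[of B n] by simp
  then have "(B, \<alpha> @ s @ \<beta> @ string_inverse s) \<in> band_equiv"
    using band_equiv_swap band_equiv_trans by blast
  then show ?thesis
    using barbell_data_count[OF d] band_equiv_count by metis
qed

text \<open>\<open>q\<close> is rotated, and inverted if necessary, to start where \<open>p\<close>
  starts. For a barbell everything is then forced except the direction in which \<alpha> is entered,
  and the wrong direction contradicts \<open>aligned\<close>, which self-compatibility gives for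
  both bands.\<close>

lemma elementary_band_unique:
  assumes p: "elementary_band G p" "self_compatible G R p" and q: "elementary_band G q" "self_compatible G R q"
    and eq: "indicator_vector p = indicator_vector q"
  shows "(p, q) \<in> band_equiv"
proof -
  have len: "length p = length q" and H: "halves p = halves q"
    using length_eq_if_indicator_vector_eq[OF eq] halves_eq_if_indicator_vector_eq[OF eq] .
  have "band G q" 
    using q(1) by (auto simp: elementary_band_def simple_band_def barbell_def)
  then have closed: "is_string G (q @ q)"
    by (simp add: band_def)
  have start: "\<exists>r. (q, r) \<in> band_equiv \<and> hd r = x \<and> r \<noteq> [] \<and> length r = length p \<and> is_string G r \<and> set r \<subseteq> halves p"
    if x: "x \<in> halves p" for x
  proof -
    obtain n r where r: "(q, r) \<in> band_equiv" "hd r = x" "r \<noteq> []" "r = rotate n q \<or> r = rotate n (string_inverse q)"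
      using band_equiv_start[of x q] x unfolding H by blast
    then have "is_string G r"
      using band_equiv_closed[OF r(1) closed] by (simp add: is_string_append)
    moreover have "length r = length p" "halves r = halves p"
      using r(4) len H halves_rotate by auto
    ultimately show ?thesis
      using r set_subset_halves by metis
  qed
  consider "simple_band G p" | "barbell G p"
    using p(1) by (auto simp: elementary_band_def)
  then show ?thesis
  proof cases
    case 1
    then have b: "p \<noteq> []" "is_string G p" "linked (last p) (hd p)" "distinct (map (vert G) p)"
      by (simp_all add: simple_band_iff)
    obtain r where r: "(q, r) \<in> band_equiv" "hd r = hd p" "r \<noteq> []" "length r = length p" "is_string G r" "set r \<subseteq> halves p"
      using start[of "hd p"] b(1) by (auto simp: in_halves_self)
    have "prefix r p \<or> prefix p r"
      using forced_follow[OF simple_band_forced[OF b(2-4)] r(5,6) b(1) r(3,2)] .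
    then have "r = p"
      using r(4) by (auto simp: prefix_def)
    then show ?thesis
      using r(1) band_equiv_sym by blast
  next
    case 2
    then obtain n \<alpha> s \<beta> where rot: "rotate n p = s @ \<beta> @ string_inverse s @ \<alpha>" and d: "barbell_data \<alpha> s \<beta>"
      by (rule barbell_dataE)
    let ?H = "halves (\<alpha> @ s @ \<beta>)"
    let ?p = "\<beta> @ string_inverse s @ \<alpha> @ s"
    have pp: "(p, ?p) \<in> band_equiv" "(p, \<alpha> @ s @ \<beta> @ string_inverse s) \<in> band_equiv"
      using band_equiv_rotate(1)[of p n] band_equiv_swap[of s "\<beta> @ string_inverse s @ \<alpha>"]
        band_equiv_swap[of "s @ \<beta> @ string_inverse s" \<alpha>] band_equiv_trans[of p] unfolding rot by auto
    have Hp: "halves p = ?H"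
      unfolding halves_rotate[of n p, symmetric] rot by auto
    have ne: "\<alpha> \<noteq> []" "\<beta> \<noteq> []"
      using d by (simp_all add: barbell_data_def)
    have "length p = length (rotate n p)"
      by simp
    then have lenp: "length p = length ?p"
      unfolding rot by simp
    obtain r where r: "(q, r) \<in> band_equiv" "hd r = hd \<beta>" "r \<noteq> []" "length r = length p" "is_string G r" "set r \<subseteq> ?H"
      using start[of "hd \<beta>"] ne unfolding Hp by (auto simp: in_halves_self)
    have "hd (\<beta> @ string_inverse s) = hd \<beta>" "\<beta> @ string_inverse s \<noteq> []"
      using ne by simp_all
    then have "prefix r (\<beta> @ string_inverse s) \<or> prefix (\<beta> @ string_inverse s) r"
      using forced_follow[OF barbell_forced(3)[OF d] r(5,6)] r(2,3) by simp
    \<comment> \<open>Equal indicator vectors give equal lengths, so \<open>r\<close> goes beyond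
      this forced piece and reaches the fork at \<alpha>.\<close>
    moreover have "\<not> length r \<le> length (\<beta> @ string_inverse s)"
      using r(4) lenp ne by simp
    ultimately have "prefix (\<beta> @ string_inverse s) r"
      using prefix_length_le by blast
    then obtain u where u: "r = (\<beta> @ string_inverse s) @ u"
      unfolding prefix_def by blast
    then have u': "length u = length (\<alpha> @ s)" "u \<noteq> []"
      using r(4) lenp ne by auto
    have u'': "is_string G u" "set u \<subseteq> ?H" "linked (last (\<beta> @ string_inverse s)) (hd u)"
      using r(5,6) u'(2) ne unfolding u is_string_append[of "\<beta> @ string_inverse s"] by simp_all
    have d2: "barbell_data \<beta> (string_inverse s) (string_inverse \<alpha>)"
      using barbell_data_inverse[OF barbell_data_flip[OF d]] by simp
    have "?H = halves (\<beta> @ string_inverse s @ string_inverse \<alpha>)"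
      by auto
    then have "hd u \<in> {hd (string_inverse \<alpha>), edge_inverse (last (string_inverse \<alpha>))}"
      using barbell_fork(1)[OF d2 _ u''(3)] u''(2) u'(2) hd_in_set by blast
    then have hd_u: "hd u = hd \<alpha> \<or> hd u = hd (string_inverse \<alpha>)"
      using ne by auto
    have follow: "u = w" if "forced ?H w" "hd u = hd w" "length w = length (\<alpha> @ s)" for w
    proof -
      have "w \<noteq> []"
        using that(3) ne by auto
      then have "prefix u w \<or> prefix w u"
        using forced_follow[OF that(1) u''(1,2) _ u'(2) that(2)] by blast
      then show ?thesis
        using u'(1) that(3) by (auto simp: prefix_def)
    qed
    from hd_u show ?thesis
    proof
      assume "hd u = hd \<alpha>"
      then have "u = \<alpha> @ s"
        using follow[OF barbell_forced(1)[OF d]] ne by simp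
      then have "r = ?p"
        using u by simp
      then show ?thesis
        using r(1) pp(1) band_equiv_sym band_equiv_trans by metis
    next
      \<comment> \<open>Here \<open>q\<close> is the barbell with \<alpha> reversed against
        \<beta>.\<close>
      assume "hd u = hd (string_inverse \<alpha>)"
      then have "u = string_inverse \<alpha> @ s"
        using follow[OF barbell_forced(2)[OF d]] ne by simp
      then have "r = (\<beta> @ string_inverse s) @ string_inverse \<alpha> @ s"
        using u by simp
      then have "((string_inverse \<alpha> @ s) @ \<beta> @ string_inverse s, q) \<in> band_equiv"
        using r(1) band_equiv_swap band_equiv_sym band_equiv_trans by metis
      moreover have "barbell_data (string_inverse \<alpha>) s \<beta>"
        using barbell_data_inverse[OF barbell_data_flip[OF barbell_data_inverse[OF d]]] by simp
      ultimately have "aligned (string_inverse \<alpha>) \<beta>"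
        using aligned_if_compatible q(2) by simp
      moreover have "aligned \<alpha> \<beta>"
        using aligned_if_compatible[OF d] band_equiv_sym[OF pp(2)] p(2) by blast
      ultimately show ?thesis
        using aligned_flip(2)[OF d] by blast
    qed
  qed
qed

end

section \<open>Vertices and extremal rays\<close>

lemma equiv_route_equiv: "equiv UNIV (route_equiv :: ('a oriented_edge list \<times> 'a oriented_edge list) set)"
  by (rule equivI) (auto simp: route_equiv_def refl_on_def intro!: symI transI)

text \<open>The map \<open>f\<close> is constant on classes, while \<open>g\<close> need not be
  injective. The lemma is used with \<open>g\<close> the identity for vertices and \<open>g\<close>
  equal to \<open>ray\<close> for bands.\<close>

lemma bij_betw_quotient:
  assumes "equiv UNIV r" and resp: "\<And>x y. (x, y) \<in> r \<Longrightarrow> f x = f y"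
    and inj: "\<And>x y. x \<in> A \<Longrightarrow> y \<in> A \<Longrightarrow> g (f x) = g (f y) \<Longrightarrow> (x, y) \<in> r"
  shows "bij_betw (\<lambda>c. g (the_elem (f ` c))) (A // r) ((\<lambda>x. g (f x)) ` A)"
proof -
  have value_class: "the_elem (f ` (r `` {x})) = f x" for x
  proof -
    have "x \<in> r `` {x}"
      using equiv_class_self[OF assms(1)] by simp
    have "f ` (r `` {x}) = (\<lambda>_. f x) ` (r `` {x})"
      using resp by (intro image_cong) auto
    then have "f ` (r `` {x}) = {f x}"
      using \<open>x \<in> r `` {x}\<close> by (metis empty_iff image_constant)
    then show ?thesis
      by simp
  qed
  show ?thesis
  proof (rule bij_betw_imageI)
    show "inj_on (\<lambda>c. g (the_elem (f ` c))) (A // r)"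
    proof (rule inj_onI)
      fix c d assume "c \<in> A // r" "d \<in> A // r" and eq: "g (the_elem (f ` c)) = g (the_elem (f ` d))"
      then obtain x y where x: "c = r `` {x}" "x \<in> A" and y: "d = r `` {y}" "y \<in> A"
        by (metis quotientE)
      then have "(x, y) \<in> r"
        using inj eq value_class by simp
      then show "c = d"
        using equiv_class_eq[OF assms(1)] x y by blast
    qed
    have "A // r = (\<lambda>x. r `` {x}) ` A"
      by (auto simp: quotient_def)
    then show "(\<lambda>c. g (the_elem (f ` c))) ` (A // r) = (\<lambda>x. g (f x)) ` A"
      by (simp add: image_image value_class)
  qed
qed

lemma convex_coneI:
  assumes "C \<noteq> {}" "\<And>x y. x \<in> C \<Longrightarrow> y \<in> C \<Longrightarrow> x + y \<in> C" "\<And>x c. x \<in> C \<Longrightarrow> 0 \<le> c \<Longrightarrow> c *\<^sub>R x \<in> C"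
  shows "convex_cone C"
proof -
  obtain x where "x \<in> C"
    using assms(1) by blast
  then have "0 \<in> C"
    using assms(3)[of x 0] by simp
  then show ?thesis
    using assms(2,3) unfolding convex_cone_iff by blast
qed

context framed_turbulence
begin

lemma flow_contains_trail:
  assumes F: "is_flow G F" "\<And>e. F $ e \<ge> 0" "F \<noteq> 0"
  shows "(\<exists>p. elementary_route G R p \<and> (\<forall>x \<in> set p. F $ fst x > 0)) \<or>
    (\<exists>B. elementary_band G B \<and> self_compatible G R B \<and> (\<forall>x \<in> set B. F $ fst x > 0))"
proof -
  let ?X = "{x :: 'e half_edge. F $ fst x > 0}"
  obtain e where "F $ e \<noteq> 0"
    using F(3) by (auto simp: vec_eq_iff)
  then have "F $ e > 0"
    using F(2)[of e] by simp
  then have "(e, True) \<in> ?X"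
    by simp
  then have ne: "?X \<noteq> {}"
    by blast
  \<comment> \<open>Conservation carries positive flow across a vertex: the class of
    \<open>x\<close> has positive sum, hence so has the opposite class.\<close>
  have opp: "\<exists>y\<in>?X. opp x y" if x: "x \<in> ?X" "internal G (vert G x)" for x
  proof -
    obtain y where y: "opp x y"
      using exists_opp x(2) by blast
    have "0 < (\<Sum>z | same x z. F $ fst z)"
      using x same_refl[OF x(2)] F(2) by (intro sum_pos2[of _ x]) auto
    then have "(\<Sum>z | same y z. F $ fst z) \<noteq> 0"
      using flow_eq[OF F(1) y] by simp
    then obtain z where "same y z" "F $ fst z \<noteq> 0"
      by (metis (no_types, lifting) mem_Collect_eq sum.neutral)
    then have "opp x z" "F $ fst z > 0"
      using opp_same_trans[OF y] F(2)[of "fst z"] by auto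
    then show ?thesis
      by blast
  qed
  consider q where "set q \<subseteq> ?X" "simple_route G q" | q where "set q \<subseteq> ?X" "simple_band G q"
    | s \<beta> where "lollipop_data s \<beta>" "set (s @ \<beta>) \<subseteq> ?X"
    | \<alpha> s \<beta> where "barbell_data \<alpha> s \<beta>" "set (\<alpha> @ s @ \<beta>) \<subseteq> ?X"
    using exists_trail[OF ne _ opp] by force
  then show ?thesis
  proof cases
    case 1
    then show ?thesis
      using simple_route_compatible[OF 1(2)] unfolding elementary_route_def by blast
  next
    case 2
    then show ?thesis
      using simple_band_compatible[OF 2(2)] unfolding elementary_band_def by blast
  next
    case 3
    have "elementary_route G R (s @ \<beta> @ string_inverse s)"
      using lollipop_compatible[OF 3(1)] lollipop_iff 3(1) unfolding elementary_route_def by blast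
    moreover have "\<forall>x \<in> set (s @ \<beta> @ string_inverse s). F $ fst x > 0"
      using 3(2) by auto
    ultimately show ?thesis
      by blast
  next
    case 4
    \<comment> \<open>Reversing \<beta> negates \<open>aligned\<close>, so one of the two directions
      works.\<close>
    obtain \<gamma> where \<gamma>: "barbell_data \<alpha> s \<gamma>" "aligned \<alpha> \<gamma>" "\<gamma> = \<beta> \<or> \<gamma> = string_inverse \<beta>"
      using 4(1) barbell_data_flip[OF 4(1)] aligned_flip(1)[OF 4(1)] by blast
    have "elementary_band G (\<alpha> @ s @ \<gamma> @ string_inverse s)"
      using barbell_data_barbell[OF \<gamma>(1)] by (simp add: elementary_band_def)
    moreover have "set (string_inverse p) \<subseteq> ?X" if "set p \<subseteq> ?X" for p
      using that by auto
    then have "set (\<alpha> @ s @ \<gamma> @ string_inverse s) \<subseteq> ?X"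
      using 4(2) \<gamma>(3) by (metis Un_subset_iff set_append)
    then have "\<forall>x \<in> set (\<alpha> @ s @ \<gamma> @ string_inverse s). F $ fst x > 0"
      by blast
    ultimately show ?thesis
      using barbell_compatible[OF \<gamma>(1,2)] by blast
  qed
qed

text \<open>The test edge depends on the trail alone and serves for all flows. It can therefore be
  used to read off the coefficient in \<open>elementary_minimal\<close>.\<close>

lemma elementary_flow_zero:
  assumes "simple_route G p \<or> lollipop G p \<or> elementary_band G p"
  shows "\<exists>e \<in> fst ` set p. \<forall>F. supported_flow (halves p) F \<longrightarrow> F $ e = 0 \<longrightarrow> F = 0"
proof -
  consider "simple_route G p" | "simple_band G p" | s \<beta> where "p = s @ \<beta> @ string_inverse s" "lollipop_data s \<beta>"
    | n \<alpha> s \<beta> where "rotate n p = s @ \<beta> @ string_inverse s @ \<alpha>" "barbell_data \<alpha> s \<beta>"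
    using assms lollipop_iff barbell_dataE unfolding elementary_band_def by metis
  then show ?thesis
  proof cases
    case 1
    then have "p \<noteq> []"
      by (simp add: simple_route_iff)
    then show ?thesis
      using simple_route_flow_zero[OF 1] by (intro bexI[of _ "fst (hd p)"]) auto
  next
    case 2
    then have "p \<noteq> []"
      by (simp add: simple_band_iff)
    then show ?thesis
      using simple_band_flow_zero[OF 2] by (intro bexI[of _ "fst (hd p)"]) auto
  next
    case 3
    have H: "halves p = halves (s @ \<beta>)"
      unfolding 3(1) by auto
    have "fst (hd \<beta>) \<in> fst ` set p"
      using 3(2) unfolding 3(1) lollipop_data_def by auto
    then show ?thesis
      using lollipop_flow_zero[OF 3(2)] unfolding H by blast
  next
    case 4
    have "halves p = halves (rotate n p)"
      by (simp add: halves_rotate)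
    also have "\<dots> = halves (\<alpha> @ s @ \<beta>)"
      unfolding 4(1) by auto
    finally have H: "halves p = halves (\<alpha> @ s @ \<beta>)" .
    have "fst (hd \<beta>) \<in> fst ` set (rotate n p)"
      using 4(2) unfolding 4(1) barbell_data_def by auto
    then have "fst (hd \<beta>) \<in> fst ` set p"
      by simp
    then show ?thesis
      using barbell_flow_zero[OF 4(2)] unfolding H by blast
  qed
qed

lemma elementary_minimal:
  assumes p: "simple_route G p \<or> lollipop G p \<or> elementary_band G p"
    and F: "is_flow G F" "\<And>e. e \<notin> fst ` set p \<Longrightarrow> F $ e = 0"
  shows "\<exists>c. F = c *\<^sub>R indicator_vector p"
proof -
  obtain e where e: "e \<in> fst ` set p" and zero: "\<And>F. supported_flow (halves p) F \<Longrightarrow> F $ e = 0 \<Longrightarrow> F = 0"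
    using elementary_flow_zero[OF p] by blast
  have I: "indicator_vector p $ e \<noteq> 0"
    using e by (simp add: indicator_vector_eq_0_iff)
  have "route G p \<or> band G p"
    using p by (auto simp: simple_route_def lollipop_def elementary_band_def simple_band_def barbell_def)
  then have flow: "is_flow G (indicator_vector p)"
    using route_in_polyhedron band_in_recession_cone
    unfolding turbulence_polyhedron_def turbulence_recession_cone_def nonneg_flows_of_strength_def by blast
  \<comment> \<open>With this coefficient the difference vanishes at the test edge. The difference
    may have entries of either sign, which \<open>supported_flow\<close> allows.\<close>
  define c where "c = F $ e / indicator_vector p $ e"
  have "is_flow G (F + (- c) *\<^sub>R indicator_vector p)"
    by (intro is_flow_add is_flow_scale F(1) flow)
  moreover have "(F + (- c) *\<^sub>R indicator_vector p) $ fst x = 0" if "x \<notin> halves p" for x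
  proof -
    have "fst x \<notin> fst ` set p"
      using that by (simp add: halves_def)
    then show ?thesis
      using F(2) indicator_vector_eq_0_iff by fastforce
  qed
  ultimately have "supported_flow (halves p) (F + (- c) *\<^sub>R indicator_vector p)"
    unfolding supported_flow_def by blast
  moreover have "(F + (- c) *\<^sub>R indicator_vector p) $ e = 0"
    using I by (simp add: c_def)
  ultimately have "F + (- c) *\<^sub>R indicator_vector p = 0"
    by (rule zero)
  then show ?thesis
    by (metis add.commute add_diff_cancel_left' add_eq_0_iff scaleR_minus_left)
qed

section \<open>Vertices of the polyhedron\<close>

lemma route_extreme:
  assumes "elementary_route G R p"
  shows "indicator_vector p extreme_point_of turbulence_polyhedron G"
proof -
  have p: "simple_route G p \<or> lollipop G p"
    using assms by (simp add: elementary_route_def)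
  then have "route G p"
    by (auto simp: simple_route_def lollipop_def)
  then have P: "indicator_vector p \<in> turbulence_polyhedron G"
    by (rule route_in_polyhedron)
  have "indicator_vector p \<notin> open_segment a b"
    if a: "a \<in> turbulence_polyhedron G" and b: "b \<in> turbulence_polyhedron G" for a b
  proof
    assume "indicator_vector p \<in> open_segment a b"
    then obtain u where u: "a \<noteq> b" "0 < u" "u < 1" "indicator_vector p = (1 - u) *\<^sub>R a + u *\<^sub>R b"
      by (auto simp: in_segment)
    \<comment> \<open>Inside the support of \<open>p\<close> every flow is a multiple of the
      indicator vector, and strength 1 fixes the factor.\<close>
    have eq: "y = indicator_vector p" if y: "y \<in> turbulence_polyhedron G" "\<And>e. e \<notin> fst ` set p \<Longrightarrow> y $ e = 0" for y
    proof -
      obtain c where c: "y = c *\<^sub>R indicator_vector p"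
        using elementary_minimal[of p y] p y unfolding turbulence_polyhedron_def nonneg_flows_of_strength_def by blast
      then have "c = 1"
        using y(1) P strength_scale[of G c "indicator_vector p"]
        unfolding turbulence_polyhedron_def nonneg_flows_of_strength_def by simp
      then show ?thesis
        using c by simp
    qed
    \<comment> \<open>Nonnegative terms with sum 0: where the indicator vector vanishes, both end
      points of the segment vanish.\<close>
    have "a $ e = 0 \<and> b $ e = 0" if "e \<notin> fst ` set p" for e
    proof -
      have "(1 - u) * a $ e + u * b $ e = 0"
        using that indicator_vector_eq_0_iff[of p e] u(4) by (metis vector_add_component vector_scaleR_component real_scaleR_def)
      moreover have "0 \<le> a $ e" "0 \<le> b $ e"
        using a b by (simp_all add: turbulence_polyhedron_def nonneg_flows_of_strength_def)
      moreover from this have "0 \<le> (1 - u) * a $ e" "0 \<le> u * b $ e"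
        using u(2,3) by simp_all
      ultimately have "(1 - u) * a $ e = 0" "u * b $ e = 0"
        by linarith+
      then show ?thesis
        using u(2,3) by simp
    qed
    then have "a = indicator_vector p" "b = indicator_vector p"
      using eq[OF a] eq[OF b] by blast+
    then show False
      using u(1) by simp
  qed
  then show ?thesis
    using P by (simp add: extreme_point_of_def)
qed

text \<open>\<open>t\<close> is the smallest quotient of the entries over the edges of
  \<open>p\<close>. It is the largest multiple that fits below \<open>F\<close>, and subtracting it
  empties an edge.\<close>

lemma subtract_multiple:
  assumes "\<And>e. F $ e \<ge> 0" "\<And>x. x \<in> set p \<Longrightarrow> F $ fst x > 0" "p \<noteq> []"
  shows "\<exists>t>0. (\<forall>e. F $ e \<ge> t * indicator_vector p $ e) \<and> (\<exists>e \<in> fst ` set p. F $ e = t * indicator_vector p $ e)"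
proof -
  let ?E = "fst ` set p"
  let ?q = "\<lambda>e. F $ e / indicator_vector p $ e"
  define t where "t = Min (?q ` ?E)"
  have I: "indicator_vector p $ e > 0" if "e \<in> ?E" for e
    using indicator_vector_eq_0_iff[of p e] indicator_vector_nonneg[of p e] that by simp
  have fin: "finite (?q ` ?E)" "?q ` ?E \<noteq> {}"
    using assms(3) by simp_all
  have "t \<in> ?q ` ?E"
    unfolding t_def by (rule Min_in[OF fin])
  then obtain e where e: "e \<in> ?E" "t = ?q e"
    by blast
  have "t > 0"
    using e I[OF e(1)] assms(2) by auto
  moreover have "F $ d \<ge> t * indicator_vector p $ d" for d
  proof (cases "d \<in> ?E")
    case True
    then have "t \<le> ?q d"
      unfolding t_def using fin by simp
    then show ?thesis
      using I[OF True] by (simp add: pos_le_divide_eq)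
  next
    case False
    then show ?thesis
      using assms(1)[of d] indicator_vector_eq_0_iff[of p d] by simp
  qed
  moreover have "F $ e = t * indicator_vector p $ e"
    using e I[OF e(1)] by simp
  ultimately show ?thesis
    using e(1) by blast
qed

lemma extreme_is_route:
  assumes "F extreme_point_of turbulence_polyhedron G"
  shows "\<exists>p. elementary_route G R p \<and> F = indicator_vector p"
proof -
  have F: "is_flow G F" "\<And>e. F $ e \<ge> 0" "strength G F = 1"
    and seg: "\<And>a b. a \<in> turbulence_polyhedron G \<Longrightarrow> b \<in> turbulence_polyhedron G \<Longrightarrow> F \<notin> open_segment a b"
    using assms by (auto simp: extreme_point_of_def turbulence_polyhedron_def nonneg_flows_of_strength_def)
  have "F \<noteq> 0"
    using F(3) by (auto simp: strength_def)
  consider p where "elementary_route G R p" "\<forall>x \<in> set p. F $ fst x > 0"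
    | B where "elementary_band G B" "\<forall>x \<in> set B. F $ fst x > 0"
    using flow_contains_trail[OF F(1,2) \<open>F \<noteq> 0\<close>] by blast
  then show ?thesis
  proof cases
    case 1
    let ?I = "indicator_vector p"
    have r: "route G p"
      using 1(1) by (auto simp: elementary_route_def simple_route_def lollipop_def)
    then have I: "?I \<in> turbulence_polyhedron G"
      by (rule route_in_polyhedron)
    have "p \<noteq> []"
      using r by (simp add: route_def)
    then obtain t where t: "t > 0" "\<And>e. F $ e \<ge> t * ?I $ e"
      using subtract_multiple[OF F(2)] 1(2) by blast
    \<comment> \<open>The bound by \<open>t\<close> keeps the remainder nonnegative, and the bound
      by 1/2 leaves it positive strength, so that it can be rescaled to a unit flow.\<close>
    define u where "u = min t (1 / 2)"
    have u: "0 < u" "u < 1" "u \<le> t"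
      using t(1) by (auto simp: u_def)
    let ?F' = "(1 / (1 - u)) *\<^sub>R (F + (- u) *\<^sub>R ?I)"
    have "?F' $ e \<ge> 0" for e
    proof -
      have "u * ?I $ e \<le> t * ?I $ e"
        using u(3) indicator_vector_nonneg[of p e] by (rule mult_right_mono)
      then have "F $ e - u * ?I $ e \<ge> 0"
        using t(2)[of e] by linarith
      then show ?thesis
        using u(2) by simp
    qed
    moreover have "is_flow G ?F'"
      using I F(1) unfolding turbulence_polyhedron_def nonneg_flows_of_strength_def
      by (intro is_flow_scale is_flow_add) auto
    moreover have "strength G ?F' = 1"
      using I F(3) u(2) unfolding turbulence_polyhedron_def nonneg_flows_of_strength_def
      by (simp add: strength_scale strength_add del: scaleR_minus_left)
    ultimately have F': "?F' \<in> turbulence_polyhedron G"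
      by (simp add: turbulence_polyhedron_def nonneg_flows_of_strength_def)
    have eq: "F = (1 - u) *\<^sub>R ?F' + u *\<^sub>R ?I"
      using u(2) by simp
    have "?F' = ?I"
    proof (rule ccontr)
      assume "?F' \<noteq> ?I"
      then have "F \<in> open_segment ?F' ?I"
        using eq u(1,2) unfolding in_segment by blast
      then show False
        using seg[OF F' I] by blast
    qed
    then have "F = ?I"
      using eq by (metis scaleR_collapse)
    then show ?thesis
      using 1(1) by blast
  next
    case 2
    let ?I = "indicator_vector B"
    have "band G B"
      using 2(1) by (auto simp: elementary_band_def simple_band_def barbell_def)
    then have I: "?I \<in> turbulence_recession_cone G" "B \<noteq> []"
      by (auto simp: band_in_recession_cone band_def)
    then obtain t where t: "t > 0" "\<And>e. F $ e \<ge> t * ?I $ e"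
      using subtract_multiple[OF F(2)] 2(2) by blast
    \<comment> \<open>A band adds no strength, so it can be both added and removed. This makes
      \<open>F\<close> the midpoint of a segment in the polyhedron.\<close>
    have "F + c *\<^sub>R ?I \<in> turbulence_polyhedron G" if "c = t \<or> c = - t" for c
    proof -
      have "(F + c *\<^sub>R ?I) $ e \<ge> 0" for e
        using that t(2)[of e] F(2)[of e] t(1) indicator_vector_nonneg[of B e] by auto
      moreover have "is_flow G (F + c *\<^sub>R ?I)" "strength G (F + c *\<^sub>R ?I) = 1"
        using I(1) F(1,3) unfolding turbulence_recession_cone_def nonneg_flows_of_strength_def
        by (auto simp: is_flow_add is_flow_scale strength_add strength_scale)
      ultimately show ?thesis
        by (simp add: turbulence_polyhedron_def nonneg_flows_of_strength_def)
    qed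
    then have "F + t *\<^sub>R ?I \<in> turbulence_polyhedron G" "F + (- t) *\<^sub>R ?I \<in> turbulence_polyhedron G"
      by blast+
    moreover have "F \<in> open_segment (F + t *\<^sub>R ?I) (F + (- t) *\<^sub>R ?I)"
    proof -
      have "?I \<noteq> 0"
      proof
        assume "?I = 0"
        then have "fst (hd B) \<notin> fst ` set B"
          using indicator_vector_eq_0_iff[of B "fst (hd B)"] by simp
        then show False
          using I(2) by simp
      qed
      moreover have "(t - (- t)) *\<^sub>R ?I = 0" if "F + t *\<^sub>R ?I = F + (- t) *\<^sub>R ?I"
        using that unfolding scaleR_diff_left by (simp only: add_left_cancel diff_self)
      ultimately have "F + t *\<^sub>R ?I \<noteq> F + (- t) *\<^sub>R ?I"
        using t(1) unfolding scaleR_eq_0_iff by auto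
      moreover have "F = (1 - 1 / 2) *\<^sub>R (F + t *\<^sub>R ?I) + (1 / 2) *\<^sub>R (F + (- t) *\<^sub>R ?I)"
        by (simp add: algebra_simps flip: scaleR_add_left)
      ultimately show ?thesis
        unfolding in_segment by (intro conjI exI[of _ "1 / 2"]) auto
    qed
    ultimately show ?thesis
      using seg by blast
  qed
qed

section \<open>The recession cone and its extremal rays\<close>

abbreviation bands :: "'e oriented_edge list set" where
  "bands \<equiv> {B. elementary_band G B \<and> self_compatible G R B}"

lemma bands_in_cone: "B \<in> bands \<Longrightarrow> indicator_vector B \<in> turbulence_recession_cone G"
  using band_in_recession_cone by (auto simp: elementary_band_def simple_band_def barbell_def)

text \<open>All entries are natural numbers and both vectors have an entry 1. One of these entries
  makes \<open>c\<close> a natural number, the other makes it a divisor of 1.\<close>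

lemma band_multiple_eq:
  assumes "B \<in> bands" "C \<in> bands" "indicator_vector B = c *\<^sub>R indicator_vector C"
  shows "c = 1"
proof -
  obtain d where d: "indicator_vector B $ d = 1"
    using elementary_band_count[of B] assms(1) by (auto simp: indicator_vector_nth)
  obtain e where e: "indicator_vector C $ e = 1"
    using elementary_band_count[of C] assms(2) by (auto simp: indicator_vector_nth)
  obtain m n :: nat where "indicator_vector C $ d = real m" "indicator_vector B $ e = real n"
    by (simp add: indicator_vector_nth)
  then have "c * real m = 1" "c = real n"
    using arg_cong[OF assms(3), of "\<lambda>F. F $ d"] arg_cong[OF assms(3), of "\<lambda>F. F $ e"] d e by simp_all
  then have "real (n * m) = real 1"
    by simp
  then have "n = 1"
    using of_nat_eq_iff nat_mult_eq_1_iff by blast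
  then show ?thesis
    using \<open>c = real n\<close> by simp
qed

lemma band_multiple_if_support:
  assumes "B \<in> bands" "F \<in> turbulence_recession_cone G" "\<And>e. indicator_vector B $ e = 0 \<Longrightarrow> F $ e = 0" "F \<noteq> 0"
  shows "\<exists>c>0. F = c *\<^sub>R indicator_vector B"
proof -
  have F: "is_flow G F" "\<And>e. F $ e \<ge> 0"
    using assms(2) by (auto simp: turbulence_recession_cone_def nonneg_flows_of_strength_def)
  obtain c where c: "F = c *\<^sub>R indicator_vector B"
    using elementary_minimal[of B F] assms(1,3) F(1) indicator_vector_eq_0_iff[of B] by blast
  obtain e where "indicator_vector B $ e = 1"
    using elementary_band_count[of B] assms(1) by (auto simp: indicator_vector_nth)
  then have "c \<ge> 0"
    using F(2)[of e] c by simp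
  moreover have "c \<noteq> 0"
    using assms(4) c by auto
  ultimately have "c > 0"
    by simp
  then show ?thesis
    using c by blast
qed

text \<open>An indicator vector of a band in \<open>bands\<close> is determined by its set of zeros,
  and there are only finitely many sets of edges.\<close>

lemma finite_bands: "finite (indicator_vector ` bands)"
proof -
  have "inj_on (\<lambda>F. {e. F $ e = 0}) (indicator_vector ` bands)"
  proof (rule inj_onI)
    fix F F' assume "F \<in> indicator_vector ` bands" "F' \<in> indicator_vector ` bands" and eq: "{e. F $ e = 0} = {e. F' $ e = 0}"
    then obtain B C where B: "B \<in> bands" "F = indicator_vector B" and C: "C \<in> bands" "F' = indicator_vector C"
      by blast
    obtain e where "indicator_vector B $ e = 1"
      using elementary_band_count[of B] B(1) by (auto simp: indicator_vector_nth)
    then have "F \<noteq> 0"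
      using B(2) by auto
    then obtain c where c: "indicator_vector B = c *\<^sub>R indicator_vector C"
      using band_multiple_if_support[OF C(1) bands_in_cone[OF B(1)]] eq unfolding B(2) C(2) by blast
    then show "F = F'"
      using band_multiple_eq[OF B(1) C(1) c] unfolding B(2) C(2) by simp
  qed
  then show ?thesis
    by (rule finite_imageD[rotated]) simp
qed

lemma convex_cone_recession: "convex_cone (turbulence_recession_cone G)"
proof (rule convex_coneI)
  have "is_flow G 0" "strength G 0 = 0"
    by (simp_all add: is_flow_def strength_def)
  then have "0 \<in> turbulence_recession_cone G"
    by (simp add: turbulence_recession_cone_def nonneg_flows_of_strength_def)
  then show "turbulence_recession_cone G \<noteq> {}"
    by blast
qed (auto simp: turbulence_recession_cone_def nonneg_flows_of_strength_def
    is_flow_add is_flow_scale strength_add strength_scale)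

text \<open>Strength 0 and nonnegativity empty all fringe edges, in particular the first edge of a
  route.\<close>

lemma recession_cone_no_route:
  assumes "F \<in> turbulence_recession_cone G" "route G p"
  shows "\<exists>x \<in> set p. F $ fst x = 0"
proof -
  have F: "\<And>e. F $ e \<ge> 0" "(\<Sum>x | fringe G (vert G x). F $ fst x) = 0"
    using assms(1) by (auto simp: turbulence_recession_cone_def nonneg_flows_of_strength_def strength_def)
  have "p \<noteq> []" "fringe G (vert G (hd p))"
    using assms(2) by (simp_all add: route_def)
  then have "F $ fst (hd p) = 0"
    using sum_nonneg_eq_0_iff[THEN iffD1, OF finite _ F(2)] F(1) by blast
  then show ?thesis
    using \<open>p \<noteq> []\<close> hd_in_set by blast
qed

text \<open>A nonzero element contains a band, since it cannot contain a route. Subtracting the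
  largest possible multiple of that band keeps it in the cone and shrinks its support.\<close>

lemma recession_cone_generated: "convex_cone hull (indicator_vector ` bands) = turbulence_recession_cone G"
proof
  show "convex_cone hull (indicator_vector ` bands) \<subseteq> turbulence_recession_cone G"
    using bands_in_cone convex_cone_recession by (intro hull_minimal) auto
  have "F \<in> convex_cone hull (indicator_vector ` bands)" if "F \<in> turbulence_recession_cone G" for F
    using that
  proof (induction "card {e. F $ e \<noteq> 0}" arbitrary: F rule: less_induct)
    case less
    have F: "is_flow G F" "\<And>e. F $ e \<ge> 0" "strength G F = 0"
      using less.prems by (auto simp: turbulence_recession_cone_def nonneg_flows_of_strength_def)
    show ?case
    proof (cases "F = 0")
      case True
      then show ?thesis
        by (simp add: convex_cone_hull_contains_0)
    next
      case False
      have "\<not> (\<forall>x \<in> set p. F $ fst x > 0)" if "elementary_route G R p" for p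
      proof -
        have "route G p"
          using that by (auto simp: elementary_route_def simple_route_def lollipop_def)
        then obtain x where "x \<in> set p" "F $ fst x = 0"
          using recession_cone_no_route[OF less.prems] by blast
        then show ?thesis
          by (metis less_irrefl)
      qed
      then obtain B where B: "B \<in> bands" "\<forall>x \<in> set B. F $ fst x > 0"
        using flow_contains_trail[OF F(1,2) False] by blast
      let ?I = "indicator_vector B"
      have "B \<noteq> []"
        using B(1) by (auto simp: elementary_band_def simple_band_def barbell_def band_def)
      then obtain t e where t: "t > 0" "\<And>e. F $ e \<ge> t * ?I $ e" "e \<in> fst ` set B" "F $ e = t * ?I $ e"
        using subtract_multiple[OF F(2)] B(2) by blast
      let ?F' = "F + (- t) *\<^sub>R ?I"
      have I: "is_flow G ?I" "strength G ?I = 0"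
        using bands_in_cone[OF B(1)] by (auto simp: turbulence_recession_cone_def nonneg_flows_of_strength_def)
      have "is_flow G ?F'" "strength G ?F' = 0"
        using F(1,3) I by (auto simp: is_flow_add is_flow_scale strength_add strength_scale simp del: scaleR_minus_left)
      then have F': "?F' \<in> turbulence_recession_cone G"
        using t(2) by (simp add: turbulence_recession_cone_def nonneg_flows_of_strength_def)
      have "{d. ?F' $ d \<noteq> 0} \<subset> {d. F $ d \<noteq> 0}"
      proof
        show "{d. ?F' $ d \<noteq> 0} \<subseteq> {d. F $ d \<noteq> 0}"
        proof clarify
          fix d assume d: "?F' $ d \<noteq> 0" "F $ d = 0"
          then have "t * ?I $ d \<le> 0"
            using t(2)[of d] by simp
          then have "?I $ d = 0"
            using t(1) indicator_vector_nonneg[of B d] by (simp add: mult_le_0_iff)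
          then show False
            using d by simp
        qed
        have "F $ e \<noteq> 0"
          using B(2) t(3) by force
        moreover have "?F' $ e = 0"
          using t(4) by simp
        ultimately show "{d. ?F' $ d \<noteq> 0} \<noteq> {d. F $ d \<noteq> 0}"
          by blast
      qed
      then have "?F' \<in> convex_cone hull (indicator_vector ` bands)"
        using F' by (intro less.hyps) (auto intro: psubset_card_mono)
      moreover have "t *\<^sub>R ?I \<in> convex_cone hull (indicator_vector ` bands)"
        using B(1) t(1) by (intro convex_cone_hull_mul hull_inc) auto
      ultimately have "?F' + t *\<^sub>R ?I \<in> convex_cone hull (indicator_vector ` bands)"
        by (rule convex_cone_hull_add)
      then show ?thesis
        by simp
    qed
  qed
  then show "turbulence_recession_cone G \<subseteq> convex_cone hull (indicator_vector ` bands)"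
    by blast
qed

text \<open>Extremality of the ray, in the form that holds for any generating set: elements that use
  an edge outside the support of \<open>B\<close> cannot combine to its indicator vector.\<close>

lemma generating_set_contains_band:
  assumes S: "convex_cone hull S = turbulence_recession_cone G" and B: "B \<in> bands"
  shows "\<exists>y\<in>S. \<exists>c>0. y = c *\<^sub>R indicator_vector B"
proof (rule ccontr)
  assume n: "\<not> ?thesis"
  let ?I = "indicator_vector B"
  \<comment> \<open>As all entries are nonnegative, being positive somewhere outside the support of
    \<open>B\<close> survives addition. So this is a convex cone; without multiples of
    \<open>B\<close>, the set \<open>S\<close> lies in it, but the indicator vector of
    \<open>B\<close> does not.\<close>
  let ?K = "{z \<in> turbulence_recession_cone G. z = 0 \<or> (\<exists>e. ?I $ e = 0 \<and> z $ e > 0)}"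
  have nonneg: "z $ e \<ge> 0" if "z \<in> turbulence_recession_cone G" for z e
    using that by (simp add: turbulence_recession_cone_def nonneg_flows_of_strength_def)
  have "S \<subseteq> ?K"
  proof
    fix y assume y: "y \<in> S"
    have yC: "y \<in> turbulence_recession_cone G"
      using hull_inc[OF y, of convex_cone] unfolding S .
    moreover have "\<exists>e. ?I $ e = 0 \<and> y $ e > 0" if "y \<noteq> 0"
    proof (rule ccontr)
      assume "\<not> ?thesis"
      then have "y $ e = 0" if "?I $ e = 0" for e
        using nonneg[OF yC, of e] that by force
      then show False
        using band_multiple_if_support[OF B yC] \<open>y \<noteq> 0\<close> n y by blast
    qed
    ultimately show "y \<in> ?K"
      by blast
  qed
  moreover have "convex_cone ?K"
  proof (rule convex_coneI)
    have "0 \<in> turbulence_recession_cone G"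
      using convex_cone_recession by (simp add: convex_cone_iff)
    then show "?K \<noteq> {}"
      by blast
    fix x y assume x: "x \<in> ?K" and y: "y \<in> ?K"
    have "x + y \<in> turbulence_recession_cone G"
      using convex_cone_recession x y by (simp add: convex_cone_iff)
    moreover have "\<exists>e. ?I $ e = 0 \<and> (x + y) $ e > 0" if "x + y \<noteq> 0"
    proof -
      have "x \<noteq> 0 \<or> y \<noteq> 0"
        using that by auto
      then obtain e where "?I $ e = 0" "x $ e > 0 \<or> y $ e > 0"
        using x y by blast
      moreover have "x $ e \<ge> 0" "y $ e \<ge> 0"
        using nonneg x y by blast+
      ultimately have "?I $ e = 0 \<and> (x + y) $ e > 0"
        by auto
      then show ?thesis
        by blast
    qed
    ultimately show "x + y \<in> ?K"
      by blast
  next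
    fix x and c :: real assume x: "x \<in> ?K" and c: "0 \<le> c"
    have "c *\<^sub>R x \<in> turbulence_recession_cone G"
      using convex_cone_recession x c by (simp add: convex_cone_iff)
    moreover have "\<exists>e. ?I $ e = 0 \<and> (c *\<^sub>R x) $ e > 0" if "c *\<^sub>R x \<noteq> 0"
    proof -
      have "x \<noteq> 0" "c > 0"
        using that c by (auto simp: order_le_less)
      then obtain e where "?I $ e = 0" "x $ e > 0"
        using x by blast
      then have "?I $ e = 0 \<and> (c *\<^sub>R x) $ e > 0"
        using \<open>c > 0\<close> by simp
      then show ?thesis
        by blast
    qed
    ultimately show "c *\<^sub>R x \<in> ?K"
      by blast
  qed
  ultimately have "convex_cone hull S \<subseteq> ?K"
    by (rule hull_minimal)
  then have "?I \<in> ?K"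
    using S bands_in_cone[OF B] by blast
  moreover obtain e where "?I $ e = 1"
    using elementary_band_count[of B] B by (auto simp: indicator_vector_nth)
  ultimately show False
    by auto
qed

lemma extremal_rays_eq: "extremal_rays (turbulence_recession_cone G) = (\<lambda>B. ray (indicator_vector B)) ` bands"
proof
  let ?C = "turbulence_recession_cone G"
  let ?V = "indicator_vector ` bands"
  have ray_scale: "ray (c *\<^sub>R x) = ray x" if "c > 0" for c and x :: "real ^ 'e"
  proof
    show "ray (c *\<^sub>R x) \<subseteq> ray x"
    proof
      fix y assume "y \<in> ray (c *\<^sub>R x)"
      then obtain t where "t > 0" "y = t *\<^sub>R c *\<^sub>R x"
        by (auto simp: ray_def)
      then have "y = (t * c) *\<^sub>R x" "t * c > 0"
        using that by simp_all
      then show "y \<in> ray x"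
        unfolding ray_def by blast
    qed
    show "ray x \<subseteq> ray (c *\<^sub>R x)"
    proof
      fix y assume "y \<in> ray x"
      then obtain t where "t > 0" "y = t *\<^sub>R x"
        by (auto simp: ray_def)
      then have "y = (t / c) *\<^sub>R c *\<^sub>R x" "t / c > 0"
        using that by simp_all
      then show "y \<in> ray (c *\<^sub>R x)"
        unfolding ray_def by blast
    qed
  qed
  show "extremal_rays ?C \<subseteq> (\<lambda>B. ray (indicator_vector B)) ` bands"
  proof
    fix r assume "r \<in> extremal_rays ?C"
    then obtain x S where S: "convex_cone hull S = ?C" "\<And>T. T \<subset> S \<Longrightarrow> convex_cone hull T \<noteq> ?C" "x \<in> S" "r = ray x"
      by (auto simp: extremal_rays_def minimal_generating_set_def)
    \<comment> \<open>The members of \<open>S\<close> on band rays still generate every band, hence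
      the whole cone, so by minimality they are all of \<open>S\<close>.\<close>
    define T where "T = {y \<in> S. \<exists>B\<in>bands. \<exists>c>0. y = c *\<^sub>R indicator_vector B}"
    have "indicator_vector B \<in> convex_cone hull T" if B: "B \<in> bands" for B
    proof -
      obtain y c where y: "y \<in> S" "c > 0" "y = c *\<^sub>R indicator_vector B"
        using generating_set_contains_band[OF S(1) B] by blast
      then have "(1 / c) *\<^sub>R y \<in> convex_cone hull T"
        using B by (intro convex_cone_hull_mul hull_inc) (auto simp: T_def)
      then show ?thesis
        using y by simp
    qed
    then have "convex_cone hull ?V \<subseteq> convex_cone hull T"
      by (intro hull_minimal convex_cone_convex_cone_hull) blast
    moreover have "convex_cone hull T \<subseteq> convex_cone hull S"
      by (rule hull_mono) (auto simp: T_def)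
    ultimately have "convex_cone hull T = ?C"
      using recession_cone_generated S(1) by blast
    then have "T = S"
      using S(2)[of T] by (auto simp: T_def)
    then obtain B c where "B \<in> bands" "c > 0" "x = c *\<^sub>R indicator_vector B"
      using S(3) unfolding T_def by blast
    then show "r \<in> (\<lambda>B. ray (indicator_vector B)) ` bands"
      using S(4) ray_scale by blast
  qed
  show "(\<lambda>B. ray (indicator_vector B)) ` bands \<subseteq> extremal_rays ?C"
  proof
    fix r assume "r \<in> (\<lambda>B. ray (indicator_vector B)) ` bands"
    then obtain B where B: "B \<in> bands" "r = ray (indicator_vector B)"
      by blast
    \<comment> \<open>The indicator vectors form a finite generating set, which contains a minimal
      one. By \<open>generating_set_contains_band\<close> this one still meets the ray of
      \<open>B\<close>.\<close>
    let ?A = "{S. S \<subseteq> ?V \<and> convex_cone hull S = ?C}"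
    have "finite ?A"
      using finite_bands by simp
    moreover have "?V \<in> ?A"
      using recession_cone_generated by simp
    then have "?A \<noteq> {}"
      by (metis empty_iff)
    ultimately have "\<exists>S\<in>?A. \<forall>T\<in>?A. T \<subseteq> S \<longrightarrow> S = T"
      by (rule finite_has_minimal)
    then obtain S where S: "S \<in> ?A" "\<And>T. T \<in> ?A \<Longrightarrow> T \<subseteq> S \<Longrightarrow> S = T"
      by (elim bexE) (metis (no_types))
    have "convex_cone hull T \<noteq> ?C" if "T \<subset> S" for T
      using S(1) S(2)[of T] that by blast
    then have "minimal_generating_set ?C S"
      using S(1) by (simp add: minimal_generating_set_def)
    moreover obtain y c where y: "y \<in> S" "c > 0" "y = c *\<^sub>R indicator_vector B"
      using generating_set_contains_band[OF _ B(1), of S] S(1) by blast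
    ultimately have "ray y \<in> extremal_rays ?C"
      unfolding extremal_rays_def by blast
    then show "r \<in> extremal_rays ?C"
      using B(2) y ray_scale by metis
  qed
qed

end

theorem theorem8p7:
  fixes G :: "('v, 'e::finite) chart" and R :: "('v, 'e) framing"
  assumes "turbulence_chart G" and "is_framing G R"
  shows "bij_betw (\<lambda>c. the_elem (indicator_vector ` c))
           ({p. elementary_route G R p} // route_equiv)
           {x. x extreme_point_of turbulence_polyhedron G}
       \<and> bij_betw (\<lambda>c. ray (the_elem (indicator_vector ` c)))
           ({B. elementary_band G B \<and> self_compatible G R B} // band_equiv)
           (extremal_rays (turbulence_recession_cone G))"
proof
  interpret framed_turbulence G R
    by unfold_locales (rule assms)+
  have vertices: "{x. x extreme_point_of turbulence_polyhedron G} = indicator_vector ` {p. elementary_route G R p}"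
    using route_extreme extreme_is_route by blast
  show "bij_betw (\<lambda>c. the_elem (indicator_vector ` c)) ({p. elementary_route G R p} // route_equiv)
      {x. x extreme_point_of turbulence_polyhedron G}"
    unfolding vertices
  proof (rule bij_betw_quotient[where g = "\<lambda>x. x", OF equiv_route_equiv])
    show "indicator_vector p = indicator_vector q" if "(p, q) \<in> route_equiv" for p q :: "'e oriented_edge list"
      using that by (auto simp: route_equiv_def)
  qed (use elementary_route_unique in blast)
  have "(B, C) \<in> band_equiv" if B: "B \<in> bands" and C: "C \<in> bands" and eq: "ray (indicator_vector B) = ray (indicator_vector C)" for B C
  proof -
    have "indicator_vector B \<in> ray (indicator_vector B)"
      by (auto simp: ray_def intro: exI[of _ 1])
    then obtain t where t: "indicator_vector B = t *\<^sub>R indicator_vector C"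
      unfolding eq by (auto simp: ray_def)
    then have "indicator_vector B = indicator_vector C"
      using band_multiple_eq[OF B C t] by simp
    then show ?thesis
      using elementary_band_unique B C by blast
  qed
  then show "bij_betw (\<lambda>c. ray (the_elem (indicator_vector ` c))) (bands // band_equiv)
      (extremal_rays (turbulence_recession_cone G))"
    unfolding extremal_rays_eq
    by (intro bij_betw_quotient equiv_band_equiv band_equiv_indicator[symmetric])
qed

end
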